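(* Consider density estimation on $[0,1]$, suppose the true density $f_0\in C[0,1]$ is bounded away from zero, and let $\alpha_n\in(0,1]$ with $n\alpha_n\to\infty$. Let $W$ be a mean-zero Gaussian process in $(C[0,1],\|\cdot\|_\infty)$ with RKHS $\mathbb H$, and let the prior $\Pi$ on densities be the law of $f=f_W$, $f_W(x)=e^{W(x)}/\int_0^1e^{W(y)}dy$. Suppose that $\varepsilon_n\to0$ satisfies $\varphi_{\eta_0}(\varepsilon_n)\le n\alpha_n\varepsilon_n^2$ with $\eta_0=\log f_0$. Let $\psi$ be a functional on densities with expansion $$\psi(f)-\psi(f_0)=\int\tilde\psi_{f_0}f+\tilde r(f,f_0),\qquad\int\tilde\psi_{f_0}f_0=0,$$ where $\tilde\psi_{f_0}:[0,1]\to\mathbb R$ is continuous, satisfying $$\sup_{f\in A_n}|\tilde r(f,f_0)|=o_P\Big(\frac1{\sqrt{n\alpha_n}}\Big)$$ for some measurable $A_n\subset\{f:\|f-f_0\|_1\le\varepsilon_n\}$ with $\Pi_{\alpha_n}(A_n\mid Y^n)=1+o_P(1)$. Further assume that there exist sequences $\psi_n\in\mathbb H$ and $\zeta_n\to0$ such that $$\|\psi_n-\tilde\psi_{f_0}\|_\infty\le\zeta_n,\qquad\|\psi_n\|_{\mathbb H}\le\sqrt{n\alpha_n}\,\zeta_n,\qquad\sqrt{n\alpha_n}\,\varepsilon_n\zeta_n\to0.$$ Then, with $\hat\psi=\psi(f_0)+\frac1n\sum_{i=1}^n\tilde\psi_{f_0}(Y_i)$, the $\alpha_n$-posterior distribution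 of $\sqrt{n\alpha_n}(\psi(f)-\hat\psi)$ converges weakly in $P_0$-probability to a Gaussian distribution with mean $0$ and variance $\int_0^1\tilde\psi_{f_0}^2f_0$.
   Context: Density estimation: one observes $Y^n=(Y_1,\dots,Y_n)$ i.i.d. from a density $f$ on $[0,1]$; $\ell_n(f)=\sum_i\log f(Y_i)$; $P_0$ is the law under $f_0$ and $o_P$ is in $P_0$-probability. The $\alpha_n$-posterior is $\Pi_{\alpha_n}(B\mid Y^n)=\int_Be^{\alpha_n\ell_n}d\Pi/\int e^{\alpha_n\ell_n}d\Pi$. For a mean-zero Gaussian random element $W$ of a Banach space $(\mathbb B,\|\cdot\|)$ with RKHS $(\mathbb H,\|\cdot\|_{\mathbb H})$, the concentration function at $\eta_0\in\mathbb B$ is $$\varphi_{\eta_0}(\varepsilon)=-\log P(\|W\|\le\varepsilon)+\tfrac12\inf_{h\in\mathbb H:\|h-\eta_0\|<\varepsilon}\|h\|_{\mathbb H}^2;$$ here $(\mathbb B,\|\cdot\|)=(C[0,1],\|\cdot\|_\infty)$. A data-dependent law $Q_Y$ on $\mathbb R$ converges weakly in $P_0$-probability to $\mathcal N(0,V)$ if $d_{BL}(Q_Y,\mathcal N(0,V))\to0$ in $P_0$-probability, with $d_{BL}$ the bounded Lipschitz distance; the $\alpha_n$-posterior distribution of a function of $f$ is the push-forward of $\Pi_{\alpha_n}(\cdot\mid Y^n)$ by that function. *)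

theory Defs
  imports "HOL-Probability.Probability"
begin

section \<open>The space $C[0,1]$\<close>

typedef unit_interval = "{0..1::real}"
  by (rule exI[of _ 0]) simp

instantiation unit_interval :: metric_space
begin

definition dist_unit_interval :: "unit_interval \<Rightarrow> unit_interval \<Rightarrow> real"
  where "dist_unit_interval x y = dist (Rep_unit_interval x) (Rep_unit_interval y)"

definition uniformity_unit_interval :: "(unit_interval \<times> unit_interval) filter"
  where "uniformity_unit_interval = (INF e\<in>{0<..}. principal {(x, y). dist x y < e})"

definition open_unit_interval :: "unit_interval set \<Rightarrow> bool"
  where "open_unit_interval U = (\<forall>x\<in>U. \<forall>\<^sub>F (x', y) in uniformity. x' = x \<longrightarrow> y \<in> U)"

instance
proof
  fix x y z :: unit_interval
  show "dist x y = 0 \<longleftrightarrow> x = y"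
    by (simp add: dist_unit_interval_def Rep_unit_interval_inject)
  show "dist x y \<le> dist x z + dist y z"
    unfolding dist_unit_interval_def by (rule dist_triangle2)
qed (rule uniformity_unit_interval_def open_unit_interval_def)+

end

lemma continuous_on_Abs_unit_interval: "continuous_on {0..1} Abs_unit_interval"
  by (auto simp: continuous_on_iff dist_unit_interval_def Abs_unit_interval_inverse)

lemma compact_UNIV_unit_interval: "compact (UNIV :: unit_interval set)"
proof -
  have "(UNIV :: unit_interval set) = Abs_unit_interval ` {0..1}"
    by (auto simp: image_iff) (metis Abs_unit_interval_cases atLeastAtMost_iff)
  then show ?thesis
    using compact_continuous_image[OF continuous_on_Abs_unit_interval compact_Icc] by simp
qed

text \<open>Since the unit interval is compact, the bounded continuous functions on it, with their
  supremum norm, are exactly the Banach space $(C[0,1], \|\cdot\|_\infty)$.\<close>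

type_synonym C01 = "unit_interval \<Rightarrow>\<^sub>C real"

lemma continuous_in_bcontfun:
  fixes f :: "unit_interval \<Rightarrow> real"
  assumes "continuous_on UNIV f"
  shows "f \<in> bcontfun"
  using assms compact_imp_bounded[OF compact_continuous_image[OF assms compact_UNIV_unit_interval]]
  by (simp add: bcontfun_def)

lemma apply_Bcontfun_continuous:
  fixes f :: "unit_interval \<Rightarrow> real"
  assumes "continuous_on UNIV f"
  shows "apply_bcontfun (Bcontfun f) = f"
  by (rule Bcontfun_inverse[OF continuous_in_bcontfun[OF assms]])

definition leb01 :: "unit_interval measure"
  where "leb01 = distr (restrict_space lborel {0..1}) borel Abs_unit_interval"

lemma measurable_Abs_unit_interval:
  "Abs_unit_interval \<in> measurable (restrict_space lborel {0..1}) borel"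
  using borel_measurable_continuous_on_restrict[OF continuous_on_Abs_unit_interval]
  by (simp add: measurable_cong_sets[OF sets_restrict_space_cong[OF sets_lborel] refl])

lemma prob_space_leb01: "prob_space leb01"
  unfolding leb01_def
  by (intro prob_space.prob_space_distr measurable_Abs_unit_interval prob_spaceI)
     (simp add: space_restrict_space emeasure_restrict_space)


section \<open>Gaussian random elements, RKHS and concentration function\<close>

text \<open>The affine form includes the degenerate case \<^term>\<open>V = 0\<close> (a Dirac measure), which
  \<^const>\<open>normal_density\<close> does not.\<close>

definition gaussian :: "real \<Rightarrow> real \<Rightarrow> real measure"
  where "gaussian m V = distr std_normal_distribution borel (\<lambda>z. m + sqrt V * z)"

definition centered_gaussian_element ::
    "'w measure \<Rightarrow> ('w \<Rightarrow> 'b::real_normed_vector) \<Rightarrow> bool"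
  where "centered_gaussian_element M W \<longleftrightarrow>
    prob_space M \<and> W \<in> borel_measurable M \<and>
    (\<forall>b::'b \<Rightarrow> real. bounded_linear b \<longrightarrow>
      (\<exists>V\<ge>0. distr M borel (\<lambda>\<omega>. b (W \<omega>)) = gaussian 0 V))"

definition has_pettis_integral ::
    "'w measure \<Rightarrow> ('w \<Rightarrow> 'b::real_normed_vector) \<Rightarrow> 'b \<Rightarrow> bool"
  where "has_pettis_integral M X v \<longleftrightarrow>
    (\<forall>b::'b \<Rightarrow> real. bounded_linear b \<longrightarrow> has_bochner_integral M (\<lambda>\<omega>. b (X \<omega>)) (b v))"

text \<open>The RKHS is the completion of $\{E[b(W) W] : b \in B^*\}$ under
  $\langle E[b_1(W) W], E[b_2(W) W]\rangle = E[b_1(W) b_2(W)]$. Realised inside the Banach space,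
  its elements are the Pettis integrals $h = E[L W]$ with $L$ in the $L^2$-closure of
  $\{b(W) : b \in B^*\}$, and $\|h\|$ is the $L^2$-norm of $L$.\<close>

definition rkhs_representer ::
    "'w measure \<Rightarrow> ('w \<Rightarrow> 'b::real_normed_vector) \<Rightarrow> 'b \<Rightarrow> ('w \<Rightarrow> real) \<Rightarrow> bool"
  where "rkhs_representer M W h L \<longleftrightarrow>
    L \<in> borel_measurable M \<and> integrable M (\<lambda>\<omega>. (L \<omega>)\<^sup>2) \<and>
    (\<exists>b::nat \<Rightarrow> 'b \<Rightarrow> real. (\<forall>k. bounded_linear (b k)) \<and>
      (\<lambda>k. \<integral>\<^sup>+\<omega>. ennreal ((b k (W \<omega>) - L \<omega>)\<^sup>2) \<partial>M) \<longlonglongrightarrow> 0) \<and>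
    has_pettis_integral M (\<lambda>\<omega>. L \<omega> *\<^sub>R W \<omega>) h"

definition rkhs :: "'w measure \<Rightarrow> ('w \<Rightarrow> 'b::real_normed_vector) \<Rightarrow> 'b set"
  where "rkhs M W = {h. \<exists>L. rkhs_representer M W h L}"

definition rkhs_norm :: "'w measure \<Rightarrow> ('w \<Rightarrow> 'b::real_normed_vector) \<Rightarrow> 'b \<Rightarrow> real"
  where "rkhs_norm M W h =
    (THE r. \<exists>L. rkhs_representer M W h L \<and> r = sqrt (\<integral>\<omega>. (L \<omega>)\<^sup>2 \<partial>M))"

lemma rkhs_representer_unique:
  fixes W :: "'w \<Rightarrow> 'b::real_normed_vector"
  assumes W: "W \<in> borel_measurable M"
    and L: "rkhs_representer M W h L" and L': "rkhs_representer M W h L'"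
  shows "AE \<omega> in M. L \<omega> = L' \<omega>"
proof -
  obtain b where b: "\<And>k. bounded_linear (b k)"
    and lim: "(\<lambda>k. \<integral>\<^sup>+\<omega>. ennreal ((b k (W \<omega>) - L \<omega>)\<^sup>2) \<partial>M) \<longlonglongrightarrow> 0"
    using L unfolding rkhs_representer_def by blast
  obtain b' where b': "\<And>k. bounded_linear (b' k)"
    and lim': "(\<lambda>k. \<integral>\<^sup>+\<omega>. ennreal ((b' k (W \<omega>) - L' \<omega>)\<^sup>2) \<partial>M) \<longlonglongrightarrow> 0"
    using L' unfolding rkhs_representer_def by blast
  have [measurable]: "L \<in> borel_measurable M" "L' \<in> borel_measurable M"
    and sq: "integrable M (\<lambda>\<omega>. (L \<omega>)\<^sup>2)" "integrable M (\<lambda>\<omega>. (L' \<omega>)\<^sup>2)"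
    using L L' unfolding rkhs_representer_def by auto
  have bm [measurable]: "(\<lambda>\<omega>. c (W \<omega>)) \<in> borel_measurable M" if "bounded_linear c" for c :: "'b \<Rightarrow> real"
    using measurable_compose[OF W borel_measurable_continuous_onI[OF linear_continuous_on[OF that]]] .
  define D where "D = (\<lambda>\<omega>. L \<omega> - L' \<omega>)"
  have [measurable]: "D \<in> borel_measurable M" unfolding D_def by measurable
  have sqb: "(x - y)\<^sup>2 \<le> 2 * x\<^sup>2 + 2 * y\<^sup>2" for x y :: real
    using zero_le_power2[of "x + y"] by (simp add: power2_eq_square algebra_simps)
  have iD: "integrable M (\<lambda>\<omega>. (D \<omega>)\<^sup>2)"
    by (rule Bochner_Integration.integrable_bound[of _ "\<lambda>\<omega>. 2 * (L \<omega>)\<^sup>2 + 2 * (L' \<omega>)\<^sup>2"])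
       (use sq sqb in \<open>auto simp: D_def\<close>)
  have orth: "has_bochner_integral M (\<lambda>\<omega>. c (W \<omega>) * D \<omega>) 0" if c: "bounded_linear c" for c :: "'b \<Rightarrow> real"
  proof -
    interpret bounded_linear c by (rule c)
    have "has_bochner_integral M (\<lambda>\<omega>. c (L \<omega> *\<^sub>R W \<omega>)) (c h)"
      "has_bochner_integral M (\<lambda>\<omega>. c (L' \<omega> *\<^sub>R W \<omega>)) (c h)"
      using L L' c unfolding rkhs_representer_def has_pettis_integral_def by auto
    from has_bochner_integral_diff[OF this] show ?thesis
      by (simp add: scaleR D_def algebra_simps)
  qed
  define I where "I = (\<lambda>k. \<integral>\<^sup>+\<omega>. ennreal ((b k (W \<omega>) - L \<omega>)\<^sup>2) \<partial>M)"
  define I' where "I' = (\<lambda>k. \<integral>\<^sup>+\<omega>. ennreal ((b' k (W \<omega>) - L' \<omega>)\<^sup>2) \<partial>M)"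
  have bound: "(\<integral>\<^sup>+\<omega>. ennreal ((D \<omega>)\<^sup>2) \<partial>M) \<le> 2 * I k + 2 * I' k" for k
  proof -
    define c where "c = (\<lambda>x. b k x - b' k x)"
    have c: "bounded_linear c"
      unfolding c_def by (rule bounded_linear_sub[OF b b'])
    have le: "ennreal (2 * (c (W \<omega>) * D \<omega>)) \<le> ennreal ((c (W \<omega>))\<^sup>2 + (D \<omega>)\<^sup>2)" for \<omega>
      using zero_le_power2[of "c (W \<omega>) - D \<omega>"]
      by (intro ennreal_leI) (simp add: power2_eq_square algebra_simps)
    have pt: "(D \<omega>)\<^sup>2 - 2 * (c (W \<omega>) * D \<omega>) \<le> 2 * (b k (W \<omega>) - L \<omega>)\<^sup>2 + 2 * (b' k (W \<omega>) - L' \<omega>)\<^sup>2" for \<omega>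
    proof -
      have "(D \<omega>)\<^sup>2 - 2 * (c (W \<omega>) * D \<omega>) \<le> (c (W \<omega>) - D \<omega>)\<^sup>2"
        by (simp add: power2_eq_square algebra_simps)
      also have "c (W \<omega>) - D \<omega> = (b k (W \<omega>) - L \<omega>) - (b' k (W \<omega>) - L' \<omega>)"
        by (simp add: c_def D_def)
      also have "\<dots>\<^sup>2 \<le> 2 * (b k (W \<omega>) - L \<omega>)\<^sup>2 + 2 * (b' k (W \<omega>) - L' \<omega>)\<^sup>2"
        by (rule sqb)
      finally show ?thesis .
    qed
    have i1: "integrable M (\<lambda>\<omega>. (D \<omega>)\<^sup>2 - 2 * (c (W \<omega>) * D \<omega>))"
      and e1: "(\<integral>\<omega>. (D \<omega>)\<^sup>2 - 2 * (c (W \<omega>) * D \<omega>) \<partial>M) = (\<integral>\<omega>. (D \<omega>)\<^sup>2 \<partial>M)"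
      using iD orth[OF c] by (auto simp: has_bochner_integral_iff)
    have "(\<integral>\<^sup>+\<omega>. ennreal ((D \<omega>)\<^sup>2) \<partial>M) = ennreal (\<integral>\<omega>. (D \<omega>)\<^sup>2 - 2 * (c (W \<omega>) * D \<omega>) \<partial>M)"
      unfolding e1 by (rule nn_integral_eq_integral[OF iD]) auto
    also have "\<dots> \<le> (\<integral>\<^sup>+\<omega>. ennreal ((D \<omega>)\<^sup>2 - 2 * (c (W \<omega>) * D \<omega>)) \<partial>M)"
    proof -
      have "(\<integral>\<omega>. (D \<omega>)\<^sup>2 - 2 * (c (W \<omega>) * D \<omega>) \<partial>M) \<le>
          (\<integral>\<omega>. max 0 ((D \<omega>)\<^sup>2 - 2 * (c (W \<omega>) * D \<omega>)) \<partial>M)"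
        using i1 by (intro integral_mono) auto
      also have "ennreal \<dots> = (\<integral>\<^sup>+\<omega>. ennreal (max 0 ((D \<omega>)\<^sup>2 - 2 * (c (W \<omega>) * D \<omega>))) \<partial>M)"
        using i1 by (intro nn_integral_eq_integral[symmetric]) auto
      also have "\<dots> = (\<integral>\<^sup>+\<omega>. ennreal ((D \<omega>)\<^sup>2 - 2 * (c (W \<omega>) * D \<omega>)) \<partial>M)"
        by (intro nn_integral_cong) (auto simp: max_def ennreal_neg)
      finally show ?thesis
        by (simp add: ennreal_leI)
    qed
    also have "\<dots> \<le> (\<integral>\<^sup>+\<omega>. 2 * ennreal ((b k (W \<omega>) - L \<omega>)\<^sup>2) + 2 * ennreal ((b' k (W \<omega>) - L' \<omega>)\<^sup>2) \<partial>M)"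
      using pt by (intro nn_integral_mono)
        (simp add: ennreal_leI flip: ennreal_numeral ennreal_mult ennreal_plus)
    also have "\<dots> = 2 * I k + 2 * I' k"
      using b b' by (simp add: I_def I'_def nn_integral_add nn_integral_cmult)
    finally show ?thesis .
  qed
  have "(\<lambda>k. 2 * I k + 2 * I' k) \<longlonglongrightarrow> 2 * 0 + 2 * 0"
    using lim lim' unfolding I_def I'_def by (intro tendsto_add ennreal_tendsto_cmult) auto
  then have "(\<integral>\<^sup>+\<omega>. ennreal ((D \<omega>)\<^sup>2) \<partial>M) \<le> 0"
    using bound by (intro tendsto_lowerbound[where F = sequentially]) auto
  then show ?thesis
    by (simp add: nn_integral_0_iff_AE D_def)
qed

lemma rkhs_norm_eq:
  assumes W: "W \<in> borel_measurable M" and L: "rkhs_representer M W h L"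
  shows "rkhs_norm M W h = sqrt (\<integral>\<omega>. (L \<omega>)\<^sup>2 \<partial>M)"
  unfolding rkhs_norm_def
proof (rule the_equality)
  fix r assume "\<exists>L. rkhs_representer M W h L \<and> r = sqrt (\<integral>\<omega>. (L \<omega>)\<^sup>2 \<partial>M)"
  then obtain L' where L': "rkhs_representer M W h L'" and r: "r = sqrt (\<integral>\<omega>. (L' \<omega>)\<^sup>2 \<partial>M)"
    by blast
  have "(\<integral>\<omega>. (L' \<omega>)\<^sup>2 \<partial>M) = (\<integral>\<omega>. (L \<omega>)\<^sup>2 \<partial>M)"
    using rkhs_representer_unique[OF W L' L] L L'
    by (intro integral_cong_AE) (auto simp: rkhs_representer_def)
  then show "r = sqrt (\<integral>\<omega>. (L \<omega>)\<^sup>2 \<partial>M)" by (simp add: r)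
qed (use L in blast)

text \<open>Extended-real valued: $-\log 0 = \infty$, and the infimum over the empty set is $\infty$.\<close>

definition concentration_fun ::
    "'w measure \<Rightarrow> ('w \<Rightarrow> 'b::real_normed_vector) \<Rightarrow> 'b \<Rightarrow> real \<Rightarrow> ereal"
  where "concentration_fun M W \<eta> \<epsilon> =
    (let p = measure M {\<omega> \<in> space M. norm (W \<omega>) \<le> \<epsilon>}
     in (if p = 0 then \<infinity> else ereal (- ln p)))
    + ereal (1/2) * (INF h\<in>{h \<in> rkhs M W. norm (h - \<eta>) < \<epsilon>}. ereal ((rkhs_norm M W h)\<^sup>2))"


section \<open>Convergence in probability\<close>

text \<open>\<^term>\<open>small_o_P P X a\<close> says $X_n = o_P(a_n)$ for nonnegative, possibly infinite, $X_n$
  on the probability spaces $P_n$. The outer measure is the probability whenever the event is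
  measurable; it avoids that \<^const>\<open>measure\<close> is $0$ on nonmeasurable events.\<close>

definition small_o_P ::
    "(nat \<Rightarrow> 'a measure) \<Rightarrow> (nat \<Rightarrow> 'a \<Rightarrow> ennreal) \<Rightarrow> (nat \<Rightarrow> real) \<Rightarrow> bool"
  where "small_o_P P X a \<longleftrightarrow>
    (\<forall>\<delta>>0. (\<lambda>n. outer_measure_of (P n) {\<omega> \<in> space (P n). X n \<omega> > ennreal (\<delta> * a n)})
      \<longlonglongrightarrow> 0)"

definition d_BL :: "real measure \<Rightarrow> real measure \<Rightarrow> ennreal"
  where "d_BL Q R = (SUP g\<in>{g :: real \<Rightarrow> real. (\<forall>x. \<bar>g x\<bar> \<le> 1) \<and> 1-lipschitz_on UNIV g}.
    ennreal \<bar>(\<integral>x. g x \<partial>Q) - (\<integral>x. g x \<partial>R)\<bar>)"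

definition weakly_converges_in_prob ::
    "(nat \<Rightarrow> 'a measure) \<Rightarrow> (nat \<Rightarrow> 'a \<Rightarrow> real measure) \<Rightarrow> real measure \<Rightarrow> bool"
  where "weakly_converges_in_prob P Q R \<longleftrightarrow> small_o_P P (\<lambda>n \<omega>. d_BL (Q n \<omega>) R) (\<lambda>_. 1)"


section \<open>Density estimation\<close>

definition densities :: "C01 set"
  where "densities = {f :: C01. (\<forall>x. 0 \<le> f x) \<and> (\<integral>x. f x \<partial>leb01) = 1}"

definition density_space :: "C01 measure"
  where "density_space = restrict_space borel densities"

definition exp_density :: "C01 \<Rightarrow> C01"
  where "exp_density w = Bcontfun (\<lambda>x. exp (w x) / (\<integral>y. exp (w y) \<partial>leb01))"

definition log_density :: "C01 \<Rightarrow> C01"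
  where "log_density f = Bcontfun (\<lambda>x. ln (f x))"

lemma apply_log_density:
  fixes f :: C01
  assumes "\<And>x. 0 < f x"
  shows "apply_bcontfun (log_density f) = (\<lambda>x. ln (f x))"
  unfolding log_density_def using assms
  by (intro apply_Bcontfun_continuous continuous_intros) (auto simp: less_imp_neq[symmetric])

lemma integrable_leb01:
  fixes f :: "unit_interval \<Rightarrow> real"
  assumes "continuous_on UNIV f"
  shows "integrable leb01 f"
proof -
  interpret prob_space leb01 by (rule prob_space_leb01)
  obtain B where "\<And>x. norm (f x) \<le> B"
    using continuous_in_bcontfun[OF assms] by (auto simp: bcontfun_def bounded_iff)
  moreover have "f \<in> borel_measurable leb01"
    using borel_measurable_continuous_onI[OF assms] by (simp add: leb01_def)
  ultimately show ?thesis
    by (intro integrable_const_bound[of _ B]) auto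
qed

lemma
  fixes w :: C01
  shows apply_exp_density: "exp_density w x = exp (w x) / (\<integral>y. exp (w y) \<partial>leb01)"
    and exp_density_pos: "0 < exp_density w x"
    and exp_density_in_densities: "exp_density w \<in> densities"
proof -
  interpret prob_space leb01 by (rule prob_space_leb01)
  have c: "continuous_on UNIV (\<lambda>x. exp (w x))"
    by (intro continuous_intros continuous_on_apply_bcontfun)
  have pos: "0 < (\<integral>y. exp (w y) \<partial>leb01)"
  proof -
    have "(\<integral>y. 0 \<partial>leb01) < (\<integral>y. exp (w y) \<partial>leb01)"
      by (rule integral_less_AE_space) (use integrable_leb01[OF c] emeasure_space_1 in auto)
    then show ?thesis by simp
  qed
  have app: "exp_density w x = exp (w x) / (\<integral>y. exp (w y) \<partial>leb01)" for x
    unfolding exp_density_def using pos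
    by (subst apply_Bcontfun_continuous) (auto intro!: continuous_intros)
  then show "exp_density w x = exp (w x) / (\<integral>y. exp (w y) \<partial>leb01)"
    and "0 < exp_density w x" using pos by auto
  show "exp_density w \<in> densities"
    using pos by (auto simp: densities_def ext[of "apply_bcontfun (exp_density w)", OF app])
qed

definition density_prior :: "'w measure \<Rightarrow> ('w \<Rightarrow> C01) \<Rightarrow> C01 measure"
  where "density_prior M W = distr M density_space (\<lambda>\<omega>. exp_density (W \<omega>))"

definition data_law :: "C01 \<Rightarrow> nat \<Rightarrow> (nat \<Rightarrow> unit_interval) measure"
  where "data_law f n = PiM {..<n} (\<lambda>_. density leb01 (\<lambda>x. ennreal (f x)))"

text \<open>\<^const>\<open>exp_density\<close> is strictly positive, so the convention \<^term>\<open>ln (0::real) = 0\<close> only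
  matters on a null set of the prior.\<close>

definition log_likelihood :: "nat \<Rightarrow> (nat \<Rightarrow> unit_interval) \<Rightarrow> C01 \<Rightarrow> real"
  where "log_likelihood n y f = (\<Sum>i<n. ln (f (y i)))"

definition frac_posterior ::
    "real \<Rightarrow> C01 measure \<Rightarrow> nat \<Rightarrow> (nat \<Rightarrow> unit_interval) \<Rightarrow> C01 measure"
  where "frac_posterior \<alpha> prior n y =
    density prior (\<lambda>f. ennreal (exp (\<alpha> * log_likelihood n y f)) /
                  (\<integral>\<^sup>+g. ennreal (exp (\<alpha> * log_likelihood n y g)) \<partial>prior))"

end

theory Submission
  imports Defs
begin

text \<open>Tilting the fractional posterior by $e^{tX}$, with $X$ the centred linear statistic, amounts up to
  the factor $e^{t^2 V/2 + o_P(1)}$ to shifting $W$ by $-t \psi_n / \sqrt{n\alpha_n}$ in the likelihood.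
  The Cameron--Martin formula moves the shift to the prior. Its density is $1 + o(1)$ outside an event of
  prior probability $e^{-K n \alpha_n \varepsilon_n^2}$, with $K$ as large as desired, and such events are
  negligible under the posterior since $E_0[1/D] \le e^{C n \alpha_n \varepsilon_n^2}$ for the normalising
  constant $D$. Hence the Laplace transform of $X$ under the posterior, restricted to a ball of radius
  $2\varepsilon_n$ that contains both $A_n$ and its shifts, converges to $e^{t^2 V/2}$ in probability.\<close>

section \<open>Uniqueness of moment generating functions\<close>

text \<open>The posterior is handled on the sample space of \<open>M\<close> rather than on C[0,1]:
  a representer \<open>L\<close> is only an L2 limit of functionals of \<open>W\<close>, so the
  Cameron-Martin weight is a function on \<open>M\<close>. The Cameron-Martin identity is an
  equality of two laws on C[0,1] and is proved by showing that Laplace transforms of continuous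
  functionals determine such laws, for which one-dimensional uniqueness is the base. The quadratic
  expansion of the exponent holds only near \<open>f0\<close> in L1, and the shift moves the
  localising set; this forces the two radii e and 2 e. Write a for n alpha e^2. The inverse evidence
  has mean at most exp (34 a + 1), with 32 a from the likelihood on a sup-norm ball and 2 a + 1 from
  the prior mass of that ball; the constant K of the overview is therefore taken as 37. The tail of
  \<open>L\<close> reaches any K because the shift has squared RKHS norm at most t^2 zeta^2, while a
  zeta^2 tends to 0.\<close>

lemma exp_integrable_moments:
  fixes X :: "'a \<Rightarrow> real"
  assumes X: "X \<in> borel_measurable M"
    and e: "\<And>t. integrable M (\<lambda>x. exp (t * X x))"
  shows "integrable M (\<lambda>x. exp (\<bar>t * X x\<bar>))"
    and "integrable M (\<lambda>x. \<bar>X x\<bar> ^ k)"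
    and "integrable M (\<lambda>x. X x ^ k)"
    and "(\<integral>x. \<bar>t * X x\<bar> ^ k \<partial>M) \<le> fact k * (\<integral>x. exp (\<bar>t * X x\<bar>) \<partial>M)"
proof -
  have ee: "exp \<bar>u\<bar> \<le> \<bar>exp u + exp (- u)\<bar>" for u :: real
    by (cases "u \<ge> 0") auto
  have a: "integrable M (\<lambda>x. exp (\<bar>t * X x\<bar>))" for t
    by (rule Bochner_Integration.integrable_bound[of _ "\<lambda>x. exp (t * X x) + exp ((-t) * X x)"])
      (use e[of t] e[of "-t"] X ee in auto)
  have pw: "u ^ k \<le> fact k * exp u" if "u \<ge> 0" for u :: real
  proof -
    have "(\<Sum>i\<in>{k}. u ^ i /\<^sub>R fact i) \<le> (\<Sum>i. u ^ i /\<^sub>R fact i)"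
      using that summable_exp_generic[of u] by (intro sum_le_suminf) auto
    then show ?thesis by (simp add: exp_def field_simps)
  qed
  show "integrable M (\<lambda>x. exp (\<bar>t * X x\<bar>))" by (rule a)
  have b: "integrable M (\<lambda>x. \<bar>t * X x\<bar> ^ k)" for t
    by (rule Bochner_Integration.integrable_bound[of _ "\<lambda>x. fact k * exp (\<bar>t * X x\<bar>)"])
      (use a[of t] pw X in auto)
  show c: "integrable M (\<lambda>x. \<bar>X x\<bar> ^ k)" using b[of 1] by simp
  show "integrable M (\<lambda>x. X x ^ k)"
    by (rule Bochner_Integration.integrable_bound[OF c]) (use X in \<open>auto simp: power_abs\<close>)
  have "(\<integral>x. \<bar>t * X x\<bar> ^ k \<partial>M) \<le> (\<integral>x. fact k * exp (\<bar>t * X x\<bar>) \<partial>M)"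
    by (rule integral_mono) (use a[of t] b[of t] pw in auto)
  then show "(\<integral>x. \<bar>t * X x\<bar> ^ k \<partial>M) \<le> fact k * (\<integral>x. exp (\<bar>t * X x\<bar>) \<partial>M)" by simp
qed

text \<open>Termwise integration of the exponential series is justified by domination: partial sums
  of absolute values stay below exp |t x|, which is integrable because it is at most exp (t x) + exp
  (- t x).\<close>

lemma mgf_sums_moments:
  fixes M :: "real measure"
  assumes M: "sets M = sets borel" and e: "\<And>t. integrable M (\<lambda>x. exp (t * x))"
  shows "(\<lambda>k. (\<integral>x. x ^ k \<partial>M) / fact k * t ^ k) sums (\<integral>x. exp (t * x) \<partial>M)"
proof -
  have X: "(\<lambda>x. x) \<in> borel_measurable M" unfolding measurable_cong_sets[OF M refl] by simp
  note I = exp_integrable_moments[OF X e]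
  define f where "f k x = (t * x) ^ k /\<^sub>R fact k" for k and x :: real
  have int: "integrable M (f k)" for k
    unfolding f_def using I(3)[of k] by (simp add: power_mult_distrib)
  have S: "(\<lambda>k. f k x) sums exp (t * x)" for x
    unfolding f_def by (rule exp_converges)
  have Sn: "(\<lambda>k. norm (f k x)) sums exp \<bar>t * x\<bar>" for x
    using exp_converges[of "\<bar>t * x\<bar>"] by (simp add: f_def power_abs abs_mult)
  have sm: "summable (\<lambda>k. \<integral>x. norm (f k x) \<partial>M)"
  proof (rule bounded_imp_summable)
    fix k
    have "(\<Sum>i\<le>k. \<integral>x. norm (f i x) \<partial>M) = (\<integral>x. (\<Sum>i\<le>k. norm (f i x)) \<partial>M)"
      using int by (intro Bochner_Integration.integral_sum[symmetric]) auto
    also have "\<dots> \<le> (\<integral>x. exp \<bar>t * x\<bar> \<partial>M)"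
    proof (rule integral_mono)
      show "(\<Sum>i\<le>k. norm (f i x)) \<le> exp \<bar>t * x\<bar>" for x
        using Sn[of x] sum_le_suminf[of "\<lambda>k. norm (f k x)" "{..k}"] by (auto simp: sums_iff)
    qed (use int I(1) in auto)
    finally show "(\<Sum>i\<le>k. \<integral>x. norm (f i x) \<partial>M) \<le> (\<integral>x. exp \<bar>t * x\<bar> \<partial>M)" .
  qed auto
  have "(\<lambda>k. integral\<^sup>L M (f k)) sums (\<integral>x. (\<Sum>k. f k x) \<partial>M)"
    by (rule sums_integral) (use int sm Sn in \<open>auto simp: sums_iff\<close>)
  moreover have "(\<Sum>k. f k x) = exp (t * x)" for x using S by (simp add: sums_iff)
  moreover have "integral\<^sup>L M (f k) = (\<integral>x. x ^ k \<partial>M) / fact k * t ^ k" for k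
  proof -
    have "f k = (\<lambda>x. (t ^ k / fact k) * x ^ k)" by (auto simp: f_def field_simps power_mult_distrib)
    then show ?thesis by simp
  qed
  ultimately show ?thesis by simp
qed

text \<open>Strong induction: once the coefficients below k vanish, dividing by t^k and letting t
  tend to 0 isolates the coefficient k.\<close>

lemma powser_zero_coeffs:
  fixes a :: "nat \<Rightarrow> real"
  assumes "\<And>t. (\<lambda>k. a k * t ^ k) sums 0"
  shows "a k = 0"
proof (induction k rule: less_induct)
  case (less k)
  have "(\<lambda>i. a (i + k) * t ^ i) sums 0" if "t \<noteq> 0" for t
  proof -
    have "(\<lambda>i. a (i + k) * t ^ (i + k)) sums (0 - (\<Sum>i<k. a i * t ^ i))"
      by (rule sums_split_initial_segment[OF assms])
    then have "(\<lambda>i. t ^ k * (a (i + k) * t ^ i)) sums (t ^ k * 0)"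
      using less by (simp add: power_add mult_ac)
    then show ?thesis using that by (subst (asm) sums_mult_iff) auto
  qed
  then have "((\<lambda>t. 0) \<longlongrightarrow> a (0 + k)) (at (0::real))"
    by (intro powser_limit_0_strong[of 1 "\<lambda>i. a (i + k)" "\<lambda>_. 0"]) auto
  then show ?case using LIM_unique[of "\<lambda>_. 0" 0 "0::real" "a k"] by (simp add: tendsto_const_iff)
qed

text \<open>Both transforms are power series in t, so their equality gives equal moments; the
  characteristic functions are then limits of the same Taylor polynomials, and Levy's theorem
  applies.\<close>

lemma mgf_uniqueness:
  assumes M: "real_distribution M" and N: "real_distribution N"
    and eM: "\<And>t. integrable M (\<lambda>x. exp (t * x))" and eN: "\<And>t. integrable N (\<lambda>x. exp (t * x))"
    and eq: "\<And>t. (\<integral>x. exp (t * x) \<partial>M) = (\<integral>x. exp (t * x) \<partial>N)"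
  shows "M = N"
proof -
  interpret M: real_distribution M by fact
  interpret N: real_distribution N by fact
  define a where "a k = (\<integral>x. x ^ k \<partial>M) / fact k - (\<integral>x. x ^ k \<partial>N) / fact k" for k :: nat
  have s0: "(\<lambda>k. a k * t ^ k) sums 0" for t
    using sums_diff[OF mgf_sums_moments[OF M.events_eq_borel eM, of t]
        mgf_sums_moments[OF N.events_eq_borel eN, of t]] eq
    by (simp add: a_def left_diff_distrib)
  have "a k = 0" for k by (rule powser_zero_coeffs[OF s0])
  then have mom: "(\<integral>x. x ^ k \<partial>M) = (\<integral>x. x ^ k \<partial>N)" for k by (simp add: a_def)
  have lim: "(\<lambda>n. (\<Sum>k\<le>n. ((\<i> * t)^k / fact k) * complex_of_real (\<integral>x. x^k \<partial>P))) \<longlonglongrightarrow> char P t"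
    if P: "real_distribution P" and eP: "\<And>t. integrable P (\<lambda>x. exp (t * x))" for P and t :: real
  proof -
    interpret P: real_distribution P by fact
    have X: "(\<lambda>x. x) \<in> borel_measurable P" unfolding measurable_cong_sets[OF P.events_eq_borel refl] by simp
    note I = exp_integrable_moments[OF X eP]
    \<comment> \<open>The doubled argument 2 t pays for convergence: bounding the n-th absolute
      moment of 2 t x by n! C leaves a factor 2^-n in the Taylor remainder, however large t
      is.\<close>
    define C where "C = (\<integral>x. exp \<bar>(2 * t) * x\<bar> \<partial>P)"
    have b: "norm ((\<Sum>k\<le>n. ((\<i> * t)^k / fact k) * complex_of_real (\<integral>x. x^k \<partial>P)) - char P t)
        \<le> 2 * C * (1/2) ^ n" for n
    proof -
      have "norm (char P t - (\<Sum>k\<le>n. ((\<i> * t)^k / fact k) * complex_of_real (\<integral>x. x^k \<partial>P)))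
        \<le> (2*\<bar>t\<bar>^n / fact n) * (\<integral>x. \<bar>x\<bar>^n \<partial>P)"
        by (rule P.char_approx1) (rule I(3))
      also have "\<bar>t\<bar>^n * (\<integral>x. \<bar>x\<bar>^n \<partial>P) = (1/2)^n * (\<integral>x. \<bar>(2*t) * x\<bar>^n \<partial>P)"
        by (simp add: abs_mult power_mult_distrib power_one_over flip: mult.assoc)
      then have "(2*\<bar>t\<bar>^n / fact n) * (\<integral>x. \<bar>x\<bar>^n \<partial>P) = 2 / fact n * ((1/2)^n * (\<integral>x. \<bar>(2*t) * x\<bar>^n \<partial>P))"
        by simp
      also have "\<dots> \<le> 2 / fact n * ((1/2)^n * (fact n * C))"
        unfolding C_def using I(4)[of "2*t" n] by (intro mult_left_mono) auto
      also have "\<dots> = 2 * C * (1/2) ^ n" by simp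
      finally show ?thesis by (subst norm_minus_commute)
    qed
    have l0: "(\<lambda>n. 2 * C * (1/2) ^ n) \<longlonglongrightarrow> 0"
      by (intro tendsto_mult_right_zero LIMSEQ_realpow_zero) auto
    have "(\<lambda>n. (\<Sum>k\<le>n. ((\<i> * t)^k / fact k) * complex_of_real (\<integral>x. x^k \<partial>P)) - char P t) \<longlonglongrightarrow> 0"
      by (rule Lim_null_comparison[OF always_eventually l0]) (use b in blast)
    then show ?thesis by (simp only: LIM_zero_iff)
  qed
  have "char M t = char N t" for t
    using LIMSEQ_unique[OF lim[OF M eM, of t]] lim[OF N eN, of t] unfolding mom by blast
  then show ?thesis by (intro Levy_uniqueness[OF M N]) auto
qed

section \<open>Measurability in $C[0,1]$\<close>

lemma continuous_on_Rep_unit_interval: "continuous_on UNIV Rep_unit_interval"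
  by (auto simp: continuous_on_iff dist_unit_interval_def)

lemma measurable_Rep_unit_interval [measurable]: "Rep_unit_interval \<in> borel_measurable borel"
  by (rule borel_measurable_continuous_onI[OF continuous_on_Rep_unit_interval])

lemma bounded_linear_eval: "bounded_linear (\<lambda>w::C01. w x)"
proof (rule bounded_linear_intro[of _ 1])
  show "norm (apply_bcontfun w x) \<le> norm w * 1" for w :: C01 using norm_bounded[of w x] by simp
qed auto

lemma measurable_eval [measurable]: "(\<lambda>w::C01. w x) \<in> borel_measurable borel"
  by (intro borel_measurable_continuous_onI linear_continuous_on bounded_linear_eval)

text \<open>Rounding passes through a natural-number index so that evaluation at a rounded argument
  becomes a countable case distinction.\<close>

definition grid_round :: "nat \<Rightarrow> unit_interval \<Rightarrow> nat"
  where "grid_round k x = nat \<lfloor>real (Suc k) * Rep_unit_interval x\<rfloor>"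

definition grid_point :: "nat \<Rightarrow> nat \<Rightarrow> unit_interval"
  where "grid_point k i = Abs_unit_interval (real i / real (Suc k))"

lemma Rep_unit_interval_bounds: "0 \<le> Rep_unit_interval x" "Rep_unit_interval x \<le> 1"
  using Rep_unit_interval[of x] by auto

lemma grid_point_tendsto: "(\<lambda>k. grid_point k (grid_round k x)) \<longlonglongrightarrow> x"
proof -
  define z where "z = Rep_unit_interval x"
  have z: "0 \<le> z" "z \<le> 1" using Rep_unit_interval_bounds by (auto simp: z_def)
  have d: "dist (grid_point k (grid_round k x)) x \<le> 1 / real (Suc k)" for k
  proof -
    define j where "j = \<lfloor>real (Suc k) * z\<rfloor>"
    have j: "real_of_int j \<le> real (Suc k) * z" "real (Suc k) * z < real_of_int j + 1"
      unfolding j_def by linarith+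
    have j0: "0 \<le> j" unfolding j_def using z by simp
    have le: "real_of_int j / real (Suc k) \<le> z" "z \<le> real_of_int j / real (Suc k) + 1 / real (Suc k)"
      using j by (auto simp: field_simps)
    have in01: "real_of_int j / real (Suc k) \<in> {0..1}" using order_trans[OF le(1) z(2)] j0 by (simp del: of_nat_Suc)
    have "dist (grid_point k (grid_round k x)) x = \<bar>real_of_int j / real (Suc k) - z\<bar>"
      unfolding grid_point_def grid_round_def dist_unit_interval_def dist_real_def
      unfolding z_def[symmetric] j_def[symmetric] using in01 j0 by (simp add: Abs_unit_interval_inverse)
    then show ?thesis using le by auto
  qed
  have l0: "(\<lambda>k. 1 / real (Suc k)) \<longlonglongrightarrow> 0" by (rule LIMSEQ_Suc[OF lim_1_over_n])
  show ?thesis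
    by (rule tendsto_dist_iff[THEN iffD2], rule tendsto_sandwich[OF _ _ tendsto_const l0]) (use d in auto)
qed

lemma eval_grid_tendsto: "(\<lambda>k. apply_bcontfun (w::C01) (grid_point k (grid_round k x))) \<longlonglongrightarrow> w x"
proof -
  have "isCont (apply_bcontfun w) x"
    using continuous_on_apply_bcontfun[of UNIV w] by (metis continuous_on_eq_continuous_at open_UNIV UNIV_I)
  then show ?thesis using grid_point_tendsto isCont_tendsto_compose by blast
qed

text \<open>With the argument rounded to a grid, evaluation is measurable in \<open>w\<close> for
  each of countably many indices; continuity of \<open>w\<close> makes it converge as the grid is
  refined. Joint measurability is what the later exchanges of integrals over data and sample point
  rest on.\<close>

lemma measurable_eval_pair: "(\<lambda>(w::C01, x). w x) \<in> borel_measurable (borel \<Otimes>\<^sub>M borel)"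
proof (rule borel_measurable_LIMSEQ_real)
  show "(\<lambda>k. (\<lambda>(w::C01, x). apply_bcontfun w (grid_point k (grid_round k x))) p) \<longlonglongrightarrow> (\<lambda>(w::C01, x). apply_bcontfun w x) p" for p
    using eval_grid_tendsto by (auto split: prod.splits)
  show "(\<lambda>(w::C01, x). w (grid_point k (grid_round k x))) \<in> borel_measurable (borel \<Otimes>\<^sub>M borel)" for k
  proof -
    have [measurable]: "(\<lambda>p::C01 \<times> unit_interval. grid_round k (snd p)) \<in> measurable (borel \<Otimes>\<^sub>M borel) (count_space UNIV)"
      unfolding grid_round_def by measurable
    have "(\<lambda>p::C01 \<times> unit_interval. apply_bcontfun (fst p) (grid_point k (grid_round k (snd p)))) \<in> borel_measurable (borel \<Otimes>\<^sub>M borel)"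
      by (rule measurable_compose_countable'[where f="\<lambda>i p. apply_bcontfun (fst p) (grid_point k i)" and g="\<lambda>p. grid_round k (snd p)" and I=UNIV]) auto
    then show ?thesis by (simp add: case_prod_beta')
  qed
qed

lemma measurable_eval_compose:
  assumes "f \<in> measurable N (borel :: C01 measure)" "g \<in> measurable N borel"
  shows "(\<lambda>z. apply_bcontfun (f z) (g z)) \<in> borel_measurable N"
  using measurable_compose[OF measurable_Pair[OF assms] measurable_eval_pair] by simp

text \<open>Bernstein polynomials with rational coefficients are dense: the basis is nonnegative and
  sums to 1, so moving every coefficient by at most e/2 moves the polynomial by at most e/2. Coding
  a polynomial by its degree and a list of rationals makes countability immediate.\<close>

lemma C01_separable:
  "\<exists>D::C01 set. countable D \<and> (\<forall>w e. e > 0 \<longrightarrow> (\<exists>p\<in>D. dist w p \<le> e))"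
proof (intro exI conjI allI impI)
  let ?p = "\<lambda>(n, l::rat list). Bcontfun (\<lambda>x. \<Sum>k\<le>n. of_rat (l ! k) * Bernstein n k (Rep_unit_interval x)) :: C01"
  show "countable (range ?p)" by simp
  fix w :: C01 and e :: real assume e: "e > 0"
  have "continuous_on {0..1} (\<lambda>t. w (Abs_unit_interval t))"
    using continuous_on_compose2[OF continuous_on_apply_bcontfun continuous_on_Abs_unit_interval] by auto
  from Bernstein_Weierstrass[OF this half_gt_zero[OF e]] obtain n :: nat where
    "\<forall>m x. n \<le> m \<and> x \<in> {0..1} \<longrightarrow>
        \<bar>w (Abs_unit_interval x) - (\<Sum>k\<le>m. w (Abs_unit_interval (real k / real m)) * Bernstein m k x)\<bar> < e/2"
    by blast
  then have n: "\<And>x. x \<in> {0..1} \<Longrightarrow>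
        \<bar>w (Abs_unit_interval x) - (\<Sum>k\<le>n. w (Abs_unit_interval (real k / real n)) * Bernstein n k x)\<bar> < e/2"
    by blast
  have dense: "\<exists>q::rat. \<bar>c - of_rat q\<bar> < e/2" for c
  proof -
    obtain q where "c - e/2 < of_rat q" "of_rat q < c + e/2"
      using of_rat_dense[of "c - e/2" "c + e/2"] e by auto
    then have "\<bar>c - of_rat q\<bar> < e/2" by linarith
    then show ?thesis ..
  qed
  have "\<exists>q::rat. \<bar>w (Abs_unit_interval (real k / real n)) - of_rat q\<bar> < e/2" for k
    by (rule dense)
  then obtain q :: "nat \<Rightarrow> rat" where q: "\<And>k. \<bar>w (Abs_unit_interval (real k / real n)) - of_rat (q k)\<bar> < e/2"
    by metis
  let ?l = "map q [0..<Suc n]"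
  have cont: "continuous_on UNIV (\<lambda>x. \<Sum>k\<le>n. of_rat (?l ! k) * Bernstein n k (Rep_unit_interval x))"
    unfolding Bernstein_def by (intro continuous_intros continuous_on_Rep_unit_interval)
  have app: "apply_bcontfun (?p (n, ?l)) x = (\<Sum>k\<le>n. of_rat (q k) * Bernstein n k (Rep_unit_interval x))" for x
    unfolding prod.case apply_Bcontfun_continuous[OF cont]
    by (intro sum.cong refl) (simp del: upt_Suc)
  have "dist (w x) (?p (n, ?l) x) \<le> e" for x
  proof -
    define z where "z = Rep_unit_interval x"
    have z: "z \<in> {0..1}" unfolding z_def by (rule Rep_unit_interval)
    have wz: "w x = w (Abs_unit_interval z)" by (simp add: z_def Rep_unit_interval_inverse)
    have "\<bar>(\<Sum>k\<le>n. w (Abs_unit_interval (real k / real n)) * Bernstein n k z) - (\<Sum>k\<le>n. of_rat (q k) * Bernstein n k z)\<bar>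
      = \<bar>\<Sum>k\<le>n. (w (Abs_unit_interval (real k / real n)) - of_rat (q k)) * Bernstein n k z\<bar>"
      by (simp add: sum_subtractf left_diff_distrib)
    also have "\<dots> \<le> (\<Sum>k\<le>n. \<bar>(w (Abs_unit_interval (real k / real n)) - of_rat (q k)) * Bernstein n k z\<bar>)"
      by (rule sum_abs)
    also have "\<dots> \<le> (\<Sum>k\<le>n. e/2 * Bernstein n k z)"
    proof (rule sum_mono)
      fix k assume "k \<in> {..n}"
      have "0 \<le> Bernstein n k z" using z by (intro Bernstein_nonneg) auto
      then show "\<bar>(w (Abs_unit_interval (real k / real n)) - of_rat (q k)) * Bernstein n k z\<bar> \<le> e/2 * Bernstein n k z"
        using mult_right_mono[OF less_imp_le[OF q[of k]], of "Bernstein n k z"] by (simp only: abs_mult abs_of_nonneg)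
    qed
    also have "\<dots> = e/2" by (simp add: sum_divide_distrib[symmetric] sum_distrib_left[symmetric])
    finally have "\<bar>w (Abs_unit_interval z) - (\<Sum>k\<le>n. of_rat (q k) * Bernstein n k z)\<bar> \<le> e"
      using n[OF z] by linarith
    then show ?thesis unfolding wz app[of x] dist_real_def z_def[symmetric] .
  qed
  then show "\<exists>p\<in>range ?p. dist w p \<le> e" by (intro bexI[of _ "?p (n, ?l)"] dist_bound) auto
qed

definition eval_cylinders :: "C01 set set"
  where "eval_cylinders = {{w. \<forall>(x, r)\<in>J. apply_bcontfun w x \<le> r} |J. finite J}"

text \<open>By separability every open set is a countable union of closed balls, and a closed ball
  is cut out by evaluations at countably many points. Hence cylinders, a convenient pi-system,
  generate the Borel sets.\<close>

lemma sets_borel_C01: "sets (borel :: C01 measure) = sigma_sets UNIV eval_cylinders"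
proof -
  define N where "N = sigma UNIV eval_cylinders"
  have spN: "space N = UNIV" and sN: "sets N = sigma_sets UNIV eval_cylinders"
    by (auto simp: N_def sets_measure_of space_measure_of)
  have ev [measurable]: "(\<lambda>w::C01. w x) \<in> borel_measurable N" for x
  proof (rule borel_measurableI_le)
    fix r
    have "{w::C01. w x \<le> r} \<in> eval_cylinders"
      unfolding eval_cylinders_def by (intro CollectI exI[of _ "{(x, r)}"]) auto
    then show "{w \<in> space N. apply_bcontfun w x \<le> r} \<in> sets N" by (simp add: spN sN)
  qed
  have cb: "{w. dist p w \<le> e} \<in> sets N" for p :: C01 and e :: real
  proof -
    \<comment> \<open>A non-strict bound on the grid points extends to all arguments by continuity;
      this is why closed balls are used.\<close>
    have "{w. dist p w \<le> e} = {w \<in> space N. \<forall>k i. \<bar>p (grid_point k i) - w (grid_point k i)\<bar> \<le> e}"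
    proof (intro equalityI subsetI CollectI conjI)
      fix w assume "w \<in> {w \<in> space N. \<forall>k i. \<bar>p (grid_point k i) - w (grid_point k i)\<bar> \<le> e}"
      then have le: "\<bar>p (grid_point k i) - w (grid_point k i)\<bar> \<le> e" for k i by auto
      have "\<bar>p x - w x\<bar> \<le> e" for x
        by (rule LIMSEQ_le_const2[OF tendsto_rabs[OF tendsto_diff[OF eval_grid_tendsto eval_grid_tendsto]]])
          (use le in auto)
      then show "dist p w \<le> e" by (intro dist_bound) (auto simp: dist_real_def)
    next
      fix w assume "w \<in> {w. dist p w \<le> e}"
      then show "\<forall>k i. \<bar>p (grid_point k i) - w (grid_point k i)\<bar> \<le> e"
        using dist_bounded[of p _ w] by (auto simp: dist_real_def intro: order_trans)
    qed (auto simp: spN)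
    also have "\<dots> \<in> sets N" by measurable
    finally show ?thesis .
  qed
  obtain D :: "C01 set" where D: "countable D" "\<And>w e. e > 0 \<Longrightarrow> \<exists>p\<in>D. dist w p \<le> e"
    using C01_separable by blast
  have op: "U \<in> sets N" if "open U" for U :: "C01 set"
  proof -
    define I where "I = {(p, k::nat). p \<in> D \<and> {w. dist p w \<le> 1 / Suc k} \<subseteq> U}"
    have "I \<subseteq> D \<times> UNIV" by (auto simp: I_def)
    then have "countable I" using D(1) by (intro countable_subset[of I "D \<times> UNIV"]) auto
    moreover have "U = (\<Union>(p, k)\<in>I. {w. dist p w \<le> 1 / Suc k})"
    proof (intro equalityI subsetI)
      fix w assume "w \<in> U"
      then obtain e where e: "e > 0" "\<And>v. dist v w < e \<Longrightarrow> v \<in> U"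
        using \<open>open U\<close> unfolding open_dist by blast
      obtain k where k: "1 / real (Suc k) < e / 2"
        using e(1) by (metis half_gt_zero nat_approx_posE)
      obtain p where p: "p \<in> D" "dist w p \<le> 1 / Suc k" using D(2)[of "1 / Suc k" w] by auto
      have "(p, k) \<in> I"
        unfolding I_def
      proof (intro CollectI case_prodI conjI subsetI p(1))
        fix v assume "v \<in> {w. dist p w \<le> 1 / Suc k}"
        then have "dist v w < e" using p k dist_triangle[of v w p] by (auto simp: dist_commute)
        then show "v \<in> U" by (rule e(2))
      qed
      then show "w \<in> (\<Union>(p, k)\<in>I. {w. dist p w \<le> 1 / Suc k})" using p by (auto simp: dist_commute)
    qed (auto simp: I_def)
    ultimately show ?thesis
      by (subst \<open>U = _\<close>, intro sets.countable_UN') (auto intro: cb)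
  qed
  have "sets (borel :: C01 measure) \<subseteq> sets N"
    unfolding borel_def by (subst sets_measure_of) (use op sets.sigma_sets_subset[of "{S. open S}" N] spN in auto)
  moreover have "sets N \<subseteq> sets (borel :: C01 measure)"
  proof -
    have "eval_cylinders \<subseteq> sets (borel :: C01 measure)"
    proof
      fix S assume "S \<in> eval_cylinders"
      then obtain J where J: "finite J" "S = {w \<in> space borel. \<forall>z\<in>J. apply_bcontfun w (fst z) \<le> snd z}"
        by (auto simp: eval_cylinders_def case_prod_beta)
      show "S \<in> sets borel" unfolding J(2) using J(1) by measurable
    qed
    then show ?thesis unfolding sN using sets.sigma_sets_subset[of eval_cylinders borel] by simp
  qed
  ultimately show ?thesis by (simp add: sN)
qed

lemma measurable_into_C01I:
  assumes "\<And>x. (\<lambda>z. apply_bcontfun (f z) x) \<in> borel_measurable N"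
  shows "f \<in> measurable N (borel :: C01 measure)"
proof (rule measurable_sigma_sets[where A = eval_cylinders, OF sets_borel_C01])
  fix S assume "S \<in> eval_cylinders"
  then obtain J where J: "finite J" "S = {w. \<forall>z\<in>J. apply_bcontfun w (fst z) \<le> snd z}"
    by (auto simp: eval_cylinders_def case_prod_beta)
  have "f -` S \<inter> space N = {z \<in> space N. \<forall>j\<in>J. apply_bcontfun (f z) (fst j) \<le> snd j}"
    using J by auto
  also have "\<dots> \<in> sets N" using J(1) assms by measurable
  finally show "f -` S \<inter> space N \<in> sets N" .
qed auto

lemma sets_leb01 [measurable_cong]: "sets leb01 = sets borel"
  by (simp add: leb01_def)

lemma space_leb01: "space leb01 = UNIV"
  by (simp add: leb01_def)

lemma measurable_exp_density: "exp_density \<in> measurable borel borel"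
proof (rule measurable_into_C01I)
  interpret prob_space leb01 by (rule prob_space_leb01)
  have [measurable]: "(\<lambda>(w::C01, x). w x) \<in> borel_measurable (borel \<Otimes>\<^sub>M leb01)"
    by (subst measurable_cong_sets[OF sets_pair_measure_cong[OF refl sets_leb01] refl]) (rule measurable_eval_pair)
  show "(\<lambda>w. apply_bcontfun (exp_density w) x) \<in> borel_measurable borel" for x
    unfolding apply_exp_density by measurable
qed

lemma measurable_exp_density_space: "exp_density \<in> measurable borel density_space"
  unfolding density_space_def
  by (rule measurable_restrict_space2) (auto simp: exp_density_in_densities measurable_exp_density)

section \<open>Laplace transforms determine measures on $C[0,1]$\<close>

text \<open>Nonnegative integrals let finiteness on one side yield integrability on both through the
  equality.\<close>

lemma nn_mgf_uniqueness:
  fixes \<mu> \<nu> :: "real measure"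
  assumes M: "real_distribution \<mu>" and N: "real_distribution \<nu>"
    and fin: "\<And>t. (\<integral>\<^sup>+x. ennreal (exp (t * x)) \<partial>\<mu>) < \<infinity>"
    and eq: "\<And>t. (\<integral>\<^sup>+x. ennreal (exp (t * x)) \<partial>\<mu>) = (\<integral>\<^sup>+x. ennreal (exp (t * x)) \<partial>\<nu>)"
  shows "\<mu> = \<nu>"
proof (rule mgf_uniqueness[OF M N])
  interpret M: real_distribution \<mu> by fact
  interpret N: real_distribution \<nu> by fact
  have [measurable]: "(\<lambda>x. exp (t * x)) \<in> borel_measurable \<mu>" "(\<lambda>x. exp (t * x)) \<in> borel_measurable \<nu>" for t
    unfolding measurable_cong_sets[OF M.events_eq_borel refl] measurable_cong_sets[OF N.events_eq_borel refl]
    by measurable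
  show i1: "integrable \<mu> (\<lambda>x. exp (t * x))" for t
    by (rule integrableI_bounded) (use fin[of t] in auto)
  show i2: "integrable \<nu> (\<lambda>x. exp (t * x))" for t
    by (rule integrableI_bounded) (use fin[of t] eq[of t] in auto)
  fix t
  have "ennreal (\<integral>x. exp (t * x) \<partial>\<mu>) = ennreal (\<integral>x. exp (t * x) \<partial>\<nu>)"
    using eq[of t] nn_integral_eq_integral[OF i1, of t] nn_integral_eq_integral[OF i2, of t] by simp
  then show "(\<integral>x. exp (t * x) \<partial>\<mu>) = (\<integral>x. exp (t * x) \<partial>\<nu>)"
    by (subst (asm) ennreal_inj) auto
qed

lemma borel_measurable_bounded_linear:
  fixes c :: "'b::real_normed_vector \<Rightarrow> real"
  assumes "bounded_linear c" shows "c \<in> borel_measurable borel"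
  by (intro borel_measurable_continuous_onI linear_continuous_on assms)

text \<open>A finite measure tilted by \<^term>\<open>exp (b w)\<close> is again determined along every \<^term>\<open>c\<close> by its
  Laplace transform, so cylinder conditions can be adjoined one at a time.\<close>

lemma tilted_cylinder_step:
  fixes \<mu> \<nu> :: "'b::real_normed_vector measure"
  assumes M: "sets \<mu> = sets borel" and N: "sets \<nu> = sets borel"
    and fin: "\<And>b. bounded_linear b \<Longrightarrow> (\<integral>\<^sup>+w. ennreal (exp (b w)) \<partial>\<mu>) < \<infinity>"
    and S: "S \<in> sets borel"
    and eq: "\<And>b. bounded_linear b \<Longrightarrow> (\<integral>\<^sup>+w. ennreal (exp (b w)) * indicator S w \<partial>\<mu>)
        = (\<integral>\<^sup>+w. ennreal (exp (b w)) * indicator S w \<partial>\<nu>)"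
    and c: "bounded_linear (c :: 'b \<Rightarrow> real)" and b: "bounded_linear b"
  shows "(\<integral>\<^sup>+w. ennreal (exp (b w)) * indicator (S \<inter> {w. c w \<le> r}) w \<partial>\<mu>)
        = (\<integral>\<^sup>+w. ennreal (exp (b w)) * indicator (S \<inter> {w. c w \<le> r}) w \<partial>\<nu>)"
proof -
  note [measurable] = borel_measurable_bounded_linear[OF b] borel_measurable_bounded_linear[OF c]
  note [measurable_cong] = M N
  note [measurable] = S
  define Z where "Z = (\<integral>\<^sup>+w. ennreal (exp (b w)) * indicator S w \<partial>\<mu>)"
  have Z': "Z = (\<integral>\<^sup>+w. ennreal (exp (b w)) * indicator S w \<partial>\<nu>)" unfolding Z_def by (rule eq[OF b])
  have finS: "(\<integral>\<^sup>+w. ennreal (exp (b w)) * indicator S w \<partial>\<mu>) < \<infinity>" if b: "bounded_linear b" for b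
    by (rule le_less_trans[OF nn_integral_mono fin[OF b]]) (auto simp: indicator_def)
  have Zfin: "Z < \<infinity>" unfolding Z_def by (rule finS[OF b])
  show ?thesis
  proof (cases "Z = 0")
    \<comment> \<open>Zero tilted mass cannot be normalised to a law, but then both integrals are
      dominated by \<open>Z\<close>.\<close>
    case True
    have "(\<integral>\<^sup>+w. ennreal (exp (b w)) * indicator (S \<inter> {w. c w \<le> r}) w \<partial>\<mu>) \<le> Z"
      unfolding Z_def by (intro nn_integral_mono) (auto simp: indicator_def)
    moreover have "(\<integral>\<^sup>+w. ennreal (exp (b w)) * indicator (S \<inter> {w. c w \<le> r}) w \<partial>\<nu>) \<le> Z"
      unfolding Z' by (intro nn_integral_mono) (auto simp: indicator_def)
    ultimately show ?thesis using True by simp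
  next
    case False
    define d where "d w = ennreal (exp (b w)) * indicator S w / Z" for w
    have [measurable]: "d \<in> borel_measurable borel" unfolding d_def by measurable
    define P where "P \<rho> = distr (density \<rho> d) borel c" for \<rho> :: "'b measure"
    have total: "(\<integral>\<^sup>+w. d w \<partial>\<rho>) = 1"
      if "Z = (\<integral>\<^sup>+w. ennreal (exp (b w)) * indicator S w \<partial>\<rho>)" "sets \<rho> = sets borel" for \<rho>
    proof -
      note [measurable_cong] = that(2)
      show ?thesis unfolding d_def
        by (subst nn_integral_divide) (use that(1)[symmetric] False Zfin in \<open>auto simp: ennreal_divide_self less_top\<close>)
    qed
    have rd: "real_distribution (P \<rho>)"
      if "Z = (\<integral>\<^sup>+w. ennreal (exp (b w)) * indicator S w \<partial>\<rho>)" "sets \<rho> = sets borel" for \<rho>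
    proof -
      note [measurable_cong] = that(2)
      have "prob_space (density \<rho> d)"
        by (rule prob_spaceI) (simp add: emeasure_density total[OF that] cong: nn_integral_cong_simp)
      then show ?thesis unfolding P_def
        by (rule prob_space.real_distribution_distr) simp
    qed
    \<comment> \<open>A further tilt by \<open>exp (t * c w)\<close> merely replaces the functional
      b by b + t c, so the assumed equality over all functionals covers every t.\<close>
    have mgf: "(\<integral>\<^sup>+x. ennreal (exp (t * x)) \<partial>P \<rho>)
        = (\<integral>\<^sup>+w. ennreal (exp (b w + t * c w)) * indicator S w \<partial>\<rho>) / Z"
      if "sets \<rho> = sets borel" for \<rho> t
    proof -
      note [measurable_cong] = that
      have "(\<integral>\<^sup>+x. ennreal (exp (t * x)) \<partial>P \<rho>) = (\<integral>\<^sup>+w. d w * ennreal (exp (t * c w)) \<partial>\<rho>)"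
        unfolding P_def by (simp add: nn_integral_distr nn_integral_density)
      also have "\<dots> = (\<integral>\<^sup>+w. ennreal (exp (b w + t * c w)) * indicator S w / Z \<partial>\<rho>)"
        unfolding d_def
        by (intro nn_integral_cong) (auto simp: indicator_def exp_add ennreal_mult divide_ennreal_def mult_ac)
      finally show ?thesis by (simp add: nn_integral_divide)
    qed
    have bl: "bounded_linear (\<lambda>w. b w + t * c w)" for t
      by (intro bounded_linear_add b bounded_linear_const_mult c)
    have "P \<mu> = P \<nu>"
    proof (rule nn_mgf_uniqueness[OF rd[OF Z_def M] rd[OF Z' N]])
      show "(\<integral>\<^sup>+x. ennreal (exp (t * x)) \<partial>P \<mu>) < \<infinity>" for t
        unfolding mgf[OF M] using finS[OF bl[of t]] False
        by (simp add: less_top[symmetric] ennreal_divide_eq_top_iff)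
      show "(\<integral>\<^sup>+x. ennreal (exp (t * x)) \<partial>P \<mu>) = (\<integral>\<^sup>+x. ennreal (exp (t * x)) \<partial>P \<nu>)" for t
        unfolding mgf[OF M] mgf[OF N] eq[OF bl] ..
    qed
    moreover have "(\<integral>\<^sup>+w. ennreal (exp (b w)) * indicator (S \<inter> {w. c w \<le> r}) w \<partial>\<rho>) = Z * emeasure (P \<rho>) {..r}"
      if "sets \<rho> = sets borel" for \<rho>
    proof -
      note [measurable_cong] = that
      have sp: "space \<rho> = UNIV" using sets_eq_imp_space_eq[OF that] by simp
      have "emeasure (P \<rho>) {..r} = (\<integral>\<^sup>+w. d w * indicator (c -` {..r} \<inter> space \<rho>) w \<partial>\<rho>)"
        unfolding P_def by (simp add: emeasure_distr emeasure_density)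
      also have "\<dots> = (\<integral>\<^sup>+w. ennreal (exp (b w)) * indicator (S \<inter> {w. c w \<le> r}) w / Z \<partial>\<rho>)"
        unfolding d_def by (intro nn_integral_cong) (auto simp: indicator_def sp)
      also have "\<dots> = (\<integral>\<^sup>+w. ennreal (exp (b w)) * indicator (S \<inter> {w. c w \<le> r}) w \<partial>\<rho>) / Z"
        by (subst nn_integral_divide) auto
      finally show ?thesis using False Zfin
        by (simp add: ennreal_times_divide mult.commute[of Z] ennreal_mult_divide_eq less_top[symmetric])
    qed
    ultimately show ?thesis using M N by simp
  qed
qed

text \<open>Induction on the number of cylinder constraints. The functional b stays universally
  quantified because the next constraint tilts again; only at the end is b = 0 taken, which gives
  equal cylinder probabilities on a generating pi-system.\<close>

lemma C01_measure_eqI: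
  fixes \<mu> \<nu> :: "C01 measure"
  assumes pM: "prob_space \<mu>"
    and M: "sets \<mu> = sets borel" and N: "sets \<nu> = sets borel"
    and fin: "\<And>b. bounded_linear b \<Longrightarrow> (\<integral>\<^sup>+w. ennreal (exp (b w)) \<partial>\<mu>) < \<infinity>"
    and eq: "\<And>b. bounded_linear b \<Longrightarrow>
      (\<integral>\<^sup>+w. ennreal (exp (b w)) \<partial>\<mu>) = (\<integral>\<^sup>+w. ennreal (exp (b w)) \<partial>\<nu>)"
  shows "\<mu> = \<nu>"
proof -
  interpret \<mu>: prob_space \<mu> by fact
  define cyl where "cyl J = {w::C01. \<forall>(x, r)\<in>J. apply_bcontfun w x \<le> r}" for J
  have cylb: "cyl J \<in> sets borel" if "finite J" for J
    using that sets_borel_C01 by (auto simp: cyl_def eval_cylinders_def intro!: sigma_sets.Basic)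
  have step: "\<forall>b. bounded_linear b \<longrightarrow> (\<integral>\<^sup>+w. ennreal (exp (b w)) * indicator (cyl J) w \<partial>\<mu>)
        = (\<integral>\<^sup>+w. ennreal (exp (b w)) * indicator (cyl J) w \<partial>\<nu>)" if "finite J" for J
    using that
  proof (induction J)
    case empty
    then show ?case using eq by (simp add: cyl_def)
  next
    case (insert p J)
    have "cyl (insert p J) = cyl J \<inter> {w. apply_bcontfun w (fst p) \<le> snd p}"
      by (auto simp: cyl_def case_prod_beta)
    moreover have "(\<integral>\<^sup>+w. ennreal (exp (b w)) * indicator (cyl J \<inter> {w. apply_bcontfun w (fst p) \<le> snd p}) w \<partial>\<mu>)
        = (\<integral>\<^sup>+w. ennreal (exp (b w)) * indicator (cyl J \<inter> {w. apply_bcontfun w (fst p) \<le> snd p}) w \<partial>\<nu>)"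
      if b: "bounded_linear b" for b
      by (rule tilted_cylinder_step[OF M N fin cylb[OF insert(1)] _ bounded_linear_eval b]) (use insert.IH in auto)
    ultimately show ?case by simp
  qed
  show ?thesis
  proof (rule measure_eqI_generator_eq[where E = eval_cylinders and \<Omega> = UNIV and A = "\<lambda>_. UNIV"])
    show "Int_stable eval_cylinders"
    proof (rule Int_stableI)
      fix a b assume "a \<in> eval_cylinders" "b \<in> eval_cylinders"
      then obtain J K where "finite J" "finite K" "a = cyl J" "b = cyl K"
        by (auto simp: eval_cylinders_def cyl_def)
      moreover have "cyl J \<inter> cyl K = cyl (J \<union> K)" by (auto simp: cyl_def)
      ultimately show "a \<inter> b \<in> eval_cylinders"
        by (auto simp: eval_cylinders_def cyl_def intro!: exI[of _ "J \<union> K"])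
    qed
    fix X assume "X \<in> eval_cylinders"
    then obtain J where J: "finite J" "X = cyl J" by (auto simp: eval_cylinders_def cyl_def)
    show "emeasure \<mu> X = emeasure \<nu> X"
      using step[OF J(1), rule_format, of "\<lambda>_. 0"] cylb[OF J(1)] M N J(2) by (simp add: nn_integral_indicator)
  next
    have "UNIV \<in> eval_cylinders" unfolding eval_cylinders_def by (intro CollectI exI[of _ "{}"]) auto
    then show "range (\<lambda>_::nat. UNIV) \<subseteq> eval_cylinders" by auto
  qed (use sets_borel_C01 M N \<mu>.emeasure_finite in auto)
qed

section \<open>Gaussian limits\<close>

lemma real_distribution_gaussian: "real_distribution (gaussian m V)"
  unfolding gaussian_def
  by (rule prob_space.real_distribution_distr)
    (use real_dist_normal_dist in \<open>auto simp: real_distribution_def\<close>)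

lemma sets_gaussian [simp]: "sets (gaussian m V) = sets borel"
  by (simp add: gaussian_def)

lemma nn_integral_exp_std_normal:
  "(\<integral>\<^sup>+z. ennreal (exp (s * z)) \<partial>std_normal_distribution) = ennreal (exp (s\<^sup>2 / 2))"
proof -
  \<comment> \<open>Completing the square: a tilt by s z moves the mean of the standard normal law
    to s.\<close>
  have *: "std_normal_density z * exp (s * z) = exp (s\<^sup>2 / 2) * normal_density s 1 z" for z
    by (simp add: normal_density_def field_simps power2_eq_square flip: exp_add)
  have "(\<integral>\<^sup>+z. ennreal (exp (s * z)) \<partial>std_normal_distribution)
      = (\<integral>\<^sup>+z. ennreal (exp (s\<^sup>2 / 2)) * ennreal (normal_density s 1 z) \<partial>lborel)"
    by (simp add: nn_integral_density flip: ennreal_mult *)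
  also have "\<dots> = ennreal (exp (s\<^sup>2 / 2)) * (\<integral>\<^sup>+z. ennreal (normal_density s 1 z) \<partial>lborel)"
    by (rule nn_integral_cmult) simp
  also have "(\<integral>\<^sup>+z. ennreal (normal_density s 1 z) \<partial>lborel) = 1"
    using prob_space.emeasure_space_1[OF prob_space_normal_density[of 1 s]] by (simp add: emeasure_density)
  finally show ?thesis by simp
qed

lemma nn_integral_exp_gaussian:
  assumes "0 \<le> V"
  shows "(\<integral>\<^sup>+x. ennreal (exp (t * x)) \<partial>gaussian 0 V) = ennreal (exp (t\<^sup>2 * V / 2))"
  using nn_integral_exp_std_normal[of "t * sqrt V"] assms
  by (simp add: gaussian_def nn_integral_distr power_mult_distrib mult.assoc)

lemma gaussian_second_moment:
  assumes "0 \<le> V"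
  shows "integrable (gaussian 0 V) (\<lambda>x. x\<^sup>2)" "(\<integral>x. x\<^sup>2 \<partial>gaussian 0 V) = V"
  using assms integrable_std_normal_distribution_moment[of 2] std_normal_distribution_even_moments[of 1]
  by (simp_all add: gaussian_def integrable_distr_eq integral_distr power_mult_distrib has_bochner_integral_iff)

lemma char_gaussian: "0 \<le> V \<Longrightarrow> char (gaussian 0 V) t = complex_of_real (exp (- t\<^sup>2 * V / 2))"
proof -
  assume V: "0 \<le> V"
  have "char (gaussian 0 V) t = char std_normal_distribution (t * sqrt V)"
    by (simp add: char_def gaussian_def integral_distr mult.assoc)
  also have "\<dots> = complex_of_real (exp (- t\<^sup>2 * V / 2))"
    using V by (simp add: char_std_normal_distribution power_mult_distrib)
  finally show ?thesis .
qed

text \<open>Young's inequality with weight \<open>c\<close>. The small factor in front of y^2 lets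
  convergence in L2 carry second moments along.\<close>

lemma square_diff_bound:
  fixes x y c :: real
  assumes "c > 0"
  shows "\<bar>x\<^sup>2 - y\<^sup>2\<bar> \<le> (1 + 1 / c) * (x - y)\<^sup>2 + c * y\<^sup>2"
proof -
  have "0 \<le> (sqrt (1 / c) * \<bar>x - y\<bar> - sqrt c * \<bar>y\<bar>)\<^sup>2" by simp
  also have "\<dots> = (1 / c) * (x - y)\<^sup>2 + c * y\<^sup>2 - 2 * (sqrt (1 / c) * sqrt c) * (\<bar>x - y\<bar> * \<bar>y\<bar>)"
    using assms by (simp add: power2_diff power_mult_distrib)
  also have "sqrt (1 / c) * sqrt c = 1" using assms by (simp flip: real_sqrt_mult)
  finally have "2 * (\<bar>x - y\<bar> * \<bar>y\<bar>) \<le> (1 / c) * (x - y)\<^sup>2 + c * y\<^sup>2" by simp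
  moreover have "\<bar>x\<^sup>2 - y\<^sup>2\<bar> \<le> (x - y)\<^sup>2 + 2 * (\<bar>x - y\<bar> * \<bar>y\<bar>)"
  proof -
    have "x\<^sup>2 - y\<^sup>2 = (x - y)\<^sup>2 + 2 * ((x - y) * y)" by (simp add: power2_eq_square algebra_simps)
    then show ?thesis by (metis abs_mult abs_numeral abs_of_nonneg abs_triangle_ineq zero_le_power2)
  qed
  ultimately show ?thesis by (simp add: algebra_simps)
qed

text \<open>Convergence in L2 makes the variances converge, and it makes the characteristic
  functions converge because |exp (i t X) - exp (i t Y)| is at most |t| |X - Y|. It is needed since
  a representer is itself only an L2 limit of functionals of \<open>W\<close>.\<close>

lemma gaussian_L2_limit:
  fixes Z :: "'w \<Rightarrow> real"
  assumes M: "prob_space M"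
    and Zk: "\<And>k. Zk k \<in> borel_measurable M" and Z [measurable]: "Z \<in> borel_measurable M"
    and V: "\<And>k. 0 \<le> V k" and law: "\<And>k. distr M borel (Zk k) = gaussian 0 (V k)"
    and lim: "(\<lambda>k. \<integral>\<^sup>+\<omega>. ennreal ((Zk k \<omega> - Z \<omega>)\<^sup>2) \<partial>M) \<longlonglongrightarrow> 0"
    and Z2: "integrable M (\<lambda>\<omega>. (Z \<omega>)\<^sup>2)"
  shows "distr M borel Z = gaussian 0 (\<integral>\<omega>. (Z \<omega>)\<^sup>2 \<partial>M)"
proof -
  interpret prob_space M by fact
  note [measurable] = Zk
  define S where "S = (\<integral>\<omega>. (Z \<omega>)\<^sup>2 \<partial>M)"
  have S0: "0 \<le> S" unfolding S_def by simp
  have Zk2: "integrable M (\<lambda>\<omega>. (Zk k \<omega>)\<^sup>2)" "(\<integral>\<omega>. (Zk k \<omega>)\<^sup>2 \<partial>M) = V k" for k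
    using gaussian_second_moment[OF V[of k]] unfolding law[of k, symmetric]
    by (simp_all add: integrable_distr_eq integral_distr)
  define d where "d k = (\<integral>\<omega>. (Zk k \<omega> - Z \<omega>)\<^sup>2 \<partial>M)" for k
  have D2: "integrable M (\<lambda>\<omega>. (Zk k \<omega> - Z \<omega>)\<^sup>2)" for k
  proof (rule Bochner_Integration.integrable_bound[of _ "\<lambda>\<omega>. 2 * (Zk k \<omega>)\<^sup>2 + 2 * (Z \<omega>)\<^sup>2"])
    show "AE \<omega> in M. norm ((Zk k \<omega> - Z \<omega>)\<^sup>2) \<le> norm (2 * (Zk k \<omega>)\<^sup>2 + 2 * (Z \<omega>)\<^sup>2)"
    proof (intro AE_I2)
      fix \<omega>
      have "0 \<le> (Zk k \<omega> + Z \<omega>)\<^sup>2" by simp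
      then have "(Zk k \<omega> - Z \<omega>)\<^sup>2 \<le> 2 * (Zk k \<omega>)\<^sup>2 + 2 * (Z \<omega>)\<^sup>2"
        by (simp add: power2_eq_square algebra_simps)
      then show "norm ((Zk k \<omega> - Z \<omega>)\<^sup>2) \<le> norm (2 * (Zk k \<omega>)\<^sup>2 + 2 * (Z \<omega>)\<^sup>2)"
        by simp
    qed
  qed (use Zk2 Z2 in auto)
  have dlim: "d \<longlonglongrightarrow> 0"
  proof -
    have "(\<integral>\<^sup>+\<omega>. ennreal ((Zk k \<omega> - Z \<omega>)\<^sup>2) \<partial>M) = ennreal (d k)" for k
      unfolding d_def by (rule nn_integral_eq_integral[OF D2]) simp
    then have "(\<lambda>k. ennreal (d k)) \<longlonglongrightarrow> ennreal 0" using lim by simp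
    then show ?thesis by (subst (asm) tendsto_ennreal_iff) (auto simp: d_def)
  qed
  have Vlim: "V \<longlonglongrightarrow> S"
  proof (rule LIMSEQ_I)
    fix e :: real assume e: "0 < e"
    \<comment> \<open>Chosen so that c S is at most e / 2; the summand 1 covers the degenerate case
      S = 0.\<close>
    define c where "c = e / (2 * (S + 1))"
    have c: "c > 0" using e S0 by (simp add: c_def)
    have cS: "c * S \<le> e / 2" unfolding c_def using e S0 by (simp add: field_simps)
    have b: "\<bar>V k - S\<bar> \<le> (1 + 1/c) * d k + c * S" for k
    proof -
      have "\<bar>V k - S\<bar> = \<bar>\<integral>\<omega>. (Zk k \<omega>)\<^sup>2 - (Z \<omega>)\<^sup>2 \<partial>M\<bar>"
        using Zk2 Z2 by (simp add: S_def)
      also have "\<dots> \<le> (\<integral>\<omega>. \<bar>(Zk k \<omega>)\<^sup>2 - (Z \<omega>)\<^sup>2\<bar> \<partial>M)" by (rule integral_abs_bound)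
      also have "\<dots> \<le> (\<integral>\<omega>. (1 + 1/c) * (Zk k \<omega> - Z \<omega>)\<^sup>2 + c * (Z \<omega>)\<^sup>2 \<partial>M)"
        by (rule integral_mono) (use D2 Zk2 Z2 square_diff_bound[OF c] in auto)
      also have "\<dots> = (1 + 1/c) * d k + c * S" using D2 Z2 by (simp add: d_def S_def)
      finally show ?thesis .
    qed
    have "(\<lambda>k. (1 + 1/c) * d k) \<longlonglongrightarrow> 0" by (intro tendsto_mult_right_zero dlim)
    from LIMSEQ_D[OF this, of "e/2"] e obtain N where N: "\<And>k. k \<ge> N \<Longrightarrow> \<bar>(1 + 1/c) * d k\<bar> < e/2" by auto
    have "norm (V k - S) < e" if "k \<ge> N" for k
      unfolding real_norm_def using b[of k] cS N[OF that] by linarith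
    then show "\<exists>no. \<forall>n\<ge>no. norm (V n - S) < e" by blast
  qed
  have rd: "real_distribution (distr M borel Z)" by (rule real_distribution_distr) simp
  show ?thesis unfolding S_def[symmetric]
  proof (rule Levy_uniqueness[OF rd real_distribution_gaussian], rule ext)
    fix t
    have ch: "char (distr M borel X) t = (\<integral>\<omega>. iexp (t * X \<omega>) \<partial>M)" if "X \<in> borel_measurable M" for X
      using that by (simp add: char_def integral_distr)
    have l1: "(\<lambda>k. char (gaussian 0 (V k)) t) \<longlonglongrightarrow> char (gaussian 0 S) t"
      unfolding char_gaussian[OF V] char_gaussian[OF S0]
      by (intro tendsto_intros Vlim) auto
    have b: "norm (char (gaussian 0 (V k)) t - char (distr M borel Z) t) \<le> \<bar>t\<bar> * sqrt (d k)" for k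
    proof -
      have i: "integrable M (\<lambda>\<omega>. iexp (t * X \<omega>))" if [measurable]: "X \<in> borel_measurable M" for X
        by (rule integrable_iexp) auto
      have ia: "integrable M (\<lambda>\<omega>. \<bar>Zk k \<omega> - Z \<omega>\<bar>)"
      proof (rule Bochner_Integration.integrable_bound[of _ "\<lambda>\<omega>. 1 + (Zk k \<omega> - Z \<omega>)\<^sup>2"])
        have "\<bar>x\<bar> \<le> 1 + x\<^sup>2" for x :: real
          using zero_le_power2[of "\<bar>x\<bar> - 1"] by (simp add: power2_diff)
        then show "AE \<omega> in M. norm \<bar>Zk k \<omega> - Z \<omega>\<bar> \<le> norm (1 + (Zk k \<omega> - Z \<omega>)\<^sup>2)"
          by (intro AE_I2) (simp add: order_trans[OF _ abs_ge_self])
      qed (use D2 in auto)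
      have "norm (char (gaussian 0 (V k)) t - char (distr M borel Z) t)
          = norm (\<integral>\<omega>. iexp (t * Zk k \<omega>) - iexp (t * Z \<omega>) \<partial>M)"
        unfolding law[symmetric] ch[OF Zk] ch[OF Z] using i by simp
      also have "\<dots> \<le> (\<integral>\<omega>. norm (iexp (t * Zk k \<omega>) - iexp (t * Z \<omega>)) \<partial>M)" by (rule integral_norm_bound)
      also have "\<dots> \<le> (\<integral>\<omega>. \<bar>t\<bar> * \<bar>Zk k \<omega> - Z \<omega>\<bar> \<partial>M)"
      proof (rule integral_mono)
        fix \<omega>
        have "iexp (t * Zk k \<omega>) - iexp (t * Z \<omega>) = iexp (t * Z \<omega>) * (iexp (t * (Zk k \<omega> - Z \<omega>)) - 1)"
          by (simp add: algebra_simps flip: exp_add)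
        then have "norm (iexp (t * Zk k \<omega>) - iexp (t * Z \<omega>)) = norm (iexp (t * (Zk k \<omega> - Z \<omega>)) - 1)"
          by (simp add: norm_mult)
        also have "\<dots> \<le> \<bar>t * (Zk k \<omega> - Z \<omega>)\<bar>"
          using iexp_approx1[of "t * (Zk k \<omega> - Z \<omega>)" 0] by simp
        finally show "norm (iexp (t * Zk k \<omega>) - iexp (t * Z \<omega>)) \<le> \<bar>t\<bar> * \<bar>Zk k \<omega> - Z \<omega>\<bar>"
          by (simp add: abs_mult)
      qed (use i ia in auto)
      also have "\<dots> = \<bar>t\<bar> * (\<integral>\<omega>. \<bar>Zk k \<omega> - Z \<omega>\<bar> \<partial>M)" by simp
      also have "(\<integral>\<omega>. \<bar>Zk k \<omega> - Z \<omega>\<bar> \<partial>M) \<le> sqrt (d k)"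
      proof (rule real_le_rsqrt)
        have "(\<integral>\<omega>. \<bar>Zk k \<omega> - Z \<omega>\<bar> \<partial>M)\<^sup>2 \<le> (\<integral>\<omega>. \<bar>Zk k \<omega> - Z \<omega>\<bar>\<^sup>2 \<partial>M)"
          by (rule jensens_inequality[where I = UNIV and q = "\<lambda>x. x\<^sup>2"]) (use ia D2 convex_power2 in auto)
        then show "(\<integral>\<omega>. \<bar>Zk k \<omega> - Z \<omega>\<bar> \<partial>M)\<^sup>2 \<le> d k" by (simp add: d_def)
      qed
      finally show ?thesis by (simp add: mult_left_mono)
    qed
    have "(\<lambda>k. \<bar>t\<bar> * sqrt (d k)) \<longlonglongrightarrow> \<bar>t\<bar> * sqrt 0" by (intro tendsto_intros dlim)
    then have l0: "(\<lambda>k. \<bar>t\<bar> * sqrt (d k)) \<longlonglongrightarrow> 0" by simp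
    have "(\<lambda>k. char (gaussian 0 (V k)) t - char (distr M borel Z) t) \<longlonglongrightarrow> 0"
      by (rule Lim_null_comparison[OF always_eventually l0]) (use b in blast)
    then have "(\<lambda>k. char (gaussian 0 (V k)) t) \<longlonglongrightarrow> char (distr M borel Z) t"
      by (simp only: LIM_zero_iff)
    then show "char (distr M borel Z) t = char (gaussian 0 S) t" using l1 by (rule LIMSEQ_unique)
  qed
qed

section \<open>The Cameron--Martin formula and prior mass\<close>

lemma rkhs_representer_scale:
  fixes W :: "'w \<Rightarrow> 'b::real_normed_vector"
  assumes "rkhs_representer M W h L" and W: "W \<in> borel_measurable M"
  shows "rkhs_representer M W (c *\<^sub>R h) (\<lambda>\<omega>. c * L \<omega>)"
proof -
  obtain b where b: "\<And>k. bounded_linear (b k)"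
    and lim: "(\<lambda>k. \<integral>\<^sup>+\<omega>. ennreal ((b k (W \<omega>) - L \<omega>)\<^sup>2) \<partial>M) \<longlonglongrightarrow> 0"
    and L [measurable]: "L \<in> borel_measurable M" and L2: "integrable M (\<lambda>\<omega>. (L \<omega>)\<^sup>2)"
    and pettis: "has_pettis_integral M (\<lambda>\<omega>. L \<omega> *\<^sub>R W \<omega>) h"
    using assms(1) unfolding rkhs_representer_def by blast
  have bW [measurable]: "(\<lambda>\<omega>. b k (W \<omega>)) \<in> borel_measurable M" for k
    using measurable_compose[OF W borel_measurable_bounded_linear[OF b]] .
  have "(\<integral>\<^sup>+\<omega>. ennreal ((c * b k (W \<omega>) - c * L \<omega>)\<^sup>2) \<partial>M)
      = ennreal (c\<^sup>2) * (\<integral>\<^sup>+\<omega>. ennreal ((b k (W \<omega>) - L \<omega>)\<^sup>2) \<partial>M)" for k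
    by (subst nn_integral_cmult[symmetric])
      (auto simp: ennreal_mult[symmetric] power_mult_distrib right_diff_distrib[symmetric])
  moreover have "(\<lambda>k. ennreal (c\<^sup>2) * (\<integral>\<^sup>+\<omega>. ennreal ((b k (W \<omega>) - L \<omega>)\<^sup>2) \<partial>M)) \<longlonglongrightarrow> ennreal (c\<^sup>2) * 0"
    by (intro ennreal_tendsto_cmult lim) auto
  ultimately have "(\<lambda>k. \<integral>\<^sup>+\<omega>. ennreal ((c * b k (W \<omega>) - c * L \<omega>)\<^sup>2) \<partial>M) \<longlonglongrightarrow> 0" by simp
  moreover have "has_pettis_integral M (\<lambda>\<omega>. (c * L \<omega>) *\<^sub>R W \<omega>) (c *\<^sub>R h)"
    unfolding has_pettis_integral_def
  proof (intro allI impI)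
    fix e :: "'b \<Rightarrow> real" assume e: "bounded_linear e"
    then interpret bounded_linear e .
    show "has_bochner_integral M (\<lambda>\<omega>. e ((c * L \<omega>) *\<^sub>R W \<omega>)) (e (c *\<^sub>R h))"
      using has_bochner_integral_mult_right[OF pettis[unfolded has_pettis_integral_def, rule_format, OF e], of c]
      by (simp add: scaleR mult.assoc)
  qed
  ultimately show ?thesis
    unfolding rkhs_representer_def using L2
    by (auto simp: power_mult_distrib intro!: exI[of _ "\<lambda>k w. c * b k w"] bounded_linear_const_mult b)
qed

text \<open>The variable c(W) + u L is the L2 limit of the functionals c + u b_k at
  \<open>W\<close>, hence centred Gaussian, and its transform depends on the variance alone. The
  cross term of the variance is c(h), precisely because \<open>h\<close> is the Pettis integral of L
  W. This replaces joint normality of c(W) and L.\<close>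

lemma nn_integral_exp_representer:
  fixes W :: "'w \<Rightarrow> 'b::real_normed_vector"
  assumes W: "centered_gaussian_element M W" and L: "rkhs_representer M W h L" and c: "bounded_linear c"
  shows "(\<integral>\<^sup>+\<omega>. ennreal (exp (c (W \<omega>) + u * L \<omega>)) \<partial>M)
    = ennreal (exp ((\<integral>\<omega>. (c (W \<omega>))\<^sup>2 \<partial>M) / 2 + u * c h + u\<^sup>2 * (\<integral>\<omega>. (L \<omega>)\<^sup>2 \<partial>M) / 2))"
proof -
  have M: "prob_space M" and Wm [measurable]: "W \<in> borel_measurable M"
    and gs: "\<And>b. bounded_linear b \<Longrightarrow> \<exists>V\<ge>0. distr M borel (\<lambda>\<omega>. b (W \<omega>)) = gaussian 0 V"
    using W unfolding centered_gaussian_element_def by auto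
  interpret prob_space M by (rule M)
  obtain b where b: "\<And>k. bounded_linear (b k)"
    and lim: "(\<lambda>k. \<integral>\<^sup>+\<omega>. ennreal ((b k (W \<omega>) - L \<omega>)\<^sup>2) \<partial>M) \<longlonglongrightarrow> 0"
    and Lm [measurable]: "L \<in> borel_measurable M" and L2: "integrable M (\<lambda>\<omega>. (L \<omega>)\<^sup>2)"
    and pettis: "has_pettis_integral M (\<lambda>\<omega>. L \<omega> *\<^sub>R W \<omega>) h"
    using L unfolding rkhs_representer_def by blast
  have bW [measurable]: "(\<lambda>\<omega>. e (W \<omega>)) \<in> borel_measurable M" if "bounded_linear e" for e :: "'b \<Rightarrow> real"
    using measurable_compose[OF Wm borel_measurable_bounded_linear[OF that]] .
  note [measurable] = bW[OF c] bW[OF b]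
  define Z where "Z \<omega> = c (W \<omega>) + u * L \<omega>" for \<omega>
  define bk where "bk k w = c w + u * b k w" for k w
  have bk: "bounded_linear (bk k)" for k
    unfolding bk_def by (intro bounded_linear_add c bounded_linear_const_mult b)
  obtain V where V: "\<And>k. 0 \<le> V k" "\<And>k. distr M borel (\<lambda>\<omega>. bk k (W \<omega>)) = gaussian 0 (V k)"
    using gs[OF bk] by metis
  obtain Vc where Vc: "0 \<le> Vc" "distr M borel (\<lambda>\<omega>. c (W \<omega>)) = gaussian 0 Vc" using gs[OF c] by blast
  have c2: "integrable M (\<lambda>\<omega>. (c (W \<omega>))\<^sup>2)"
    using gaussian_second_moment(1)[OF Vc(1)] unfolding Vc(2)[symmetric] by (simp add: integrable_distr_eq)
  have cL: "has_bochner_integral M (\<lambda>\<omega>. L \<omega> * c (W \<omega>)) (c h)"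
  proof -
    interpret bounded_linear c by (rule c)
    show ?thesis using pettis c unfolding has_pettis_integral_def by (auto simp: scaleR)
  qed
  have Zsq: "(Z \<omega>)\<^sup>2 = (c (W \<omega>))\<^sup>2 + 2 * u * (L \<omega> * c (W \<omega>)) + u\<^sup>2 * (L \<omega>)\<^sup>2" for \<omega>
    by (simp add: Z_def power2_eq_square algebra_simps)
  have Z2: "integrable M (\<lambda>\<omega>. (Z \<omega>)\<^sup>2)"
    unfolding Zsq using c2 L2 cL by (auto simp: has_bochner_integral_iff)
  have EZ2: "(\<integral>\<omega>. (Z \<omega>)\<^sup>2 \<partial>M) = (\<integral>\<omega>. (c (W \<omega>))\<^sup>2 \<partial>M) + 2 * u * c h + u\<^sup>2 * (\<integral>\<omega>. (L \<omega>)\<^sup>2 \<partial>M)"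
    unfolding Zsq using c2 L2 cL by (simp add: has_bochner_integral_iff)
  have Zm [measurable]: "Z \<in> borel_measurable M" unfolding Z_def by measurable
  have "(\<integral>\<^sup>+\<omega>. ennreal ((bk k (W \<omega>) - Z \<omega>)\<^sup>2) \<partial>M)
      = ennreal (u\<^sup>2) * (\<integral>\<^sup>+\<omega>. ennreal ((b k (W \<omega>) - L \<omega>)\<^sup>2) \<partial>M)" for k
    by (subst nn_integral_cmult[symmetric])
      (auto simp: bk_def Z_def ennreal_mult[symmetric] power_mult_distrib[symmetric] right_diff_distrib)
  moreover have "(\<lambda>k. ennreal (u\<^sup>2) * (\<integral>\<^sup>+\<omega>. ennreal ((b k (W \<omega>) - L \<omega>)\<^sup>2) \<partial>M)) \<longlonglongrightarrow> ennreal (u\<^sup>2) * 0"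
    by (intro ennreal_tendsto_cmult lim) auto
  ultimately have limZ: "(\<lambda>k. \<integral>\<^sup>+\<omega>. ennreal ((bk k (W \<omega>) - Z \<omega>)\<^sup>2) \<partial>M) \<longlonglongrightarrow> 0" by simp
  have dZ: "gaussian 0 (\<integral>\<omega>. (Z \<omega>)\<^sup>2 \<partial>M) = distr M borel Z"
    by (rule sym) (rule gaussian_L2_limit[OF M bW[OF bk] Zm V limZ Z2])
  have "(\<integral>\<^sup>+\<omega>. ennreal (exp (Z \<omega>)) \<partial>M) = (\<integral>\<^sup>+x. ennreal (exp (1 * x)) \<partial>gaussian 0 (\<integral>\<omega>. (Z \<omega>)\<^sup>2 \<partial>M))"
    unfolding dZ by (simp add: nn_integral_distr)
  also have "\<dots> = ennreal (exp ((\<integral>\<omega>. (Z \<omega>)\<^sup>2 \<partial>M) / 2))"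
    by (subst nn_integral_exp_gaussian) auto
  finally show ?thesis unfolding EZ2 unfolding Z_def by (simp add: add_divide_distrib)
qed

text \<open>It suffices to compare Laplace transforms of the two laws. Weighting by the exponential
  of L adds the cross term b(h) to the exponent of E exp (b(W)), which is exactly the effect of
  translating by \<open>h\<close>; the subtracted half variance removes the contribution of L
  itself.\<close>

theorem cameron_martin:
  fixes W :: "'w \<Rightarrow> C01"
  assumes W: "centered_gaussian_element M W" and L: "rkhs_representer M W h L"
    and F [measurable]: "F \<in> borel_measurable borel"
  shows "(\<integral>\<^sup>+\<omega>. F (W \<omega> + h) \<partial>M)
    = (\<integral>\<^sup>+\<omega>. F (W \<omega>) * ennreal (exp (L \<omega> - (\<integral>\<omega>. (L \<omega>)\<^sup>2 \<partial>M) / 2)) \<partial>M)"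
proof -
  have M: "prob_space M" and Wm [measurable]: "W \<in> borel_measurable M"
    using W unfolding centered_gaussian_element_def by auto
  interpret prob_space M by (rule M)
  have Lm [measurable]: "L \<in> borel_measurable M" using L by (auto simp: rkhs_representer_def)
  define S where "S = (\<integral>\<omega>. (L \<omega>)\<^sup>2 \<partial>M)"
  have Wh [measurable]: "(\<lambda>\<omega>. W \<omega> + h) \<in> borel_measurable M"
    by (rule measurable_compose[OF Wm]) (intro borel_measurable_continuous_onI continuous_intros)
  define \<mu> where "\<mu> = distr M borel (\<lambda>\<omega>. W \<omega> + h)"
  define \<nu> where "\<nu> = distr (density M (\<lambda>\<omega>. ennreal (exp (L \<omega> - S / 2)))) borel W"
  have mu: "(\<integral>\<^sup>+w. G w \<partial>\<mu>) = (\<integral>\<^sup>+\<omega>. G (W \<omega> + h) \<partial>M)" if "G \<in> borel_measurable borel" for G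
    using that unfolding \<mu>_def by (simp add: nn_integral_distr)
  have nu: "(\<integral>\<^sup>+w. G w \<partial>\<nu>) = (\<integral>\<^sup>+\<omega>. G (W \<omega>) * ennreal (exp (L \<omega> - S / 2)) \<partial>M)"
    if [measurable]: "G \<in> borel_measurable borel" for G
    unfolding \<nu>_def by (simp add: nn_integral_distr nn_integral_density mult.commute)
  have "\<mu> = \<nu>"
  proof (rule C01_measure_eqI)
    show "prob_space \<mu>" unfolding \<mu>_def by (rule prob_space_distr) simp
    show "sets \<mu> = sets borel" "sets \<nu> = sets borel" by (simp_all add: \<mu>_def \<nu>_def)
    fix b :: "C01 \<Rightarrow> real" assume b: "bounded_linear b"
    then interpret b: bounded_linear b .
    have [measurable]: "b \<in> borel_measurable borel" by (rule borel_measurable_bounded_linear[OF b])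
    have "(\<integral>\<^sup>+w. ennreal (exp (b w)) \<partial>\<mu>) = (\<integral>\<^sup>+\<omega>. ennreal (exp (b h)) * ennreal (exp (b (W \<omega>) + 0 * L \<omega>)) \<partial>M)"
      by (subst mu) (auto simp: b.add exp_add ennreal_mult mult.commute)
    also have "\<dots> = ennreal (exp (b h)) * (\<integral>\<^sup>+\<omega>. ennreal (exp (b (W \<omega>) + 0 * L \<omega>)) \<partial>M)"
      by (rule nn_integral_cmult) measurable
    also have "\<dots> = ennreal (exp ((\<integral>\<omega>. (b (W \<omega>))\<^sup>2 \<partial>M) / 2 + b h))"
      unfolding nn_integral_exp_representer[OF W L b] by (simp add: exp_add ennreal_mult[symmetric] mult.commute)
    finally have 1: "(\<integral>\<^sup>+w. ennreal (exp (b w)) \<partial>\<mu>) = ennreal (exp ((\<integral>\<omega>. (b (W \<omega>))\<^sup>2 \<partial>M) / 2 + b h))" .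
    have "(\<integral>\<^sup>+w. ennreal (exp (b w)) \<partial>\<nu>) = (\<integral>\<^sup>+\<omega>. ennreal (exp (- S / 2)) * ennreal (exp (b (W \<omega>) + 1 * L \<omega>)) \<partial>M)"
      by (subst nu) (auto simp: ennreal_mult[symmetric] exp_add[symmetric] algebra_simps intro!: nn_integral_cong)
    also have "\<dots> = ennreal (exp (- S / 2)) * (\<integral>\<^sup>+\<omega>. ennreal (exp (b (W \<omega>) + 1 * L \<omega>)) \<partial>M)"
      by (rule nn_integral_cmult) measurable
    also have "\<dots> = ennreal (exp ((\<integral>\<omega>. (b (W \<omega>))\<^sup>2 \<partial>M) / 2 + b h))"
      unfolding nn_integral_exp_representer[OF W L b] S_def[symmetric]
      by (simp add: ennreal_mult[symmetric] exp_add[symmetric])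
    finally have 2: "(\<integral>\<^sup>+w. ennreal (exp (b w)) \<partial>\<nu>) = ennreal (exp ((\<integral>\<omega>. (b (W \<omega>))\<^sup>2 \<partial>M) / 2 + b h))" .
    show "(\<integral>\<^sup>+w. ennreal (exp (b w)) \<partial>\<mu>) < \<infinity>" unfolding 1 by simp
    show "(\<integral>\<^sup>+w. ennreal (exp (b w)) \<partial>\<mu>) = (\<integral>\<^sup>+w. ennreal (exp (b w)) \<partial>\<nu>)" unfolding 1 2 ..
  qed
  then show ?thesis using mu[OF F] nu[OF F] by (simp add: S_def)
qed

text \<open>Cauchy-Schwarz for the factorisation of 1 into exp (g/2) and exp (- g/2) on
  \<open>B\<close>. It serves twice: with a representer for the prior mass of a shifted ball, and
  with a log likelihood ratio for the inverse evidence.\<close>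

lemma emeasure_squared_le:
  assumes B: "B \<in> sets M" and g [measurable]: "g \<in> borel_measurable M"
  shows "(emeasure M B)\<^sup>2 \<le> (\<integral>\<^sup>+x. ennreal (exp (g x)) * indicator B x \<partial>M) *
    (\<integral>\<^sup>+x. ennreal (exp (- g x)) * indicator B x \<partial>M)"
proof -
  note [measurable] = B
  have "emeasure M B = (\<integral>\<^sup>+x. (ennreal (exp (g x / 2)) * indicator B x) * (ennreal (exp (- g x / 2)) * indicator B x) \<partial>M)"
    by (subst nn_integral_indicator[symmetric, OF B], intro nn_integral_cong)
      (auto simp: indicator_def ennreal_mult[symmetric] exp_add[symmetric])
  then have "(emeasure M B)\<^sup>2 \<le> (\<integral>\<^sup>+x. (ennreal (exp (g x / 2)) * indicator B x)\<^sup>2 \<partial>M) *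
      (\<integral>\<^sup>+x. (ennreal (exp (- g x / 2)) * indicator B x)\<^sup>2 \<partial>M)"
    by (simp add: Cauchy_Schwarz_nn_integral)
  also have "(\<lambda>x. (ennreal (exp (g x / 2)) * indicator B x)\<^sup>2) = (\<lambda>x. ennreal (exp (g x)) * indicator B x)"
    by (auto simp: fun_eq_iff indicator_def power2_eq_square ennreal_mult[symmetric] exp_add[symmetric])
  also have "(\<lambda>x. (ennreal (exp (- g x / 2)) * indicator B x)\<^sup>2) = (\<lambda>x. ennreal (exp (- g x)) * indicator B x)"
    by (auto simp: fun_eq_iff indicator_def power2_eq_square ennreal_mult[symmetric] exp_add[symmetric])
  finally show ?thesis .
qed

text \<open>The Cauchy--Schwarz inequality replaces the usual symmetry argument, at the price of a factor 2
  in the exponent.\<close>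

lemma prior_mass_lower_bound:
  fixes W :: "'w \<Rightarrow> C01"
  assumes W: "centered_gaussian_element M W"
    and conc: "concentration_fun M W \<eta> e \<le> ereal a"
  shows "emeasure M {\<omega> \<in> space M. norm (W \<omega> - \<eta>) \<le> 2 * e} \<ge> ennreal (exp (- 2 * a - 1))"
proof -
  have M: "prob_space M" and Wm [measurable]: "W \<in> borel_measurable M"
    using W unfolding centered_gaussian_element_def by auto
  interpret prob_space M by (rule M)
  define p where "p = measure M {\<omega> \<in> space M. norm (W \<omega>) \<le> e}"
  define I where "I = (INF h\<in>{h \<in> rkhs M W. norm (h - \<eta>) < e}. ereal ((rkhs_norm M W h)\<^sup>2))"
  have I0: "0 \<le> I" unfolding I_def by (intro INF_greatest) simp
  have cI: "(if p = 0 then \<infinity> else ereal (- ln p)) + ereal (1/2) * I \<le> ereal a"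
    using conc unfolding concentration_fun_def p_def I_def Let_def .
  \<comment> \<open>A null small ball would make the concentration function infinite, against its
    real bound.\<close>
  have p0: "p \<noteq> 0"
  proof
    assume "p = 0"
    moreover have "ereal (1/2) * I \<noteq> -\<infinity>" using I0 by (cases I) auto
    ultimately show False using cI by simp
  qed
  then have p: "p > 0" unfolding p_def by (simp add: zero_less_measure_iff)
  have Ile: "I \<le> ereal (2 * (a + ln p))" using cI p0 I0 by (cases I) auto
  \<comment> \<open>The infimum need not be attained; the slack 1 spent here is the 1 in the final
    exponent.\<close>
  then have "I < ereal (2 * (a + ln p) + 1)" by (rule le_less_trans) simp
  then obtain h where h: "h \<in> rkhs M W" "norm (h - \<eta>) < e" and hn: "(rkhs_norm M W h)\<^sup>2 < 2 * (a + ln p) + 1"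
    unfolding I_def by (auto simp: INF_less_iff)
  obtain L where L: "rkhs_representer M W h L" using h by (auto simp: rkhs_def)
  define S where "S = (\<integral>\<omega>. (L \<omega>)\<^sup>2 \<partial>M)"
  have S: "S < 2 * (a + ln p) + 1" using hn unfolding rkhs_norm_eq[OF Wm L] S_def by simp
  have Lm [measurable]: "L \<in> borel_measurable M" using L by (auto simp: rkhs_representer_def)
  define B where "B = {\<omega> \<in> space M. norm (W \<omega>) \<le> e}"
  have [measurable]: "B \<in> sets M" unfolding B_def by measurable
  define X where "X = (\<integral>\<^sup>+\<omega>. ennreal (exp (- L \<omega>)) * indicator B \<omega> \<partial>M)"
  define P where "P = emeasure M {\<omega> \<in> space M. norm (W \<omega> - \<eta>) \<le> 2 * e}"
  have Fm: "indicator (cball 0 e) \<in> borel_measurable (borel :: C01 measure)"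
    by (rule borel_measurable_indicator) (simp add: borel_closed)
  \<comment> \<open>Cameron-Martin for the shift by -h: the left side is the probability that W lies
    within e of h, and h is within e of \<eta>.\<close>
  have "X * ennreal (exp (- S / 2)) = (\<integral>\<^sup>+\<omega>. indicator (cball 0 e) (W \<omega>) * ennreal (exp (- L \<omega> - S / 2)) \<partial>M)"
    unfolding X_def
    by (subst nn_integral_multc[symmetric])
      (auto simp: B_def indicator_def ennreal_mult[symmetric] exp_add[symmetric] intro!: nn_integral_cong)
  also have "\<dots> = (\<integral>\<^sup>+\<omega>. indicator (cball 0 e) (W \<omega> + (-1) *\<^sub>R h) \<partial>M)"
    using cameron_martin[OF W rkhs_representer_scale[OF L Wm, of "-1"] Fm] by (simp add: S_def)
  also have "\<dots> \<le> (\<integral>\<^sup>+\<omega>. indicator {\<omega> \<in> space M. norm (W \<omega> - \<eta>) \<le> 2 * e} \<omega> \<partial>M)"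
  proof (rule nn_integral_mono)
    fix \<omega> assume \<omega>: "\<omega> \<in> space M"
    have "norm (W \<omega> - \<eta>) \<le> norm (W \<omega> - h) + norm (h - \<eta>)"
      using norm_triangle_ineq[of "W \<omega> - h" "h - \<eta>"] by simp
    then show "indicator (cball 0 e) (W \<omega> + (-1) *\<^sub>R h)
        \<le> (indicator {\<omega> \<in> space M. norm (W \<omega> - \<eta>) \<le> 2 * e} \<omega> :: ennreal)"
      using h(2) \<omega> by (auto simp: indicator_def)
  qed
  also have "\<dots> = P"
  proof -
    have "(\<lambda>\<omega>. norm (W \<omega> - \<eta>)) \<in> borel_measurable M"
      by (rule measurable_compose[OF Wm]) (intro borel_measurable_continuous_onI continuous_intros)
    then have "{\<omega> \<in> space M. norm (W \<omega> - \<eta>) \<le> 2 * e} \<in> sets M" by measurable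
    then show ?thesis by (simp add: P_def)
  qed
  finally have XP: "X * ennreal (exp (- S / 2)) \<le> P" .
  have "(\<integral>\<^sup>+\<omega>. ennreal (exp (L \<omega>)) * indicator B \<omega> \<partial>M) \<le> (\<integral>\<^sup>+\<omega>. ennreal (exp (0 + 1 * L \<omega>)) \<partial>M)"
    by (intro nn_integral_mono) (auto simp: indicator_def)
  also have "\<dots> = ennreal (exp (S / 2))"
    using nn_integral_exp_representer[OF W L bounded_linear_zero, of 1] by (simp add: S_def)
  finally have Y: "(\<integral>\<^sup>+\<omega>. ennreal (exp (L \<omega>)) * indicator B \<omega> \<partial>M) \<le> ennreal (exp (S / 2))" .
  have "ennreal (p\<^sup>2) = (emeasure M B)\<^sup>2"
    by (simp add: p_def B_def[symmetric] emeasure_eq_measure ennreal_power)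
  also have "\<dots> \<le> (\<integral>\<^sup>+\<omega>. ennreal (exp (L \<omega>)) * indicator B \<omega> \<partial>M) * X"
    unfolding X_def by (rule emeasure_squared_le) measurable
  also have "\<dots> \<le> ennreal (exp (S / 2)) * X" by (intro mult_right_mono Y) simp
  finally have "ennreal (p\<^sup>2) * ennreal (exp (- S)) \<le> (ennreal (exp (S / 2)) * X) * ennreal (exp (- S))"
    by (rule mult_right_mono) simp
  also have "\<dots> = X * ennreal (exp (- S / 2))"
    by (simp add: mult.commute mult.left_commute ennreal_mult[symmetric] exp_add[symmetric] mult.assoc[symmetric])
  also note XP
  finally have "ennreal (p\<^sup>2 * exp (- S)) \<le> P" by (simp add: ennreal_mult)
  \<comment> \<open>The small-ball probability cancels: p^2 is exp (2 ln p), and S is below 2 a + 2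
    ln p + 1.\<close>
  moreover have "exp (- 2 * a - 1) \<le> p\<^sup>2 * exp (- S)"
  proof -
    have "p\<^sup>2 = exp (2 * ln p)" using p by (simp add: exp_double)
    then have "p\<^sup>2 * exp (- S) = exp (2 * ln p - S)" by (simp add: exp_diff exp_minus field_simps)
    then show ?thesis using S by simp
  qed
  ultimately show ?thesis unfolding P_def by (meson ennreal_leI order_trans)
qed

section \<open>A Laplace-transform criterion in bounded Lipschitz distance\<close>

lemma d_BL_leI:
  assumes "\<And>g :: real \<Rightarrow> real. (\<And>x. \<bar>g x\<bar> \<le> 1) \<Longrightarrow> 1-lipschitz_on UNIV g \<Longrightarrow>
    \<bar>(\<integral>x. g x \<partial>Q) - (\<integral>x. g x \<partial>R)\<bar> \<le> c"
  shows "d_BL Q R \<le> ennreal c"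
  unfolding d_BL_def by (rule SUP_least) (auto intro!: ennreal_leI assms)

lemma d_BL_leD:
  assumes "d_BL Q R \<le> ennreal c" "0 \<le> c"
    and "\<And>x. \<bar>g x\<bar> \<le> 1" "1-lipschitz_on UNIV g"
  shows "\<bar>(\<integral>x. g x \<partial>Q) - (\<integral>x. g x \<partial>R)\<bar> \<le> c"
proof -
  have "ennreal \<bar>(\<integral>x. g x \<partial>Q) - (\<integral>x. g x \<partial>R)\<bar> \<le> d_BL Q R"
    unfolding d_BL_def using assms(3,4) by (intro SUP_upper) auto
  then have "ennreal \<bar>(\<integral>x. g x \<partial>Q) - (\<integral>x. g x \<partial>R)\<bar> \<le> ennreal c" using assms(1) by (rule order_trans)
  then show ?thesis using assms(2) by simp
qed

lemma lipschitz_borel: "1-lipschitz_on UNIV (g :: real \<Rightarrow> real) \<Longrightarrow> g \<in> borel_measurable borel"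
  by (intro borel_measurable_continuous_onI lipschitz_on_continuous_on)

text \<open>Test functions are 1-Lipschitz and bounded by 1, whence both entries of the minimum. The
  truncation at 2 makes the bound accessible to dominated convergence.\<close>

lemma d_BL_coupling:
  assumes O: "prob_space \<Omega>" and [measurable]: "X \<in> borel_measurable \<Omega>" "Y \<in> borel_measurable \<Omega>"
  shows "d_BL (distr \<Omega> borel X) (distr \<Omega> borel Y) \<le> ennreal (\<integral>x. min 2 \<bar>X x - Y x\<bar> \<partial>\<Omega>)"
proof (rule d_BL_leI)
  interpret prob_space \<Omega> by fact
  fix g :: "real \<Rightarrow> real" assume g: "\<And>x. \<bar>g x\<bar> \<le> 1" "1-lipschitz_on UNIV g"
  note [measurable] = lipschitz_borel[OF g(2)]
  have i: "integrable \<Omega> (\<lambda>x. g (Z x))" if [measurable]: "Z \<in> borel_measurable \<Omega>" for Z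
    by (rule integrable_const_bound[of _ 1]) (use g in auto)
  have "\<bar>(\<integral>x. g x \<partial>distr \<Omega> borel X) - (\<integral>x. g x \<partial>distr \<Omega> borel Y)\<bar> = \<bar>\<integral>x. g (X x) - g (Y x) \<partial>\<Omega>\<bar>"
    using i by (simp add: integral_distr)
  also have "\<dots> \<le> (\<integral>x. \<bar>g (X x) - g (Y x)\<bar> \<partial>\<Omega>)" by (rule integral_abs_bound)
  also have "\<dots> \<le> (\<integral>x. min 2 \<bar>X x - Y x\<bar> \<partial>\<Omega>)"
  proof (rule integral_mono)
    fix x
    have "\<bar>g (X x) - g (Y x)\<bar> \<le> \<bar>X x - Y x\<bar>"
      using lipschitz_onD[OF g(2), of "X x" "Y x"] by (simp add: dist_real_def)
    moreover have "\<bar>g (X x) - g (Y x)\<bar> \<le> 2" using g(1)[of "X x"] g(1)[of "Y x"] by linarith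
    ultimately show "\<bar>g (X x) - g (Y x)\<bar> \<le> min 2 \<bar>X x - Y x\<bar>" by simp
  next
    show "integrable \<Omega> (\<lambda>x. min 2 \<bar>X x - Y x\<bar>)"
      by (rule integrable_const_bound[of _ 2]) auto
  qed (use i in auto)
  finally show "\<bar>(\<integral>x. g x \<partial>distr \<Omega> borel X) - (\<integral>x. g x \<partial>distr \<Omega> borel Y)\<bar> \<le> (\<integral>x. min 2 \<bar>X x - Y x\<bar> \<partial>\<Omega>)" .
qed

text \<open>Uniform integrability: a second moment bound C leaves at most C / K above the level K,
  truncated means converge by dominated convergence, and then K grows. Fatou passes the second
  moment bound on to the limit.\<close>

lemma integral_limit_of_bounded_second_moment:
  fixes Z :: "nat \<Rightarrow> 'a \<Rightarrow> real"
  assumes O: "prob_space \<Omega>"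
    and m [measurable]: "\<And>j. Z j \<in> borel_measurable \<Omega>" "Y \<in> borel_measurable \<Omega>"
    and pos: "\<And>j x. 0 \<le> Z j x" "\<And>x. 0 \<le> Y x"
    and lim: "\<And>x. x \<in> space \<Omega> \<Longrightarrow> (\<lambda>j. Z j x) \<longlonglongrightarrow> Y x"
    and C: "\<forall>\<^sub>F j in sequentially. (\<integral>\<^sup>+x. ennreal ((Z j x)\<^sup>2) \<partial>\<Omega>) \<le> ennreal C" and C0: "0 \<le> C"
    and e: "(\<lambda>j. \<integral>\<^sup>+x. ennreal (Z j x) \<partial>\<Omega>) \<longlonglongrightarrow> ennreal m"
  shows "(\<integral>\<^sup>+x. ennreal (Y x) \<partial>\<Omega>) = ennreal m"
proof -
  interpret prob_space \<Omega> by fact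
  have Y2: "(\<integral>\<^sup>+x. ennreal ((Y x)\<^sup>2) \<partial>\<Omega>) \<le> ennreal C"
  proof -
    have "(\<integral>\<^sup>+x. ennreal ((Y x)\<^sup>2) \<partial>\<Omega>) = (\<integral>\<^sup>+x. liminf (\<lambda>j. ennreal ((Z j x)\<^sup>2)) \<partial>\<Omega>)"
      by (intro nn_integral_cong lim_imp_Liminf[symmetric] tendsto_ennrealI tendsto_power lim) auto
    also have "\<dots> \<le> liminf (\<lambda>j. \<integral>\<^sup>+x. ennreal ((Z j x)\<^sup>2) \<partial>\<Omega>)" by (rule nn_integral_liminf) measurable
    also have "\<dots> \<le> liminf (\<lambda>j. ennreal C)" by (rule Liminf_mono) (rule C)
    finally show ?thesis by (simp add: Liminf_const)
  qed
  define E where "E K = (\<integral>x. min (Y x) K \<partial>\<Omega>)" for K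
  have iK: "integrable \<Omega> (\<lambda>x. min (F x) K)" if [measurable]: "F \<in> borel_measurable \<Omega>" and "\<And>x. 0 \<le> F x" "K > 0" for F :: "'a \<Rightarrow> real" and K
    by (rule integrable_const_bound[of _ K]) (use that(2,3) in auto)
  have lo: "ennreal (\<integral>x. min (F x) K \<partial>\<Omega>) \<le> (\<integral>\<^sup>+x. ennreal (F x) \<partial>\<Omega>)"
    if [measurable]: "F \<in> borel_measurable \<Omega>" and F: "\<And>x. 0 \<le> F x" and K: "K > 0" for F :: "'a \<Rightarrow> real" and K
  proof -
    have "ennreal (\<integral>x. min (F x) K \<partial>\<Omega>) = (\<integral>\<^sup>+x. ennreal (min (F x) K) \<partial>\<Omega>)"
      using F K by (intro nn_integral_eq_integral[symmetric] iK) (auto simp: less_imp_le)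
    also have "\<dots> \<le> (\<integral>\<^sup>+x. ennreal (F x) \<partial>\<Omega>)" by (intro nn_integral_mono ennreal_leI) simp
    finally show ?thesis .
  qed
  have hi: "(\<integral>\<^sup>+x. ennreal (F x) \<partial>\<Omega>) \<le> ennreal (\<integral>x. min (F x) K \<partial>\<Omega>) + ennreal (C / K)"
    if [measurable]: "F \<in> borel_measurable \<Omega>" and F: "\<And>x. 0 \<le> F x" and K: "K > 0"
      and F2: "(\<integral>\<^sup>+x. ennreal ((F x)\<^sup>2) \<partial>\<Omega>) \<le> ennreal C" for F :: "'a \<Rightarrow> real" and K
  proof -
    \<comment> \<open>Above the level K, z is at most z^2 / K.\<close>
    have b: "z \<le> min z K + (1 / K) * z\<^sup>2" if "z \<ge> 0" for z
    proof (cases "z \<le> K")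
      case False
      then have "z * K \<le> z * z" using that by (intro mult_left_mono) auto
      then have "z \<le> (1 / K) * z\<^sup>2" using K by (simp add: field_simps power2_eq_square)
      then show ?thesis using False K by simp
    qed (use that K in auto)
    have "(\<integral>\<^sup>+x. ennreal (F x) \<partial>\<Omega>) \<le> (\<integral>\<^sup>+x. ennreal (min (F x) K) + ennreal (1 / K) * ennreal ((F x)\<^sup>2) \<partial>\<Omega>)"
      using b F K by (intro nn_integral_mono) (simp add: ennreal_mult[symmetric] ennreal_plus[symmetric] ennreal_leI del: ennreal_plus)
    also have "\<dots> = (\<integral>\<^sup>+x. ennreal (min (F x) K) \<partial>\<Omega>) + ennreal (1 / K) * (\<integral>\<^sup>+x. ennreal ((F x)\<^sup>2) \<partial>\<Omega>)"
      by (subst nn_integral_add) (auto simp: nn_integral_cmult)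
    also have "(\<integral>\<^sup>+x. ennreal (min (F x) K) \<partial>\<Omega>) = ennreal (\<integral>x. min (F x) K \<partial>\<Omega>)"
      using F K by (intro nn_integral_eq_integral iK) (auto simp: less_imp_le)
    also have "ennreal (1 / K) * (\<integral>\<^sup>+x. ennreal ((F x)\<^sup>2) \<partial>\<Omega>) \<le> ennreal (1 / K) * ennreal C"
      by (intro mult_left_mono F2) simp
    finally show ?thesis using K C0 by (simp add: ennreal_mult[symmetric] add_left_mono)
  qed
  have El: "(\<lambda>j. \<integral>x. min (Z j x) K \<partial>\<Omega>) \<longlonglongrightarrow> E K" if "K > 0" for K
    unfolding E_def
    by (rule integral_dominated_convergence[where w = "\<lambda>_. K"])
      (use pos that in \<open>auto intro!: AE_I2 tendsto_min lim\<close>)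
  have b1: "ennreal (E K) \<le> ennreal m" if K: "K > 0" for K
    by (rule LIMSEQ_le[OF tendsto_ennrealI[OF El[OF K]] e]) (use lo[OF m(1) pos(1) K] in auto)
  have b2: "ennreal m \<le> ennreal (E K) + ennreal (C / K)" if K: "K > 0" for K
  proof (rule LIMSEQ_le[OF e tendsto_add[OF tendsto_ennrealI[OF El[OF K]] tendsto_const]])
    obtain N where "\<And>j. j \<ge> N \<Longrightarrow> (\<integral>\<^sup>+x. ennreal ((Z j x)\<^sup>2) \<partial>\<Omega>) \<le> ennreal C"
      using C by (auto simp: eventually_sequentially)
    then show "\<exists>N. \<forall>n\<ge>N. (\<integral>\<^sup>+x. ennreal (Z n x) \<partial>\<Omega>) \<le> ennreal (\<integral>x. min (Z n x) K \<partial>\<Omega>) + ennreal (C / K)"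
      using hi[OF m(1) pos(1) K] by blast
  qed
  note c1 = lo[OF m(2) pos(2)] and c2 = hi[OF m(2) pos(2) _ Y2]
  have K0: "(\<lambda>k. C / real (Suc k)) \<longlonglongrightarrow> 0"
    using tendsto_mult_right_zero[OF LIMSEQ_Suc[OF lim_1_over_n[where 'a = real]], of C] by simp
  have 1: "(\<integral>\<^sup>+x. ennreal (Y x) \<partial>\<Omega>) \<le> ennreal m + ennreal (C / real (Suc k))" for k
    using c2[of "real (Suc k)"] b1[of "real (Suc k)"]
    unfolding E_def by (meson add_right_mono of_nat_0_less_iff order_trans zero_less_Suc)
  have 2: "ennreal m \<le> (\<integral>\<^sup>+x. ennreal (Y x) \<partial>\<Omega>) + ennreal (C / real (Suc k))" for k
    using b2[of "real (Suc k)"] c1[of "real (Suc k)"]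
    unfolding E_def by (meson add_right_mono of_nat_0_less_iff order_trans zero_less_Suc)
  have l: "(\<lambda>k. a + ennreal (C / real (Suc k))) \<longlonglongrightarrow> a" for a
    using tendsto_add[OF tendsto_const[of a] tendsto_ennrealI[OF K0]] by simp
  show ?thesis
    by (intro antisym LIMSEQ_le_const[OF l]) (use 1 2 in auto)
qed

text \<open>Rational arguments determine the transform by dominated convergence between two rational
  exponents. Countability matters because the criterion below can prescribe only finitely many
  arguments at a time.\<close>

lemma mgf_eq_of_rational:
  assumes N: "real_distribution N" and V: "0 \<le> V"
    and q: "\<And>q. (\<integral>\<^sup>+x. ennreal (exp (of_rat q * x)) \<partial>N) = ennreal (exp ((of_rat q)\<^sup>2 * V / 2))"
  shows "N = gaussian 0 V"
proof (rule nn_mgf_uniqueness[OF N real_distribution_gaussian])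
  interpret real_distribution N by fact
  have [measurable]: "(\<lambda>x. exp (s * x)) \<in> borel_measurable N" for s
    unfolding measurable_cong_sets[OF events_eq_borel refl] by measurable
  have qi: "integrable N (\<lambda>x. exp (of_rat q * x))" for q
    by (rule integrableI_bounded) (use q[of q] in auto)
  fix t :: real
  define qs where "qs k = (SOME q. t < of_rat q \<and> of_rat q < t + 1 / real (Suc k))" for k
  have qs: "t < of_rat (qs k)" "of_rat (qs k) < t + 1 / real (Suc k)" for k
    using someI_ex[OF of_rat_dense[of t "t + 1 / real (Suc k)"]] by (auto simp: qs_def)
  obtain a where a: "of_rat a < t" using of_rat_dense[of "t - 1" t] by auto
  obtain b where b: "t + 1 < of_rat b" using of_rat_dense[of "t + 1" "t + 2"] by auto
  have l0: "(\<lambda>k. t + 1 / real (Suc k)) \<longlonglongrightarrow> t"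
    using tendsto_add[OF tendsto_const[of t] LIMSEQ_Suc[OF lim_1_over_n[where 'a = real]]] by simp
  have ql: "(\<lambda>k. of_rat (qs k)) \<longlonglongrightarrow> t"
    by (rule tendsto_sandwich[OF _ _ tendsto_const l0]) (use qs in \<open>auto intro!: always_eventually less_imp_le simp del: of_nat_Suc\<close>)
  have dom: "exp (s * x) \<le> exp (of_rat a * x) + exp (of_rat b * x)" if "of_rat a \<le> s" "s \<le> of_rat b" for s x :: real
  proof (cases "x \<ge> 0")
    case True
    then have "s * x \<le> of_rat b * x" using that by (intro mult_right_mono)
    then show ?thesis by (simp add: add_increasing)
  next
    case False
    then have "s * x \<le> of_rat a * x" using that by (intro mult_right_mono_neg) auto
    then show ?thesis by (simp add: add_increasing2)
  qed
  have ti: "integrable N (\<lambda>x. exp (t * x))"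
    by (rule Bochner_Integration.integrable_bound[OF Bochner_Integration.integrable_add[OF qi[of a] qi[of b]]])
      (use dom[of t] a b in \<open>auto intro!: AE_I2 order_trans[OF _ abs_ge_self]\<close>)
  have s1: "1 / real (Suc k) \<le> 1" for k by simp
  have "(\<lambda>k. \<integral>x. exp (of_rat (qs k) * x) \<partial>N) \<longlonglongrightarrow> (\<integral>x. exp (t * x) \<partial>N)"
  proof (rule integral_dominated_convergence[where w = "\<lambda>x. exp (of_rat a * x) + exp (of_rat b * x)"])
    show "AE x in N. norm (exp (of_rat (qs k) * x)) \<le> exp (of_rat a * x) + exp (of_rat b * x)" for k
      using dom[of "of_rat (qs k)"] qs[of k] s1[of k] a b by (intro AE_I2) auto
    show "AE x in N. (\<lambda>k. exp (of_rat (qs k) * x)) \<longlonglongrightarrow> exp (t * x)"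
      by (intro AE_I2 tendsto_intros ql)
  qed (use qi in auto)
  moreover have "(\<integral>x. exp (of_rat q * x) \<partial>N) = exp ((of_rat q)\<^sup>2 * V / 2)" for q
    using q[of q] nn_integral_eq_integral[OF qi[of q]] by simp
  moreover have "(\<lambda>k. exp ((of_rat (qs k))\<^sup>2 * V / 2)) \<longlonglongrightarrow> exp (t\<^sup>2 * V / 2)"
    by (intro tendsto_intros ql) auto
  ultimately have "(\<integral>x. exp (t * x) \<partial>N) = exp (t\<^sup>2 * V / 2)" using LIMSEQ_unique by auto
  then have "(\<integral>\<^sup>+x. ennreal (exp (t * x)) \<partial>N) = ennreal (exp (t\<^sup>2 * V / 2))"
    using nn_integral_eq_integral[OF ti] by simp
  then show "(\<integral>\<^sup>+x. ennreal (exp (t * x)) \<partial>N) < \<infinity>"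
    "(\<integral>\<^sup>+x. ennreal (exp (t * x)) \<partial>N) = (\<integral>\<^sup>+x. ennreal (exp (t * x)) \<partial>gaussian 0 V)"
    using nn_integral_exp_gaussian[OF V] by simp_all
qed

text \<open>Two inequalities instead of an absolute difference, because the transform may be
  infinite; \<open>ennreal\<close> turns a negative lower bound into 0.\<close>

definition mgf_close :: "real \<Rightarrow> real \<Rightarrow> real \<Rightarrow> real measure \<Rightarrow> bool"
  where "mgf_close V \<eta> t Q \<longleftrightarrow>
    (\<integral>\<^sup>+x. ennreal (exp (t * x)) \<partial>Q) \<le> ennreal (exp (t\<^sup>2 * V / 2) + \<eta>) \<and>
    ennreal (exp (t\<^sup>2 * V / 2) - \<eta>) \<le> (\<integral>\<^sup>+x. ennreal (exp (t * x)) \<partial>Q)"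

text \<open>The bounds at 1 and -1 give tightness, hence a weakly convergent subsequence, realised
  pointwise by Skorohod's theorem. Uniform integrability of the exponentials identifies the
  transform of the limit at rational arguments, so the limit is Gaussian, and the same coupling
  bounds the distance.\<close>

lemma mgf_close_sequence_d_BL:
  assumes V: "0 \<le> V" and Q: "\<And>k. real_distribution (Q k)"
    and one: "\<And>k. (\<integral>\<^sup>+x. ennreal (exp (1 * x)) \<partial>Q k) \<le> ennreal C" "\<And>k. (\<integral>\<^sup>+x. ennreal (exp (- 1 * x)) \<partial>Q k) \<le> ennreal C"
    and lim: "\<And>q::rat. (\<lambda>k. \<integral>\<^sup>+x. ennreal (exp (of_rat q * x)) \<partial>Q k) \<longlonglongrightarrow> ennreal (exp ((of_rat q)\<^sup>2 * V / 2))"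
    and \<delta>: "0 < \<delta>"
  shows "\<exists>k. d_BL (Q k) (gaussian 0 V) \<le> ennreal \<delta>"
proof -
  \<comment> \<open>Markov's inequality for exp x and exp (- x): the endpoint makes each tail at
    most e / 4.\<close>
  have tail: "measure (Q k) {a<..b} > 1 - e" if e: "0 < e" and ab: "a = - (ln (4 * (\<bar>C\<bar> + 1) / e))" "b = ln (4 * (\<bar>C\<bar> + 1) / e)" for k e a b
  proof -
    interpret Q: real_distribution "Q k" by (rule Q)
    have [measurable]: "(\<lambda>x. exp (s * x)) \<in> borel_measurable (Q k)" for s
      unfolding measurable_cong_sets[OF Q.events_eq_borel refl] by measurable
    have eb: "exp b = 4 * (\<bar>C\<bar> + 1) / e" unfolding ab using e by (subst exp_ln) (auto intro!: divide_pos_pos)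
    have mk: "emeasure (Q k) {x. b \<le> s * x} \<le> ennreal (e / 4)"
      if s: "(\<integral>\<^sup>+x. ennreal (exp (s * x)) \<partial>Q k) \<le> ennreal C" for s
    proof -
      have "emeasure (Q k) {x. b \<le> s * x} \<le> emeasure (Q k) {x\<in>UNIV. 1 \<le> ennreal (exp (- b)) * ennreal (exp (s * x))}"
        by (rule emeasure_mono) (auto simp: ennreal_mult[symmetric] exp_add[symmetric])
      also have "\<dots> \<le> ennreal (exp (- b)) * (\<integral>\<^sup>+x. ennreal (exp (s * x)) * indicator UNIV x \<partial>Q k)"
        using nn_integral_Markov_inequality[of "\<lambda>x. ennreal (exp (s * x))" UNIV "Q k" "ennreal (exp (-b))"] by simp
      also have "\<dots> \<le> ennreal (exp (- b)) * ennreal (\<bar>C\<bar> + 1)"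
        using order_trans[OF s ennreal_leI[of C "\<bar>C\<bar> + 1"]] by (intro mult_left_mono) (auto simp del: ennreal_plus)
      also have "\<dots> = ennreal (e / 4)"
      proof -
        have "exp (- b) * (\<bar>C\<bar> + 1) = e / 4"
          unfolding exp_minus eb using e by (simp add: field_simps add_nonneg_eq_0_iff)
        then show ?thesis by (metis ennreal_mult' exp_ge_zero)
      qed
      finally show ?thesis .
    qed
    have "emeasure (Q k) (- {a<..b}) \<le> emeasure (Q k) ({x. b \<le> 1 * x} \<union> {x. b \<le> - 1 * x})"
      by (rule emeasure_mono) (auto simp: ab)
    also have "\<dots> \<le> emeasure (Q k) {x. b \<le> 1 * x} + emeasure (Q k) {x. b \<le> - 1 * x}"
      by (rule emeasure_subadditive) auto
    also have "\<dots> \<le> ennreal (e / 4) + ennreal (e / 4)" by (intro add_mono mk one)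
    finally have "measure (Q k) (- {a<..b}) \<le> e / 2"
      using e by (simp add: Q.emeasure_eq_measure ennreal_plus[symmetric] del: ennreal_plus)
    moreover have "measure (Q k) (- {a<..b}) = 1 - measure (Q k) {a<..b}"
      using Q.prob_compl[of "{a<..b}"] by (simp add: Compl_eq_Diff_UNIV)
    ultimately show ?thesis using e by simp
  qed
  have "tight Q"
    unfolding tight_def
  proof (intro conjI allI impI Q)
    fix e :: real assume e: "0 < e"
    \<comment> \<open>Capping e at 1 makes the logarithm positive, so that the interval is
      nonempty.\<close>
    define e' where "e' = min e 1"
    have e': "0 < e'" "e' \<le> e" "e' \<le> 1" using e by (auto simp: e'_def)
    define b where "b = ln (4 * (\<bar>C\<bar> + 1) / e')"
    have "1 < 4 * (\<bar>C\<bar> + 1) / e'" using e' by (simp add: field_simps)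
    then have "b > 0" by (simp add: b_def)
    moreover have "measure (Q n) {-b<..b} > 1 - e" for n
      using tail[OF e'(1), of "-b" b n] e'(2) by (simp add: b_def)
    ultimately show "\<exists>a b. a < b \<and> (\<forall>n. 1 - e < measure (Q n) {a<..b})"
      by (intro exI[of _ "-b"] exI[of _ b]) simp
  qed
  from tight_imp_convergent_subsubsequence[OF this strict_mono_id]
  obtain r N where r: "strict_mono r" and N: "real_distribution N" and wc: "weak_conv_m (Q \<circ> r) N"
    by (auto simp: comp_def)
  have Qr: "real_distribution ((Q \<circ> r) n)" for n using Q by simp
  obtain \<Omega> :: "real measure" and Y Y0 where sk: "prob_space \<Omega> \<and>
    (\<forall>n. Y n \<in> measurable \<Omega> borel) \<and> (\<forall>n. distr \<Omega> borel (Y n) = (Q \<circ> r) n) \<and>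
    Y0 \<in> measurable \<Omega> lborel \<and> distr \<Omega> borel Y0 = N \<and> (\<forall>x \<in> space \<Omega>. (\<lambda>n. Y n x) \<longlonglongrightarrow> Y0 x)"
    using Skorohod[OF Qr N wc] by blast
  then have O: "prob_space \<Omega>" and Ym: "\<And>j. Y j \<in> borel_measurable \<Omega>" and Yd: "\<And>j. distr \<Omega> borel (Y j) = Q (r j)"
    and Y0m: "Y0 \<in> borel_measurable \<Omega>" and Y0d: "distr \<Omega> borel Y0 = N"
    and Yl: "\<And>x. x \<in> space \<Omega> \<Longrightarrow> (\<lambda>j. Y j x) \<longlonglongrightarrow> Y0 x"
    by auto
  note [measurable] = Ym Y0m
  interpret prob_space \<Omega> by (rule O)
  have limr: "(\<lambda>j. \<integral>\<^sup>+x. ennreal (exp (of_rat q * Y j x)) \<partial>\<Omega>) \<longlonglongrightarrow> ennreal (exp ((of_rat q)\<^sup>2 * V / 2))" for q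
    using LIMSEQ_subseq_LIMSEQ[OF lim[of q] r] by (simp add: comp_def Yd[symmetric] nn_integral_distr)
  have NG: "N = gaussian 0 V"
  proof (rule mgf_eq_of_rational[OF N V])
    fix q
    have "(\<integral>\<^sup>+x. ennreal (exp (of_rat q * Y0 x)) \<partial>\<Omega>) = ennreal (exp ((of_rat q)\<^sup>2 * V / 2))"
    proof (rule integral_limit_of_bounded_second_moment[OF O])
      \<comment> \<open>The second moment of exp (q Y) is the transform at 2 q, which converges and
        is therefore eventually below its limit plus 1.\<close>
      define C2 where "C2 = exp ((of_rat (2 * q))\<^sup>2 * V / 2) + 1"
      have sq: "(exp (of_rat q * y))\<^sup>2 = exp (of_rat (2 * q) * y)" for y :: real
        by (simp add: exp_double[symmetric] of_rat_mult mult.assoc)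
      have "\<forall>\<^sub>F j in sequentially. (\<integral>\<^sup>+x. ennreal (exp (of_rat (2 * q) * Y j x)) \<partial>\<Omega>) < ennreal C2"
        by (rule order_tendstoD(2)[OF limr]) (simp add: C2_def ennreal_less_iff)
      then show "\<forall>\<^sub>F j in sequentially. (\<integral>\<^sup>+x. ennreal ((exp (of_rat q * Y j x))\<^sup>2) \<partial>\<Omega>) \<le> ennreal C2"
        unfolding sq by (rule eventually_mono) simp
      show "0 \<le> C2" by (simp add: C2_def add_nonneg_nonneg)
      show "(\<lambda>j. \<integral>\<^sup>+x. ennreal (exp (of_rat q * Y j x)) \<partial>\<Omega>) \<longlonglongrightarrow> ennreal (exp ((of_rat q)\<^sup>2 * V / 2))" by (rule limr)
      show "(\<lambda>j. exp (of_rat q * Y j x)) \<longlonglongrightarrow> exp (of_rat q * Y0 x)" if "x \<in> space \<Omega>" for x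
        by (intro tendsto_intros Yl that)
    qed auto
    then show "(\<integral>\<^sup>+x. ennreal (exp (of_rat q * x)) \<partial>N) = ennreal (exp ((of_rat q)\<^sup>2 * V / 2))"
      by (simp add: Y0d[symmetric] nn_integral_distr)
  qed
  have "(\<lambda>j. \<integral>x. min 2 \<bar>Y j x - Y0 x\<bar> \<partial>\<Omega>) \<longlonglongrightarrow> (\<integral>x. 0 \<partial>\<Omega>)"
  proof (rule integral_dominated_convergence[where w = "\<lambda>_. 2"])
    show "AE x in \<Omega>. (\<lambda>j. min 2 \<bar>Y j x - Y0 x\<bar>) \<longlonglongrightarrow> 0"
    proof (intro AE_I2)
      fix x assume x: "x \<in> space \<Omega>"
      have "(\<lambda>j. min 2 \<bar>Y j x - Y0 x\<bar>) \<longlonglongrightarrow> min 2 \<bar>Y0 x - Y0 x\<bar>"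
        by (intro tendsto_intros Yl[OF x])
      then show "(\<lambda>j. min 2 \<bar>Y j x - Y0 x\<bar>) \<longlonglongrightarrow> 0" by simp
    qed
  qed auto
  then have "\<forall>\<^sub>F j in sequentially. (\<integral>x. min 2 \<bar>Y j x - Y0 x\<bar> \<partial>\<Omega>) < \<delta>"
    using \<delta> by (intro order_tendstoD) auto
  then obtain j where j: "(\<integral>x. min 2 \<bar>Y j x - Y0 x\<bar> \<partial>\<Omega>) < \<delta>" by (auto simp: eventually_sequentially)
  have "d_BL (Q (r j)) (gaussian 0 V) \<le> ennreal (\<integral>x. min 2 \<bar>Y j x - Y0 x\<bar> \<partial>\<Omega>)"
    using d_BL_coupling[OF O Ym[of j] Y0m] unfolding Yd Y0d NG .
  also have "\<dots> \<le> ennreal \<delta>" using j by (intro ennreal_leI) simp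
  finally show ?thesis by blast
qed

text \<open>With finitely many \<open>t\<close> and a fixed tolerance, convergence in probability passes from the Laplace
  transforms to the distance by a union bound, without extracting almost surely convergent subsequences.\<close>

lemma mgf_close_imp_d_BL_le:
  assumes V: "0 \<le> V" and \<delta>: "0 < \<delta>"
  shows "\<exists>T \<eta>. finite T \<and> 0 < \<eta> \<and>
    (\<forall>Q. real_distribution Q \<longrightarrow> (\<forall>t\<in>T. mgf_close V \<eta> t Q) \<longrightarrow> d_BL Q (gaussian 0 V) \<le> ennreal \<delta>)"
proof (rule ccontr)
  assume neg: "\<not> ?thesis"
  \<comment> \<open>Counterexamples for growing finite sets and tolerance 1/(k+1) form a sequence to
    which compactness applies: 1 and -1 secure tightness, and every rational is eventually
    included.\<close>
  define T where "T k = ({1, -1} \<union> (\<lambda>i. of_rat (from_nat i :: rat)) ` {..k} :: real set)" for k :: nat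
  have "\<exists>Q. real_distribution Q \<and> (\<forall>t\<in>T k. mgf_close V (1 / real (Suc k)) t Q) \<and> \<not> d_BL Q (gaussian 0 V) \<le> ennreal \<delta>" for k
  proof -
    have "finite (T k)" "0 < 1 / real (Suc k)" by (auto simp: T_def)
    then show ?thesis using neg by blast
  qed
  then obtain Q where Q: "\<And>k. real_distribution (Q k)" "\<And>k t. t \<in> T k \<Longrightarrow> mgf_close V (1 / real (Suc k)) t (Q k)"
    and nd: "\<And>k. \<not> d_BL (Q k) (gaussian 0 V) \<le> ennreal \<delta>"
    by metis
  have s1: "1 / real (Suc k) \<le> 1" for k by simp
  have "\<exists>k. d_BL (Q k) (gaussian 0 V) \<le> ennreal \<delta>"
  proof (rule mgf_close_sequence_d_BL[OF V Q(1) _ _ _ \<delta>])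
    have "(\<integral>\<^sup>+x. ennreal (exp (s * x)) \<partial>Q k) \<le> ennreal (exp (V / 2) + 1)" if "s = 1 \<or> s = -1" for s k
    proof -
      have "(\<integral>\<^sup>+x. ennreal (exp (s * x)) \<partial>Q k) \<le> ennreal (exp (s\<^sup>2 * V / 2) + 1 / real (Suc k))"
        using Q(2)[of s k] that by (auto simp: T_def mgf_close_def)
      also have "\<dots> \<le> ennreal (exp (V / 2) + 1)" using that s1[of k] by (intro ennreal_leI) auto
      finally show ?thesis .
    qed
    then show "(\<integral>\<^sup>+x. ennreal (exp (1 * x)) \<partial>Q k) \<le> ennreal (exp (V / 2) + 1)"
      "(\<integral>\<^sup>+x. ennreal (exp (- 1 * x)) \<partial>Q k) \<le> ennreal (exp (V / 2) + 1)" for k by blast+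
    fix q :: rat
    obtain i where i: "q = from_nat i" using surj_from_nat by (metis surjD)
    have close: "mgf_close V (1 / real (Suc k)) (of_rat q) (Q k)" if "k \<ge> i" for k
      using that Q(2) i by (auto simp: T_def)
    define E where "E = exp ((of_rat q)\<^sup>2 * V / 2)"
    have l0: "(\<lambda>k. 1 / real (Suc k)) \<longlonglongrightarrow> 0" by (rule LIMSEQ_Suc[OF lim_1_over_n])
    have lo: "(\<lambda>k. ennreal (E - 1 / real (Suc k))) \<longlonglongrightarrow> ennreal E" and hi: "(\<lambda>k. ennreal (E + 1 / real (Suc k))) \<longlonglongrightarrow> ennreal E"
      using tendsto_ennrealI[OF tendsto_diff[OF tendsto_const[of E] l0]] tendsto_ennrealI[OF tendsto_add[OF tendsto_const[of E] l0]]
      by simp_all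
    show "(\<lambda>k. \<integral>\<^sup>+x. ennreal (exp (of_rat q * x)) \<partial>Q k) \<longlonglongrightarrow> ennreal (exp ((of_rat q)\<^sup>2 * V / 2))"
      unfolding E_def[symmetric]
      by (rule tendsto_sandwich[OF _ _ lo hi])
        (use close in \<open>auto simp: eventually_sequentially mgf_close_def E_def intro!: exI[of _ i]\<close>)
  qed
  then show False using nd by blast
qed

section \<open>Likelihood ratios under the data law\<close>

definition whp :: "(nat \<Rightarrow> 'a measure) \<Rightarrow> (nat \<Rightarrow> 'a \<Rightarrow> bool) \<Rightarrow> bool"
  where "whp P E \<longleftrightarrow> (\<lambda>n. outer_measure_of (P n) {\<omega> \<in> space (P n). \<not> E n \<omega>}) \<longlonglongrightarrow> 0"

lemma small_o_P_iff_whp: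
  "small_o_P P X a \<longleftrightarrow> (\<forall>\<delta>>0. whp P (\<lambda>n \<omega>. X n \<omega> \<le> ennreal (\<delta> * a n)))"
  by (simp add: small_o_P_def whp_def not_le)

lemma outer_measure_of_Un_le:
  assumes "A \<subseteq> space M" "B \<subseteq> space M"
  shows "outer_measure_of M (A \<union> B) \<le> outer_measure_of M A + outer_measure_of M B"
proof -
  obtain E where E: "E \<in> sets M" "A \<subseteq> E" "outer_measure_of M A = emeasure M E"
    using outer_measure_of_attain[OF assms(1)] by blast
  obtain F where F: "F \<in> sets M" "B \<subseteq> F" "outer_measure_of M B = emeasure M F"
    using outer_measure_of_attain[OF assms(2)] by blast
  have "outer_measure_of M (A \<union> B) \<le> outer_measure_of M (E \<union> F)"
    using E F by (intro outer_measure_of_mono) auto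
  also have "\<dots> = emeasure M (E \<union> F)" using E F by (intro outer_measure_of_eq) auto
  also have "\<dots> \<le> emeasure M E + emeasure M F" using E F by (intro emeasure_subadditive) auto
  finally show ?thesis using E F by simp
qed

lemma tendsto_0_ennreal_le:
  fixes f g :: "nat \<Rightarrow> ennreal"
  assumes "\<forall>\<^sub>F n in sequentially. f n \<le> g n" "g \<longlonglongrightarrow> 0"
  shows "f \<longlonglongrightarrow> 0"
  by (rule tendsto_sandwich[OF always_eventually assms(1) tendsto_const assms(2)]) simp

lemma whp_mono:
  assumes "whp P E" "\<forall>\<^sub>F n in sequentially. \<forall>\<omega>\<in>space (P n). E n \<omega> \<longrightarrow> F n \<omega>"
  shows "whp P F"
  unfolding whp_def
  by (rule tendsto_0_ennreal_le[OF _ assms(1)[unfolded whp_def]])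
    (use assms(2) in \<open>auto elim!: eventually_mono intro!: outer_measure_of_mono\<close>)

lemma whp_conj:
  assumes "whp P E" "whp P F"
  shows "whp P (\<lambda>n \<omega>. E n \<omega> \<and> F n \<omega>)"
  unfolding whp_def
proof (rule tendsto_0_ennreal_le)
  show "(\<lambda>n. outer_measure_of (P n) {\<omega> \<in> space (P n). \<not> E n \<omega>} +
      outer_measure_of (P n) {\<omega> \<in> space (P n). \<not> F n \<omega>}) \<longlonglongrightarrow> 0"
    using tendsto_add[OF assms[unfolded whp_def]] by simp
  have "{\<omega> \<in> space (P n). \<not> (E n \<omega> \<and> F n \<omega>)} = {\<omega> \<in> space (P n). \<not> E n \<omega>} \<union> {\<omega> \<in> space (P n). \<not> F n \<omega>}" for n
    by auto
  then show "\<forall>\<^sub>F n in sequentially. outer_measure_of (P n) {\<omega> \<in> space (P n). \<not> (E n \<omega> \<and> F n \<omega>)}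
      \<le> outer_measure_of (P n) {\<omega> \<in> space (P n). \<not> E n \<omega>} + outer_measure_of (P n) {\<omega> \<in> space (P n). \<not> F n \<omega>}"
    by (intro always_eventually allI) (auto intro!: outer_measure_of_Un_le)
qed

lemma whp_always: "\<forall>\<^sub>F n in sequentially. \<forall>\<omega>\<in>space (P n). E n \<omega> \<Longrightarrow> whp P E"
  unfolding whp_def
  by (rule tendsto_0_ennreal_le[of _ "\<lambda>_. 0"])
    (auto elim!: eventually_mono simp: Collect_conv_if cong: conj_cong
      intro!: order_trans[OF outer_measure_of_mono[of _ "{}"]])

lemma whp_ball_finite:
  assumes "finite T" "\<And>t. t \<in> T \<Longrightarrow> whp P (E t)"
  shows "whp P (\<lambda>n \<omega>. \<forall>t\<in>T. E t n \<omega>)"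
  using assms
proof (induction T)
  case empty
  show ?case by (rule whp_always) simp
next
  case (insert t T)
  have "whp P (\<lambda>n \<omega>. E t n \<omega> \<and> (\<forall>t\<in>T. E t n \<omega>))" using insert by (intro whp_conj) auto
  then show ?case by simp
qed

text \<open>For a measurable variable the outer measure is the measure, so Markov's inequality is
  available. This is how moment bounds enter the calculus of \<open>whp\<close>.\<close>

lemma whp_Markov:
  assumes F: "\<And>n. F n \<in> borel_measurable (P n)"
    and b: "\<forall>\<^sub>F n in sequentially. (\<integral>\<^sup>+\<omega>. F n \<omega> \<partial>P n) \<le> b n" and b0: "b \<longlonglongrightarrow> 0" and c: "0 < (c::real)"
  shows "whp P (\<lambda>n \<omega>. F n \<omega> \<le> ennreal c)"
  unfolding whp_def
proof (rule tendsto_0_ennreal_le)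
  have "(\<lambda>n. ennreal (1 / c) * b n) \<longlonglongrightarrow> ennreal (1 / c) * 0"
    by (intro ennreal_tendsto_cmult b0) simp
  then show "(\<lambda>n. ennreal (1 / c) * b n) \<longlonglongrightarrow> 0" by simp
  show "\<forall>\<^sub>F n in sequentially. outer_measure_of (P n) {\<omega> \<in> space (P n). \<not> F n \<omega> \<le> ennreal c} \<le> ennreal (1 / c) * b n"
    using b
  proof (rule eventually_mono)
    fix n assume bn: "(\<integral>\<^sup>+\<omega>. F n \<omega> \<partial>P n) \<le> b n"
    note [measurable] = F[of n]
    have "outer_measure_of (P n) {\<omega> \<in> space (P n). \<not> F n \<omega> \<le> ennreal c}
        = emeasure (P n) {\<omega> \<in> space (P n). \<not> F n \<omega> \<le> ennreal c}"
      by (rule outer_measure_of_eq) measurable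
    also have "\<dots> \<le> emeasure (P n) {\<omega> \<in> space (P n). 1 \<le> ennreal (1 / c) * F n \<omega>}"
    proof (rule emeasure_mono)
      show "{\<omega> \<in> space (P n). \<not> F n \<omega> \<le> ennreal c} \<subseteq> {\<omega> \<in> space (P n). 1 \<le> ennreal (1 / c) * F n \<omega>}"
      proof safe
        fix \<omega> assume "\<not> F n \<omega> \<le> ennreal c"
        then have "ennreal (1 / c) * ennreal c \<le> ennreal (1 / c) * F n \<omega>" by (intro mult_left_mono) auto
        then show "1 \<le> ennreal (1 / c) * F n \<omega>" using c by (simp add: ennreal_mult[symmetric])
      qed
    qed measurable
    also have "\<dots> \<le> ennreal (1 / c) * (\<integral>\<^sup>+\<omega>. F n \<omega> * indicator (space (P n)) \<omega> \<partial>P n)"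
      by (rule nn_integral_Markov_inequality) auto
    also have "(\<integral>\<^sup>+\<omega>. F n \<omega> * indicator (space (P n)) \<omega> \<partial>P n) = (\<integral>\<^sup>+\<omega>. F n \<omega> \<partial>P n)"
      by (intro nn_integral_cong) simp
    also have "ennreal (1 / c) * \<dots> \<le> ennreal (1 / c) * b n" by (intro mult_left_mono bn) simp
    finally show "outer_measure_of (P n) {\<omega> \<in> space (P n). \<not> F n \<omega> \<le> ennreal c} \<le> ennreal (1 / c) * b n" .
  qed
qed


section \<open>Integrals under densities and the product data law\<close>

lemma borel_measurable_apply_C01 [measurable]: "apply_bcontfun (f::C01) \<in> borel_measurable borel"
  by (rule borel_measurable_continuous_onI[OF continuous_on_apply_bcontfun])

lemma densityD:
  assumes "f \<in> densities"
  shows "0 \<le> apply_bcontfun f x" "(\<integral>x. f x \<partial>leb01) = 1" "integrable leb01 (\<lambda>x. f x)"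
  using assms integrable_leb01[OF continuous_on_apply_bcontfun] by (auto simp: densities_def)

lemma integrable_leb01_mult:
  fixes f :: C01 and g :: "unit_interval \<Rightarrow> real"
  assumes "continuous_on UNIV g"
  shows "integrable leb01 (\<lambda>x. g x * f x)"
  by (intro integrable_leb01 continuous_intros assms continuous_on_apply_bcontfun)

lemma integral_density_mono:
  fixes f :: C01
  assumes f: "f \<in> densities" and "continuous_on UNIV g" "continuous_on UNIV h" "\<And>x. g x \<le> h x"
  shows "(\<integral>x. g x * f x \<partial>leb01) \<le> (\<integral>x. h x * f x \<partial>leb01)"
  by (intro integral_mono integrable_leb01_mult assms mult_right_mono densityD(1)[OF f])

lemma prob_space_data1: "f \<in> densities \<Longrightarrow> prob_space (density leb01 (\<lambda>x. ennreal (apply_bcontfun f x)))"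
  by (rule prob_spaceI)
    (simp add: emeasure_density space_leb01 nn_integral_eq_integral[OF densityD(3)] densityD)

lemma prob_space_data_law: "f \<in> densities \<Longrightarrow> prob_space (data_law f n)"
  unfolding data_law_def by (intro prob_space_PiM prob_space_data1)

lemma measurable_data_component [measurable]:
  "i < n \<Longrightarrow> (\<lambda>y. y i) \<in> measurable (data_law f n) borel"
  unfolding data_law_def
  by (subst measurable_cong_sets[OF refl, of borel "density leb01 (\<lambda>x. ennreal (apply_bcontfun f x))"])
    (auto simp: sets_leb01)

lemma nn_integral_data_law_prod:
  fixes f :: C01
  assumes f: "f \<in> densities" and [measurable]: "g \<in> borel_measurable borel"
  shows "(\<integral>\<^sup>+y. ennreal (\<Prod>i<n. exp (g (y i))) \<partial>data_law f n) = (\<integral>\<^sup>+x. ennreal (exp (g x)) * ennreal (f x) \<partial>leb01) ^ n"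
proof -
  interpret product_sigma_finite "\<lambda>_::nat. density leb01 (\<lambda>x. ennreal (apply_bcontfun f x))"
    by (intro product_sigma_finite.intro prob_space_imp_sigma_finite prob_space_data1 f)
  have gl: "(\<lambda>x. ennreal (exp (g x))) \<in> borel_measurable leb01"
    unfolding measurable_cong_sets[OF sets_leb01 refl] by measurable
  have "(\<integral>\<^sup>+y. ennreal (\<Prod>i<n. exp (g (y i))) \<partial>data_law f n) = (\<integral>\<^sup>+y. (\<Prod>i<n. ennreal (exp (g (y i)))) \<partial>data_law f n)"
    by (simp add: prod_ennreal)
  also have "\<dots> = (\<Prod>i<n. \<integral>\<^sup>+x. ennreal (exp (g x)) \<partial>density leb01 (\<lambda>x. ennreal (f x)))"
    unfolding data_law_def
    by (rule product_nn_integral_prod) (simp_all add: gl)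
  also have "(\<integral>\<^sup>+x. ennreal (exp (g x)) \<partial>density leb01 (\<lambda>x. ennreal (f x)))
      = (\<integral>\<^sup>+x. ennreal (exp (g x)) * ennreal (f x) \<partial>leb01)"
    using gl by (subst nn_integral_density) (simp_all add: mult.commute measurable_cong_sets[OF sets_leb01 refl])
  finally show ?thesis by simp
qed

text \<open>The likelihood of \<^term>\<open>exp_density w\<close> is divided by that of the true density; the factor
  cancels in the posterior.\<close>

definition lik_ratio :: "real \<Rightarrow> C01 \<Rightarrow> nat \<Rightarrow> (nat \<Rightarrow> unit_interval) \<Rightarrow> C01 \<Rightarrow> real"
  where "lik_ratio \<alpha> f0 n y w = exp (\<alpha> * (log_likelihood n y (exp_density w) - log_likelihood n y f0))"

definition evidence :: "'w measure \<Rightarrow> ('w \<Rightarrow> C01) \<Rightarrow> real \<Rightarrow> C01 \<Rightarrow> nat \<Rightarrow> (nat \<Rightarrow> unit_interval) \<Rightarrow> ennreal"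
  where "evidence M W \<alpha> f0 n y = (\<integral>\<^sup>+\<omega>. ennreal (lik_ratio \<alpha> f0 n y (W \<omega>)) \<partial>M)"

text \<open>A posterior for the sample point of \<open>M\<close> instead of for the density, because
  representers, which are functions on \<open>M\<close>, have to be integrated against it. With
  infinite evidence it is the null measure.\<close>

definition posterior_elem ::
    "'w measure \<Rightarrow> ('w \<Rightarrow> C01) \<Rightarrow> real \<Rightarrow> C01 \<Rightarrow> nat \<Rightarrow> (nat \<Rightarrow> unit_interval) \<Rightarrow> 'w measure"
  where "posterior_elem M W \<alpha> f0 n y =
    density M (\<lambda>\<omega>. ennreal (lik_ratio \<alpha> f0 n y (W \<omega>)) / evidence M W \<alpha> f0 n y)"

lemma lik_ratio_prod:
  "lik_ratio \<alpha> f0 n y w = (\<Prod>i<n. exp (\<alpha> * (ln (exp_density w (y i)) - ln (f0 (y i)))))"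
  unfolding lik_ratio_def log_likelihood_def sum_subtractf[symmetric] sum_distrib_left exp_sum[OF finite_lessThan] ..

lemma lik_ratio_pos: "0 < lik_ratio \<alpha> f0 n y w"
  by (simp add: lik_ratio_def)

lemma measurable_lik_ratio [measurable]: "lik_ratio \<alpha> f0 n y \<in> borel_measurable borel"
proof -
  have [measurable]: "(\<lambda>w. apply_bcontfun (exp_density w) x) \<in> borel_measurable borel" for x
    by (rule measurable_compose[OF measurable_exp_density measurable_eval])
  show ?thesis unfolding lik_ratio_def log_likelihood_def by measurable
qed

lemma measurable_lik_ratio_pair:
  assumes W [measurable]: "W \<in> borel_measurable M"
  shows "(\<lambda>(y, \<omega>). lik_ratio \<alpha> f0 n y (W \<omega>)) \<in> borel_measurable (data_law f n \<Otimes>\<^sub>M M)"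
proof -
  have [measurable]: "(\<lambda>p. apply_bcontfun (exp_density (W (snd p))) (fst p i)) \<in> borel_measurable (data_law f n \<Otimes>\<^sub>M M)"
    if i: "i < n" for i
  proof (rule measurable_eval_compose)
    show "(\<lambda>p. exp_density (W (snd p))) \<in> borel_measurable (data_law f n \<Otimes>\<^sub>M M)"
      by (rule measurable_compose[OF _ measurable_exp_density]) measurable
    show "(\<lambda>p. fst p i) \<in> borel_measurable (data_law f n \<Otimes>\<^sub>M M)"
      using i by measurable
  qed
  have [measurable]: "(\<lambda>p. apply_bcontfun f0 (fst p i)) \<in> borel_measurable (data_law f n \<Otimes>\<^sub>M M)" if i: "i < n" for i
    by (rule measurable_compose[OF _ borel_measurable_apply_C01]) (use i in measurable)
  have [measurable]: "(\<lambda>p. \<Sum>i<n. ln (apply_bcontfun (exp_density (W (snd p))) (fst p i))) \<in> borel_measurable (data_law f n \<Otimes>\<^sub>M M)"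
    "(\<lambda>p. \<Sum>i<n. ln (apply_bcontfun f0 (fst p i))) \<in> borel_measurable (data_law f n \<Otimes>\<^sub>M M)"
    by (intro borel_measurable_sum; simp)+
  show ?thesis unfolding lik_ratio_def log_likelihood_def case_prod_beta' by measurable
qed

section \<open>Moment bounds for likelihood ratios and the evidence\<close>

lemma ln_density_ratio:
  fixes f0 :: C01
  assumes "0 < c" "\<And>x. c \<le> apply_bcontfun f0 x"
  shows "continuous_on UNIV (\<lambda>x. ln (exp_density w x) - ln (f0 x))"
    and "exp (ln (exp_density w x) - ln (f0 x)) * f0 x = exp_density w x"
proof -
  have p: "0 < f0 x" for x using assms by (meson less_le_trans)
  show "continuous_on UNIV (\<lambda>x. ln (exp_density w x) - ln (f0 x))"
    using p exp_density_pos[of w] by (intro continuous_intros continuous_on_apply_bcontfun) (auto simp: less_imp_neq[symmetric])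
  show "exp (ln (exp_density w x) - ln (f0 x)) * f0 x = exp_density w x"
    using p[of x] exp_density_pos[of w x] by (simp add: exp_diff)
qed

lemma nn_integral_leb01_density:
  fixes f :: C01
  assumes f: "f \<in> densities" and g: "continuous_on UNIV g" "\<And>x. 0 \<le> g x"
  shows "(\<integral>\<^sup>+x. ennreal (g x) * ennreal (f x) \<partial>leb01) = ennreal (\<integral>x. g x * f x \<partial>leb01)"
  using nn_integral_eq_integral[OF integrable_leb01_mult[OF g(1), of f]] g(2) densityD(1)[OF f]
  by (simp add: ennreal_mult)

text \<open>Convexity bounds exp (\<alpha> u) by \<alpha> exp u + 1 - \<alpha>, whose mean under
  \<open>f0\<close> is 1 since exp u is a ratio of densities; independence raises this to the n-th
  power.\<close>

lemma expected_lik_ratio_le_1: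
  fixes f0 :: C01
  assumes f0: "f0 \<in> densities" and c: "0 < c" "\<And>x. c \<le> apply_bcontfun f0 x" and \<alpha>: "0 < \<alpha>" "\<alpha> \<le> 1"
  shows "(\<integral>\<^sup>+y. ennreal (lik_ratio \<alpha> f0 n y w) \<partial>data_law f0 n) \<le> 1"
proof -
  define u where "u x = ln (exp_density w x) - ln (f0 x)" for x
  note u = ln_density_ratio[OF c, of w, folded u_def]
  interpret prob_space leb01 by (rule prob_space_leb01)
  have cv: "exp (\<alpha> * z) \<le> \<alpha> * exp z + (1 - \<alpha>)" for z :: real
  proof -
    have "exp ((1 - \<alpha>) *\<^sub>R 0 + \<alpha> *\<^sub>R z) \<le> (1 - \<alpha>) * exp 0 + \<alpha> * exp z"
      using \<alpha> by (intro convex_onD[OF exp_convex]) auto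
    then show ?thesis by simp
  qed
  have "(\<integral>x. exp (\<alpha> * u x) * f0 x \<partial>leb01) \<le> (\<integral>x. (\<alpha> * exp (u x) + (1 - \<alpha>)) * f0 x \<partial>leb01)"
    by (rule integral_density_mono[OF f0]) (auto intro!: continuous_intros u(1) cv)
  also have "\<dots> = (\<integral>x. \<alpha> * exp_density w x + (1 - \<alpha>) * f0 x \<partial>leb01)"
    by (simp add: distrib_right mult.assoc u(2))
  also have "\<dots> = 1" using densityD[OF f0] densityD[OF exp_density_in_densities[of w]] by simp
  finally have le: "(\<integral>x. exp (\<alpha> * u x) * f0 x \<partial>leb01) \<le> 1" .
  have [measurable]: "(\<lambda>x. \<alpha> * u x) \<in> borel_measurable borel"
    by (intro borel_measurable_continuous_onI continuous_intros u(1))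
  have "(\<integral>\<^sup>+y. ennreal (lik_ratio \<alpha> f0 n y w) \<partial>data_law f0 n) = ennreal (\<integral>x. exp (\<alpha> * u x) * f0 x \<partial>leb01) ^ n"
    unfolding lik_ratio_prod u_def[symmetric]
    by (subst nn_integral_data_law_prod[OF f0], measurable, subst nn_integral_leb01_density[OF f0])
      (auto intro!: continuous_intros u(1))
  also have "\<dots> \<le> 1 ^ n" by (rule power_mono) (use ennreal_leI[OF le] in auto)
  finally show ?thesis by simp
qed

text \<open>On this range the exponential in the Lagrange remainder is at most 2, which the factors
  1/2 and 1/6 absorb.\<close>

lemma exp_taylor_bounds:
  fixes z :: real
  assumes "\<bar>z\<bar> \<le> 1 / 2"
  shows "exp z \<le> 1 + z + z\<^sup>2" and "\<bar>exp z - (1 + z + z\<^sup>2 / 2)\<bar> \<le> \<bar>z\<bar> ^ 3"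
proof -
  have e2: "exp t \<le> 2" if "\<bar>t\<bar> \<le> \<bar>z\<bar>" for t using exp_bound_half[of t] that assms by simp
  obtain t where t: "\<bar>t\<bar> \<le> \<bar>z\<bar>" "exp z = (\<Sum>m<2. z ^ m / fact m) + exp t / fact 2 * z ^ 2"
    using Maclaurin_exp_le[of z 2] by auto
  have "exp t / 2 * z\<^sup>2 \<le> 1 * z\<^sup>2" using e2[OF t(1)] by (intro mult_right_mono) auto
  then show "exp z \<le> 1 + z + z\<^sup>2" using t(2) by (simp add: numeral_2_eq_2)
  obtain s where s: "\<bar>s\<bar> \<le> \<bar>z\<bar>" "exp z = (\<Sum>m<3. z ^ m / fact m) + exp s / fact 3 * z ^ 3"
    using Maclaurin_exp_le[of z 3] by auto
  have "exp z - (1 + z + z\<^sup>2 / 2) = exp s / 6 * z ^ 3"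
    using s(2) by (simp add: numeral_3_eq_3 power2_eq_square)
  also have "\<bar>\<dots>\<bar> = exp s / 6 * \<bar>z\<bar> ^ 3" by (simp add: abs_mult power_abs)
  also have "\<dots> \<le> 1 * \<bar>z\<bar> ^ 3" using e2[OF s(1)] by (intro mult_right_mono) auto
  finally show "\<bar>exp z - (1 + z + z\<^sup>2 / 2)\<bar> \<le> \<bar>z\<bar> ^ 3" by simp
qed

text \<open>The log ratio u is at most 4 e in absolute value, 2 e from \<open>w\<close> and 2 e from
  its normaliser. Its mean is of second order, at least -16 e^2, because exp u times
  \<open>f0\<close> integrates to 1. Linear and quadratic terms of exp (- \<alpha> u) thus
  contribute 16 \<alpha> e^2 each, which gives 32; e <= 1/8 keeps |u| within the Taylor
  range.\<close>

lemma expected_inverse_lik_ratio_le: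
  fixes f0 :: C01
  assumes f0: "f0 \<in> densities" and c: "0 < c" "\<And>x. c \<le> apply_bcontfun f0 x" and \<alpha>: "0 < \<alpha>" "\<alpha> \<le> 1"
    and e: "0 < e" "e \<le> 1 / 8" and w: "norm (w - log_density f0) \<le> 2 * e"
  shows "(\<integral>\<^sup>+y. ennreal (1 / lik_ratio \<alpha> f0 n y w) \<partial>data_law f0 n) \<le> ennreal (exp (32 * (real n * \<alpha> * e\<^sup>2)))"
proof -
  define u where "u x = ln (exp_density w x) - ln (f0 x)" for x
  note u = ln_density_ratio[OF c, of w, folded u_def]
  interpret prob_space leb01 by (rule prob_space_leb01)
  have fp: "0 < f0 x" for x using c by (meson less_le_trans)
  have wx': "\<bar>w x - ln (f0 x)\<bar> \<le> 2 * e" for x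
    using norm_bounded[of "w - log_density f0" x] w apply_log_density[OF fp] by simp
  have wx: "- (2 * e) \<le> w x - ln (f0 x)" "w x - ln (f0 x) \<le> 2 * e" for x
    using wx'[of x] by linarith+
  define Z where "Z = (\<integral>y. exp (w y) \<partial>leb01)"
  have ewc: "continuous_on UNIV (\<lambda>x. exp (w x - ln (f0 x)))"
    using fp by (intro continuous_intros continuous_on_apply_bcontfun) (auto simp: less_imp_neq[symmetric])
  have "Z = (\<integral>x. exp (w x - ln (f0 x)) * f0 x \<partial>leb01)"
    unfolding Z_def using fp by (intro Bochner_Integration.integral_cong refl) (simp add: exp_diff less_imp_neq[symmetric])
  moreover have "(\<integral>x. exp (- (2 * e)) * f0 x \<partial>leb01) \<le> (\<integral>x. exp (w x - ln (f0 x)) * f0 x \<partial>leb01)"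
    by (rule integral_density_mono[OF f0 _ ewc]) (use wx in auto)
  moreover have "(\<integral>x. exp (w x - ln (f0 x)) * f0 x \<partial>leb01) \<le> (\<integral>x. exp (2 * e) * f0 x \<partial>leb01)"
    by (rule integral_density_mono[OF f0 ewc]) (use wx in auto)
  ultimately have Z: "exp (- (2 * e)) \<le> Z" "Z \<le> exp (2 * e)" using densityD(2)[OF f0] by auto
  have Zp: "Z > 0" by (rule less_le_trans[OF exp_gt_zero Z(1)])
  have lZ: "\<bar>ln Z\<bar> \<le> 2 * e"
    using ln_mono[OF Z(1) exp_gt_zero] ln_mono[OF Z(2) Zp] by (simp add: abs_le_iff)
  have ux: "\<bar>u x\<bar> \<le> 4 * e" for x
  proof -
    have "u x = w x - ln Z - ln (f0 x)"
      unfolding u_def apply_exp_density Z_def[symmetric] using Zp by (simp add: ln_div)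
    then show ?thesis using wx[of x] lZ by linarith
  qed
  have u2: "(u x)\<^sup>2 \<le> 16 * e\<^sup>2" for x
    using power_mono[OF ux[of x], of 2] by (simp add: power_mult_distrib)
  define I where "I = (\<integral>x. u x * f0 x \<partial>leb01)"
  have "1 = (\<integral>x. exp (u x) * f0 x \<partial>leb01)" unfolding u(2) using densityD(2)[OF exp_density_in_densities] by simp
  also have "\<dots> \<le> (\<integral>x. (1 + u x + 16 * e\<^sup>2) * f0 x \<partial>leb01)"
  proof (rule integral_density_mono[OF f0])
    fix x
    have "\<bar>u x\<bar> \<le> 1 / 2" using ux[of x] e by linarith
    then show "exp (u x) \<le> 1 + u x + 16 * e\<^sup>2" using exp_taylor_bounds(1)[of "u x"] u2[of x] by linarith
  qed (auto intro!: continuous_intros u(1))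
  also have "\<dots> = 1 + I + 16 * e\<^sup>2"
    unfolding I_def distrib_right using densityD[OF f0] integrable_leb01_mult[OF u(1), of f0] by simp
  finally have I: "- I \<le> 16 * e\<^sup>2" by simp
  have "(\<integral>x. exp (- (\<alpha> * u x)) * f0 x \<partial>leb01) \<le> (\<integral>x. (1 - \<alpha> * u x + \<alpha> * (16 * e\<^sup>2)) * f0 x \<partial>leb01)"
  proof (rule integral_density_mono[OF f0])
    fix x
    have "\<bar>\<alpha> * u x\<bar> \<le> 1 * \<bar>u x\<bar>" unfolding abs_mult using \<alpha> by (intro mult_right_mono) auto
    then have "\<bar>- (\<alpha> * u x)\<bar> \<le> 1 / 2" using ux[of x] e by linarith
    then have "exp (- (\<alpha> * u x)) \<le> 1 - \<alpha> * u x + \<alpha>\<^sup>2 * (u x)\<^sup>2"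
      using exp_taylor_bounds(1)[of "- (\<alpha> * u x)"] by (simp add: power_mult_distrib)
    \<comment> \<open>Giving up one factor \<alpha> keeps the exponent at the scale n \<alpha> e^2
      of the concentration inequality.\<close>
    also have "\<alpha>\<^sup>2 * (u x)\<^sup>2 \<le> \<alpha> * (16 * e\<^sup>2)"
      using \<alpha> u2[of x] by (intro mult_mono) (auto simp: power2_eq_square)
    finally show "exp (- (\<alpha> * u x)) \<le> 1 - \<alpha> * u x + \<alpha> * (16 * e\<^sup>2)" by simp
  qed (auto intro!: continuous_intros u(1))
  also have "\<dots> = 1 - \<alpha> * I + \<alpha> * (16 * e\<^sup>2)"
    unfolding I_def distrib_right left_diff_distrib using densityD[OF f0] integrable_leb01_mult[OF u(1), of f0]
    by (simp add: mult.assoc)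
  also have "\<dots> \<le> 1 + 32 * (\<alpha> * e\<^sup>2)"
    using mult_left_mono[OF I, of \<alpha>] \<alpha> by simp
  also have "\<dots> \<le> exp (32 * (\<alpha> * e\<^sup>2))" by (rule exp_ge_add_one_self)
  finally have le: "(\<integral>x. exp (- (\<alpha> * u x)) * f0 x \<partial>leb01) \<le> exp (32 * (\<alpha> * e\<^sup>2))" .
  have [measurable]: "(\<lambda>x. - (\<alpha> * u x)) \<in> borel_measurable borel"
    by (intro borel_measurable_continuous_onI continuous_intros u(1))
  have "1 / lik_ratio \<alpha> f0 n y w = (\<Prod>i<n. exp (- (\<alpha> * u (y i))))" for y
    unfolding lik_ratio_prod u_def by (simp add: exp_minus inverse_eq_divide prod_dividef)
  then have "(\<integral>\<^sup>+y. ennreal (1 / lik_ratio \<alpha> f0 n y w) \<partial>data_law f0 n)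
      = (\<integral>\<^sup>+x. ennreal (exp (- (\<alpha> * u x))) * ennreal (f0 x) \<partial>leb01) ^ n"
    by (simp only: nn_integral_data_law_prod[OF f0 \<open>(\<lambda>x. - (\<alpha> * u x)) \<in> borel_measurable borel\<close>])
  also have "(\<integral>\<^sup>+x. ennreal (exp (- (\<alpha> * u x))) * ennreal (f0 x) \<partial>leb01) = ennreal (\<integral>x. exp (- (\<alpha> * u x)) * f0 x \<partial>leb01)"
    by (rule nn_integral_leb01_density[OF f0]) (auto intro!: continuous_intros u(1))
  also have "\<dots> ^ n \<le> ennreal (exp (32 * (\<alpha> * e\<^sup>2))) ^ n"
    by (rule power_mono) (use ennreal_leI[OF le] in auto)
  also have "\<dots> = ennreal (exp (32 * (real n * \<alpha> * e\<^sup>2)))"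
    by (simp add: ennreal_power exp_of_nat_mult[symmetric] mult_ac)
  finally show ?thesis .
qed

text \<open>Cauchy-Schwarz on the ball, of prior mass p, bounds the inverse evidence by p^-2 times
  the integral of inverse likelihood ratios over the ball. Exchanging integrals bounds the mean by
  p^-1 times the bound for one ratio. A bound in mean replaces the usual exceptional event on which
  the denominator is small.\<close>

lemma expected_inverse_evidence_le:
  fixes f0 :: C01 and W :: "'w \<Rightarrow> C01"
  assumes M: "prob_space M" and W [measurable]: "W \<in> borel_measurable M"
    and f0: "f0 \<in> densities" and c: "0 < c" "\<And>x. c \<le> apply_bcontfun f0 x" and \<alpha>: "0 < \<alpha>" "\<alpha> \<le> 1"
    and e: "0 < e" "e \<le> 1 / 8"
    and mass: "ennreal (exp (- b)) \<le> emeasure M {\<omega> \<in> space M. norm (W \<omega> - log_density f0) \<le> 2 * e}"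
  shows "(\<integral>\<^sup>+y. 1 / evidence M W \<alpha> f0 n y \<partial>data_law f0 n) \<le> ennreal (exp (32 * (real n * \<alpha> * e\<^sup>2) + b))"
proof -
  interpret M: prob_space M by (rule M)
  interpret D: prob_space "data_law f0 n" by (rule prob_space_data_law[OF f0])
  interpret pair_sigma_finite "data_law f0 n" M ..
  define B where "B = {\<omega> \<in> space M. norm (W \<omega> - log_density f0) \<le> 2 * e}"
  have "(\<lambda>\<omega>. norm (W \<omega> - log_density f0)) \<in> borel_measurable M"
    by (rule measurable_compose[OF W]) (intro borel_measurable_continuous_onI continuous_intros)
  then have B [measurable]: "B \<in> sets M" unfolding B_def by measurable
  define p where "p = measure M B"
  have pB: "emeasure M B = ennreal p" by (simp add: p_def M.emeasure_eq_measure)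
  have pb: "exp (- b) \<le> p" using mass by (simp add: B_def[symmetric] pB p_def)
  then have p: "p > 0" by (rule less_le_trans[OF exp_gt_zero])
  note [measurable] = measurable_lik_ratio_pair[OF W]
  have gm: "(\<lambda>\<omega>. \<alpha> * (log_likelihood n y (exp_density (W \<omega>)) - log_likelihood n y f0)) \<in> borel_measurable M" for y
  proof -
    have "(\<lambda>\<omega>. ln (lik_ratio \<alpha> f0 n y (W \<omega>))) \<in> borel_measurable M" by measurable
    then show ?thesis by (simp add: lik_ratio_def)
  qed
  define K where "K y = (\<integral>\<^sup>+\<omega>. ennreal (1 / lik_ratio \<alpha> f0 n y (W \<omega>)) * indicator B \<omega> \<partial>M)" for y
  have pt: "1 / evidence M W \<alpha> f0 n y \<le> ennreal (1 / p\<^sup>2) * K y" for y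
  proof -
    have "(emeasure M B)\<^sup>2 \<le> (\<integral>\<^sup>+\<omega>. ennreal (lik_ratio \<alpha> f0 n y (W \<omega>)) * indicator B \<omega> \<partial>M) * K y"
      using emeasure_squared_le[OF B gm[of y]] unfolding K_def lik_ratio_def by (simp add: exp_minus divide_inverse)
    also have "\<dots> \<le> evidence M W \<alpha> f0 n y * K y"
      unfolding evidence_def by (intro mult_right_mono nn_integral_mono) (auto simp: indicator_def)
    finally have le: "ennreal (p\<^sup>2) \<le> evidence M W \<alpha> f0 n y * K y" by (simp add: pB ennreal_power p_def)
    show ?thesis
    proof (cases "evidence M W \<alpha> f0 n y" rule: ennreal_cases)
      case (real r)
      have "r \<noteq> 0" using le p real by auto
      then have r: "r > 0" using real by simp
      have "ennreal (1 / r) * ennreal (p\<^sup>2) \<le> ennreal (1 / r) * (ennreal r * K y)"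
        using le unfolding real by (rule mult_left_mono) simp
      also have "\<dots> = K y" using r by (simp add: mult.assoc[symmetric] ennreal_mult[symmetric])
      finally have "ennreal (1 / p\<^sup>2) * (ennreal (1 / r) * ennreal (p\<^sup>2)) \<le> ennreal (1 / p\<^sup>2) * K y"
        by (rule mult_left_mono) simp
      moreover have "ennreal (1 / p\<^sup>2) * (ennreal (1 / r) * ennreal (p\<^sup>2)) = ennreal (1 / r)"
        using p r by (simp add: ennreal_mult[symmetric])
      moreover have "1 / ennreal r = ennreal (1 / r)" using r divide_ennreal[of 1 r] by simp
      ultimately show ?thesis using real by simp
    next
      case top
      then show ?thesis by simp
    qed
  qed
  have "(\<integral>\<^sup>+y. 1 / evidence M W \<alpha> f0 n y \<partial>data_law f0 n) \<le> (\<integral>\<^sup>+y. ennreal (1 / p\<^sup>2) * K y \<partial>data_law f0 n)"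
    by (intro nn_integral_mono pt)
  also have "\<dots> = ennreal (1 / p\<^sup>2) * (\<integral>\<^sup>+y. K y \<partial>data_law f0 n)"
    unfolding K_def by (rule nn_integral_cmult) measurable
  also have "(\<integral>\<^sup>+y. K y \<partial>data_law f0 n)
      = (\<integral>\<^sup>+\<omega>. \<integral>\<^sup>+y. ennreal (1 / lik_ratio \<alpha> f0 n y (W \<omega>)) * indicator B \<omega> \<partial>data_law f0 n \<partial>M)"
    unfolding K_def by (rule Fubini'[symmetric]) measurable
  also have "\<dots> \<le> (\<integral>\<^sup>+\<omega>. ennreal (exp (32 * (real n * \<alpha> * e\<^sup>2))) * indicator B \<omega> \<partial>M)"
  proof (rule nn_integral_mono)
    fix \<omega> assume "\<omega> \<in> space M"
    then show "(\<integral>\<^sup>+y. ennreal (1 / lik_ratio \<alpha> f0 n y (W \<omega>)) * indicator B \<omega> \<partial>data_law f0 n)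
      \<le> ennreal (exp (32 * (real n * \<alpha> * e\<^sup>2))) * indicator B \<omega>"
      using expected_inverse_lik_ratio_le[OF f0 c \<alpha> e, of "W \<omega>" n] by (auto simp: indicator_def B_def)
  qed
  also have "\<dots> = ennreal (exp (32 * (real n * \<alpha> * e\<^sup>2)) * p)"
    by (simp add: nn_integral_cmult_indicator pB ennreal_mult p_def)
  finally have "(\<integral>\<^sup>+y. 1 / evidence M W \<alpha> f0 n y \<partial>data_law f0 n)
      \<le> ennreal (1 / p\<^sup>2) * ennreal (exp (32 * (real n * \<alpha> * e\<^sup>2)) * p)"
    by (simp add: mult_left_mono)
  also have "\<dots> = ennreal (exp (32 * (real n * \<alpha> * e\<^sup>2)) * (1 / p))"
    using p by (simp add: ennreal_mult[symmetric] power2_eq_square)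
  also have "\<dots> \<le> ennreal (exp (32 * (real n * \<alpha> * e\<^sup>2)) * exp b)"
  proof (intro ennreal_leI mult_left_mono)
    show "1 / p \<le> exp b" using pb p by (simp add: exp_minus field_simps)
  qed simp
  finally show ?thesis by (simp add: exp_add)
qed

text \<open>This controls posterior numerators: the weight \<open>k\<close> does not depend on the
  data, so after exchanging the integrals each likelihood ratio contributes at most its mean, which
  is at most 1.\<close>

lemma expected_weighted_lik_ratio_le:
  fixes f0 :: C01 and W :: "'w \<Rightarrow> C01"
  assumes M: "prob_space M" and W [measurable]: "W \<in> borel_measurable M"
    and f0: "f0 \<in> densities" and c: "0 < c" "\<And>x. c \<le> apply_bcontfun f0 x" and \<alpha>: "0 < \<alpha>" "\<alpha> \<le> 1"
    and k [measurable]: "k \<in> borel_measurable M"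
  shows "(\<integral>\<^sup>+y. \<integral>\<^sup>+\<omega>. k \<omega> * ennreal (lik_ratio \<alpha> f0 n y (W \<omega>)) \<partial>M \<partial>data_law f0 n) \<le> (\<integral>\<^sup>+\<omega>. k \<omega> \<partial>M)"
proof -
  interpret M: prob_space M by (rule M)
  interpret D: prob_space "data_law f0 n" by (rule prob_space_data_law[OF f0])
  interpret pair_sigma_finite "data_law f0 n" M ..
  note [measurable] = measurable_lik_ratio_pair[OF W]
  have "(\<integral>\<^sup>+y. \<integral>\<^sup>+\<omega>. k \<omega> * ennreal (lik_ratio \<alpha> f0 n y (W \<omega>)) \<partial>M \<partial>data_law f0 n)
      = (\<integral>\<^sup>+\<omega>. \<integral>\<^sup>+y. k \<omega> * ennreal (lik_ratio \<alpha> f0 n y (W \<omega>)) \<partial>data_law f0 n \<partial>M)"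
    by (rule Fubini'[symmetric]) measurable
  also have "\<dots> \<le> (\<integral>\<^sup>+\<omega>. k \<omega> * 1 \<partial>M)"
  proof (rule nn_integral_mono)
    fix \<omega> assume [simp]: "\<omega> \<in> space M"
    have "(\<integral>\<^sup>+y. k \<omega> * ennreal (lik_ratio \<alpha> f0 n y (W \<omega>)) \<partial>data_law f0 n)
        = k \<omega> * (\<integral>\<^sup>+y. ennreal (lik_ratio \<alpha> f0 n y (W \<omega>)) \<partial>data_law f0 n)"
      by (rule nn_integral_cmult) measurable
    also have "\<dots> \<le> k \<omega> * 1" by (intro mult_left_mono expected_lik_ratio_le_1[OF f0 c \<alpha>]) simp
    finally show "(\<integral>\<^sup>+y. k \<omega> * ennreal (lik_ratio \<alpha> f0 n y (W \<omega>)) \<partial>data_law f0 n) \<le> k \<omega> * 1" .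
  qed
  finally show ?thesis by simp
qed

lemma evidence_nonzero:
  assumes M: "prob_space M" and W [measurable]: "W \<in> borel_measurable M"
  shows "evidence M W \<alpha> f0 n y \<noteq> 0"
proof -
  interpret prob_space M by (rule M)
  have "\<not> (AE \<omega> in M. ennreal (lik_ratio \<alpha> f0 n y (W \<omega>)) = 0)"
    using lik_ratio_pos by (simp add: ennreal_eq_0_iff not_le[symmetric])
  then show ?thesis unfolding evidence_def by (subst nn_integral_0_iff_AE) auto
qed

text \<open>The factor contributed by \<open>f0\<close> is positive and finite, so it cancels
  between likelihood and normaliser; for infinite evidence both densities are 0. The reference
  \<open>f0\<close> is arbitrary here.\<close>

lemma frac_posterior_eq_distr:
  fixes W :: "'w \<Rightarrow> C01"
  assumes M: "prob_space M" and W [measurable]: "W \<in> borel_measurable M"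
  shows "frac_posterior \<alpha> (density_prior M W) n y
    = distr (posterior_elem M W \<alpha> f0 n y) density_space (\<lambda>\<omega>. exp_density (W \<omega>))"
proof -
  have fm [measurable]: "(\<lambda>\<omega>. exp_density (W \<omega>)) \<in> measurable M density_space"
    by (rule measurable_compose[OF W measurable_exp_density_space])
  have ev [measurable]: "(\<lambda>f. apply_bcontfun f x) \<in> borel_measurable density_space" for x
    unfolding density_space_def by (rule measurable_restrict_space1[OF measurable_eval])
  define K where "K = exp (\<alpha> * log_likelihood n y f0)"
  have K: "K > 0" by (simp add: K_def)
  have lm0 [measurable]: "(\<lambda>f. exp (\<alpha> * log_likelihood n y f)) \<in> borel_measurable density_space"
    unfolding log_likelihood_def by measurable
  have lm [measurable]: "(\<lambda>f. ennreal (exp (\<alpha> * log_likelihood n y f))) \<in> borel_measurable density_space"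
    unfolding log_likelihood_def by measurable
  have ex: "ennreal (exp (\<alpha> * log_likelihood n y (exp_density w))) = ennreal K * ennreal (lik_ratio \<alpha> f0 n y w)" for w
    using K by (simp add: ennreal_mult[symmetric] lik_ratio_def K_def right_diff_distrib exp_diff)
  have Z: "(\<integral>\<^sup>+g. ennreal (exp (\<alpha> * log_likelihood n y g)) \<partial>density_prior M W) = ennreal K * evidence M W \<alpha> f0 n y"
    unfolding density_prior_def evidence_def
    by (subst nn_integral_distr[OF fm]) (use lm in \<open>auto simp: ex nn_integral_cmult\<close>)
  have "frac_posterior \<alpha> (density_prior M W) n y = distr (density M (\<lambda>\<omega>.
      ennreal (exp (\<alpha> * log_likelihood n y (exp_density (W \<omega>)))) / (ennreal K * evidence M W \<alpha> f0 n y))) density_space (\<lambda>\<omega>. exp_density (W \<omega>))"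
    unfolding frac_posterior_def Z unfolding density_prior_def by (rule density_distr) measurable
  also have "(\<lambda>\<omega>. ennreal (exp (\<alpha> * log_likelihood n y (exp_density (W \<omega>)))) / (ennreal K * evidence M W \<alpha> f0 n y))
      = (\<lambda>\<omega>. ennreal (lik_ratio \<alpha> f0 n y (W \<omega>)) / evidence M W \<alpha> f0 n y)"
  proof (rule ext)
    fix \<omega>
    show "ennreal (exp (\<alpha> * log_likelihood n y (exp_density (W \<omega>)))) / (ennreal K * evidence M W \<alpha> f0 n y)
      = ennreal (lik_ratio \<alpha> f0 n y (W \<omega>)) / evidence M W \<alpha> f0 n y"
    proof (cases "evidence M W \<alpha> f0 n y" rule: ennreal_cases)
      case (real r)
      then have "r > 0" using evidence_nonzero[OF M W, of \<alpha> f0 n y] by (cases "r = 0") auto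
      then show ?thesis unfolding ex real
        using K by (simp add: ennreal_mult[symmetric] divide_ennreal lik_ratio_pos less_imp_le)
    next
      case top
      then show ?thesis using K by (simp add: ennreal_mult_top)
    qed
  qed
  finally show ?thesis unfolding posterior_elem_def .
qed

lemma nn_integral_posterior_elem:
  assumes [measurable]: "W \<in> borel_measurable M" and [measurable]: "k \<in> borel_measurable M"
  shows "(\<integral>\<^sup>+\<omega>. k \<omega> \<partial>posterior_elem M W \<alpha> f0 n y)
    = (\<integral>\<^sup>+\<omega>. k \<omega> * ennreal (lik_ratio \<alpha> f0 n y (W \<omega>)) \<partial>M) * (1 / evidence M W \<alpha> f0 n y)"
proof -
  define D where "D = evidence M W \<alpha> f0 n y"
  have "(\<integral>\<^sup>+\<omega>. k \<omega> \<partial>posterior_elem M W \<alpha> f0 n y) = (\<integral>\<^sup>+\<omega>. ennreal (lik_ratio \<alpha> f0 n y (W \<omega>)) / D * k \<omega> \<partial>M)"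
    unfolding posterior_elem_def D_def[symmetric] by (rule nn_integral_density) measurable
  also have "\<dots> = (\<integral>\<^sup>+\<omega>. k \<omega> * ennreal (lik_ratio \<alpha> f0 n y (W \<omega>)) * (1 / D) \<partial>M)"
    by (intro nn_integral_cong) (simp add: divide_ennreal_def mult_ac)
  also have "\<dots> = (\<integral>\<^sup>+\<omega>. k \<omega> * ennreal (lik_ratio \<alpha> f0 n y (W \<omega>)) \<partial>M) * (1 / D)"
    by (rule nn_integral_multc) measurable
  finally show ?thesis unfolding D_def .
qed

section \<open>Local asymptotic normality\<close>

lemma integral_density_bound:
  fixes f :: C01
  assumes f: "f \<in> densities" and g: "continuous_on UNIV g" "\<And>x. \<bar>g x\<bar> \<le> K"
  shows "\<bar>\<integral>x. g x * f x \<partial>leb01\<bar> \<le> K"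
proof -
  have "(\<integral>x. g x * f x \<partial>leb01) \<le> (\<integral>x. K * f x \<partial>leb01)"
    by (rule integral_density_mono[OF f g(1)]) (use g(2) in \<open>auto simp: abs_le_iff\<close>)
  moreover have "(\<integral>x. (- K) * f x \<partial>leb01) \<le> (\<integral>x. g x * f x \<partial>leb01)"
  proof (rule integral_density_mono[OF f _ g(1)])
    show "- K \<le> g x" for x using g(2)[of x] by linarith
  qed auto
  ultimately show ?thesis using densityD(2)[OF f] by simp
qed

lemma integral_density_diff_bound:
  fixes f f0 :: C01
  assumes g: "continuous_on UNIV g" "\<And>x. \<bar>g x\<bar> \<le> K"
    and l1: "(\<integral>x. \<bar>f x - f0 x\<bar> \<partial>leb01) \<le> d"
  shows "\<bar>(\<integral>x. g x * f x \<partial>leb01) - (\<integral>x. g x * f0 x \<partial>leb01)\<bar> \<le> K * d"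
proof -
  have K: "0 \<le> K" using g(2)[of undefined] by linarith
  have "\<bar>(\<integral>x. g x * f x \<partial>leb01) - (\<integral>x. g x * f0 x \<partial>leb01)\<bar> = \<bar>\<integral>x. g x * (f x - f0 x) \<partial>leb01\<bar>"
    using integrable_leb01_mult[OF g(1)] by (simp add: right_diff_distrib)
  also have "\<dots> \<le> (\<integral>x. \<bar>g x * (f x - f0 x)\<bar> \<partial>leb01)" by (rule integral_abs_bound)
  also have "\<dots> \<le> (\<integral>x. K * \<bar>f x - f0 x\<bar> \<partial>leb01)"
    by (intro integral_mono integrable_leb01 continuous_intros g continuous_on_apply_bcontfun)
      (simp add: abs_mult mult_right_mono g)
  also have "\<dots> \<le> K * d" using mult_left_mono[OF l1 K] by simp
  finally show ?thesis .
qed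

text \<open>Second-order expansion of a cumulant generating function, the linear term vanishing by
  centring. With q = |s| B, the cubic Taylor remainder costs q^3. The logarithm costs another: its
  argument differs from 1 by at most q^2, and 2 q^4 <= q^3.\<close>

lemma log_mgf_bound:
  fixes f :: C01
  assumes f: "f \<in> densities" and k: "continuous_on UNIV k" "\<And>x. \<bar>k x\<bar> \<le> B" and k0: "(\<integral>x. k x * f x \<partial>leb01) = 0"
    and sB: "\<bar>s\<bar> * B \<le> 1 / 2"
  shows "\<bar>ln (\<integral>x. exp (- (s * k x)) * f x \<partial>leb01) - s\<^sup>2 / 2 * (\<integral>x. (k x)\<^sup>2 * f x \<partial>leb01)\<bar> \<le> 2 * (\<bar>s\<bar> * B) ^ 3"
proof -
  have B: "0 \<le> B" using k(2)[of undefined] by linarith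
  define q where "q = \<bar>s\<bar> * B"
  have q: "0 \<le> q" "q \<le> 1 / 2" using B sB by (auto simp: q_def)
  define z where "z = (\<integral>x. exp (- (s * k x)) * f x \<partial>leb01) - 1"
  define v where "v = s\<^sup>2 / 2 * (\<integral>x. (k x)\<^sup>2 * f x \<partial>leb01)"
  have sk: "\<bar>- (s * k x)\<bar> \<le> q" for x
    unfolding q_def by (simp add: abs_mult mult_left_mono k(2))
  note i = integrable_leb01_mult[of _ f]
  have "z - v = (\<integral>x. (exp (- (s * k x)) - (1 + - (s * k x) + (- (s * k x))\<^sup>2 / 2)) * f x \<partial>leb01)"
  proof -
    have "(\<integral>x. (exp (- (s * k x)) - (1 + - (s * k x) + (- (s * k x))\<^sup>2 / 2)) * f x \<partial>leb01)
      = (\<integral>x. exp (- (s * k x)) * f x - (f x - s * (k x * f x) + s\<^sup>2 / 2 * ((k x)\<^sup>2 * f x)) \<partial>leb01)"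
      by (intro Bochner_Integration.integral_cong refl) (simp add: algebra_simps power_mult_distrib)
    also have "\<dots> = (\<integral>x. exp (- (s * k x)) * f x \<partial>leb01) - (1 - s * 0 + v)"
      using densityD[OF f] k0
      by (simp add: i k(1) continuous_intros v_def)
    finally show ?thesis by (simp add: z_def)
  qed
  also have "\<bar>\<dots>\<bar> \<le> q ^ 3"
  proof (rule integral_density_bound[OF f])
    show "continuous_on UNIV (\<lambda>x. exp (- (s * k x)) - (1 + - (s * k x) + (- (s * k x))\<^sup>2 / 2))"
      by (intro continuous_intros k(1)) auto
    fix x
    have "\<bar>exp (- (s * k x)) - (1 + - (s * k x) + (- (s * k x))\<^sup>2 / 2)\<bar> \<le> \<bar>- (s * k x)\<bar> ^ 3"
      by (rule exp_taylor_bounds(2)) (use sk[of x] q in linarith)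
    also have "\<dots> \<le> q ^ 3" by (rule power_mono[OF sk]) simp
    finally show "\<bar>exp (- (s * k x)) - (1 + - (s * k x) + (- (s * k x))\<^sup>2 / 2)\<bar> \<le> q ^ 3" .
  qed
  finally have zv: "\<bar>z - v\<bar> \<le> q ^ 3" .
  have "\<bar>\<integral>x. (k x)\<^sup>2 * f x \<partial>leb01\<bar> \<le> B\<^sup>2"
    by (rule integral_density_bound[OF f])
      (use k in \<open>auto intro!: continuous_intros simp: abs_le_square_iff[symmetric] abs_of_nonneg[OF B]\<close>)
  then have "\<bar>v\<bar> \<le> s\<^sup>2 / 2 * B\<^sup>2" unfolding v_def abs_mult by (intro mult_mono) auto
  then have v: "\<bar>v\<bar> \<le> q\<^sup>2 / 2" by (simp add: q_def power_mult_distrib)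
  have q3: "q ^ 3 \<le> q\<^sup>2 / 2"
  proof -
    have "q\<^sup>2 * q \<le> q\<^sup>2 * (1 / 2)" using q by (intro mult_left_mono) auto
    then show ?thesis by (simp add: power3_eq_cube power2_eq_square)
  qed
  have z: "\<bar>z\<bar> \<le> q\<^sup>2" using zv v q3 by linarith
  have "q\<^sup>2 \<le> (1/2)\<^sup>2" using q by (intro power_mono) auto
  then have q2: "q\<^sup>2 \<le> 1/4" by (simp add: power2_eq_square)
  have "\<bar>ln (1 + z) - z\<bar> \<le> 2 * z\<^sup>2" by (rule abs_ln_one_plus_x_minus_x_bound) (use z q2 in linarith)
  also have "z\<^sup>2 \<le> (q\<^sup>2)\<^sup>2" using power_mono[OF z, of 2] by simp
  also have "2 * (q\<^sup>2)\<^sup>2 \<le> q ^ 3"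
  proof -
    have "q ^ 3 * (2 * q) \<le> q ^ 3 * 1" using q by (intro mult_left_mono) auto
    then show ?thesis by (simp add: power3_eq_cube power2_eq_square mult_ac)
  qed
  finally have "\<bar>ln (1 + z) - z\<bar> \<le> q ^ 3" by simp
  then have "\<bar>ln (1 + z) - v\<bar> \<le> 2 * q ^ 3" using zv by linarith
  then show ?thesis by (simp add: z_def v_def q_def)
qed

text \<open>The change of log normaliser when the log density is shifted by -s h; also the cumulant
  function of \<open>h\<close> under \<open>f\<close> at -s.\<close>

definition shift_log_mgf :: "real \<Rightarrow> C01 \<Rightarrow> C01 \<Rightarrow> real"
  where "shift_log_mgf s h f = ln (\<integral>x. exp (- (s * h x)) * f x \<partial>leb01)"

lemma integral_exp_density_pos:
  assumes f: "f \<in> densities" and g: "continuous_on UNIV g"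
  shows "0 < (\<integral>x. exp (g x) * f x \<partial>leb01)"
proof -
  obtain K where K: "\<And>x. \<bar>g x\<bar> \<le> K"
    using continuous_in_bcontfun[OF g] by (auto simp: bcontfun_def bounded_iff)
  have "(\<integral>x. exp (- K) * f x \<partial>leb01) \<le> (\<integral>x. exp (g x) * f x \<partial>leb01)"
  proof (rule integral_density_mono[OF f])
    show "exp (- K) \<le> exp (g x)" for x using K[of x] by (simp add: abs_le_iff)
  qed (auto intro!: continuous_intros g)
  then show ?thesis using densityD(2)[OF f] by (simp add: less_le_trans[OF exp_gt_zero])
qed

lemma ln_exp_density_shift:
  "ln (exp_density (w - s *\<^sub>R h) x) = ln (exp_density w x) - s * h x - shift_log_mgf s h (exp_density w)"
proof -
  define Z where "Z = (\<integral>y. exp (w y) \<partial>leb01)"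
  define Z' where "Z' = (\<integral>y. exp (w y - s * h y) \<partial>leb01)"
  have pos: "0 < Z" using exp_density_pos[of w x] unfolding apply_exp_density Z_def[symmetric] by (simp add: zero_less_divide_iff)
  have pos': "0 < Z'" using exp_density_pos[of "w - s *\<^sub>R h" x] unfolding apply_exp_density Z'_def by (simp add: zero_less_divide_iff)
  have "(\<integral>x. exp (- (s * h x)) * exp_density w x \<partial>leb01) = Z' / Z"
    unfolding Z'_def apply_exp_density Z_def[symmetric] by (simp add: exp_diff exp_minus divide_inverse mult_ac)
  then have "shift_log_mgf s h (exp_density w) = ln Z' - ln Z"
    unfolding shift_log_mgf_def using pos pos' by (simp add: ln_div)
  then show ?thesis
    unfolding apply_exp_density using pos pos' by (simp add: ln_div Z_def Z'_def)
qed

lemma lik_ratio_shift: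
  "lik_ratio \<alpha> f0 n y w = lik_ratio \<alpha> f0 n y (w - s *\<^sub>R h) *
    exp (\<alpha> * (s * (\<Sum>i<n. h (y i)) + real n * shift_log_mgf s h (exp_density w)))"
  unfolding lik_ratio_def log_likelihood_def ln_exp_density_shift exp_add[symmetric]
  by (simp add: sum_subtractf sum.distrib sum_distrib_left[symmetric] algebra_simps)

text \<open>The empirical process under \<open>f0\<close> at \<open>g\<close>, scaled by a general
  root of m; m will be n \<alpha>, at most n.\<close>

definition emp_dev :: "C01 \<Rightarrow> real \<Rightarrow> nat \<Rightarrow> C01 \<Rightarrow> (nat \<Rightarrow> unit_interval) \<Rightarrow> real"
  where "emp_dev f0 m n g y = sqrt m * ((1 / real n) * (\<Sum>i<n. g (y i)) - (\<integral>x. g x * f0 x \<partial>leb01))"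

text \<open>By \<open>lik_ratio_shift\<close>, the quantity compared with $t^2 V/2$ is the logarithm of
  $e^{tX} G(w) / G(w - s h)$, where $G$ is the likelihood ratio and $X$ the centred linear statistic.\<close>

lemma lan_exponent_bound:
  fixes f f0 h p :: C01
  assumes f: "f \<in> densities" and f0: "f0 \<in> densities"
    and l1: "(\<integral>x. \<bar>f x - f0 x\<bar> \<partial>leb01) \<le> 2 * e"
    and p0: "(\<integral>x. p x * f0 x \<partial>leb01) = 0" and p: "\<And>x. \<bar>p x\<bar> \<le> C"
    and h: "\<And>x. \<bar>h x - p x\<bar> \<le> \<zeta>" and \<zeta>: "\<zeta> \<le> 1"
    and n: "n \<ge> 1" and \<alpha>: "0 < \<alpha>" and m: "m = real n * \<alpha>" and s: "s = t / sqrt m"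
    and sB: "\<bar>s\<bar> * (2 * (C + 1)) \<le> 1 / 2"
  shows "\<bar>t * (sqrt m * ((\<integral>x. p x * f x \<partial>leb01) - (1 / real n) * (\<Sum>i<n. p (y i))))
      + \<alpha> * (s * (\<Sum>i<n. h (y i)) + real n * shift_log_mgf s h f) - t\<^sup>2 * (\<integral>x. (p x)\<^sup>2 * f0 x \<partial>leb01) / 2\<bar>
    \<le> \<bar>t\<bar> * \<bar>emp_dev f0 m n (h - p) y\<bar> + (\<bar>t\<bar> * (sqrt m * (\<zeta> * (2 * e))) + 2 * m * (\<bar>s\<bar> * (2 * (C + 1))) ^ 3
      + t\<^sup>2 / 2 * ((\<zeta> * (2 * C + 1) + C\<^sup>2 * (2 * e)) + (C + 1) * (\<zeta> + C * (2 * e))))"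
proof -
  note cont = continuous_on_apply_bcontfun
  have m0: "m > 0" using n \<alpha> by (simp add: m)
  have C: "0 \<le> C" and z0: "0 \<le> \<zeta>" using p[of undefined] h[of undefined] by linarith+
  have hC: "\<bar>h x\<bar> \<le> C + 1" for x using p[of x] h[of x] \<zeta> by linarith
  \<comment> \<open>The centring is under \<open>f\<close> and not \<open>f0\<close>, since the
    cumulant expansion is taken under \<open>f\<close>.\<close>
  define a where "a = (\<integral>x. h x * f x \<partial>leb01)"
  have a: "\<bar>a\<bar> \<le> C + 1" unfolding a_def by (rule integral_density_bound[OF f cont hC])
  define Var where "Var = (\<integral>x. (h x - a)\<^sup>2 * f x \<partial>leb01)"
  note i = integrable_leb01_mult[of _ f] integrable_leb01_mult[of _ f0]
  have ih: "integrable leb01 (\<lambda>x. h x * f x)" "integrable leb01 (\<lambda>x. (h x)\<^sup>2 * f x)" "integrable leb01 (\<lambda>x. p x * f x)"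
    "integrable leb01 (\<lambda>x. h x * f0 x)" "integrable leb01 (\<lambda>x. p x * f0 x)"
    "integrable leb01 (\<lambda>x. (p x)\<^sup>2 * f x)"
    by (intro i continuous_intros cont)+
  have kap: "\<bar>(shift_log_mgf s h f + s * a) - s\<^sup>2 / 2 * Var\<bar> \<le> 2 * (\<bar>s\<bar> * (2 * (C + 1))) ^ 3"
  proof -
    have "(\<integral>x. exp (- (s * (h x - a))) * f x \<partial>leb01) = exp (s * a) * (\<integral>x. exp (- (s * h x)) * f x \<partial>leb01)"
    proof -
      have "(\<integral>x. exp (- (s * (h x - a))) * f x \<partial>leb01) = (\<integral>x. exp (s * a) * (exp (- (s * h x)) * f x) \<partial>leb01)"
        by (intro Bochner_Integration.integral_cong refl) (simp add: right_diff_distrib exp_diff exp_minus field_simps)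
      then show ?thesis by simp
    qed
    then have "ln (\<integral>x. exp (- (s * (h x - a))) * f x \<partial>leb01) = s * a + shift_log_mgf s h f"
      unfolding shift_log_mgf_def
      using integral_exp_density_pos[OF f, of "\<lambda>x. - (s * h x)"] by (simp add: ln_mult continuous_intros cont)
    moreover have "\<bar>ln (\<integral>x. exp (- (s * (h x - a))) * f x \<partial>leb01) - s\<^sup>2 / 2 * Var\<bar> \<le> 2 * (\<bar>s\<bar> * (2 * (C + 1))) ^ 3"
      unfolding Var_def
    proof (rule log_mgf_bound[OF f _ _ _ sB])
      show "continuous_on UNIV (\<lambda>x. h x - a)" by (intro continuous_intros cont)
      show "\<bar>h x - a\<bar> \<le> 2 * (C + 1)" for x
        using order_trans[OF abs_triangle_ineq4 add_mono[OF hC[of x] a]] by (simp add: algebra_simps)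
      show "(\<integral>x. (h x - a) * f x \<partial>leb01) = 0"
        using ih(1) densityD[OF f] by (simp add: left_diff_distrib a_def)
    qed
    ultimately show ?thesis by (simp add: add.commute)
  qed
  have Var: "Var = (\<integral>x. (h x)\<^sup>2 * f x \<partial>leb01) - a\<^sup>2"
  proof -
    have "Var = (\<integral>x. (h x)\<^sup>2 * f x - 2 * a * (h x * f x) + a\<^sup>2 * f x \<partial>leb01)"
      unfolding Var_def by (intro Bochner_Integration.integral_cong refl) (simp add: power2_diff algebra_simps)
    also have "\<dots> = (\<integral>x. (h x)\<^sup>2 * f x \<partial>leb01) - 2 * a * a + a\<^sup>2 * 1"
      using ih densityD[OF f] by (simp add: a_def)
    finally show ?thesis by (simp add: power2_eq_square)
  qed
  define V where "V = (\<integral>x. (p x)\<^sup>2 * f0 x \<partial>leb01)"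
  \<comment> \<open>Three errors: replacing h by p in the second moment, replacing f by f0, and the
    squared mean a^2, which is small because p has mean 0 under \<open>f0\<close>.\<close>
  have VV: "\<bar>Var - V\<bar> \<le> (\<zeta> * (2 * C + 1) + C\<^sup>2 * (2 * e)) + (C + 1) * (\<zeta> + C * (2 * e))"
  proof -
    have "\<bar>\<integral>x. ((h x)\<^sup>2 - (p x)\<^sup>2) * f x \<partial>leb01\<bar> \<le> \<zeta> * (2 * C + 1)"
    proof (rule integral_density_bound[OF f])
      fix x
      have "(h x)\<^sup>2 - (p x)\<^sup>2 = (h x - p x) * (h x + p x)" by (simp add: power2_eq_square algebra_simps)
      then have "\<bar>(h x)\<^sup>2 - (p x)\<^sup>2\<bar> = \<bar>h x - p x\<bar> * \<bar>h x + p x\<bar>" by (simp add: abs_mult)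
      also have "\<dots> \<le> \<zeta> * (2 * C + 1)"
        using h[of x] z0 hC[of x] p[of x] by (intro mult_mono) linarith+
      finally show "\<bar>(h x)\<^sup>2 - (p x)\<^sup>2\<bar> \<le> \<zeta> * (2 * C + 1)" .
    qed (intro continuous_intros cont)
    then have 1: "\<bar>(\<integral>x. (h x)\<^sup>2 * f x \<partial>leb01) - (\<integral>x. (p x)\<^sup>2 * f x \<partial>leb01)\<bar> \<le> \<zeta> * (2 * C + 1)"
      using ih by (simp add: left_diff_distrib)
    have 2: "\<bar>(\<integral>x. (p x)\<^sup>2 * f x \<partial>leb01) - V\<bar> \<le> C\<^sup>2 * (2 * e)"
      unfolding V_def
      by (rule integral_density_diff_bound[OF _ _ l1])
        (use p in \<open>auto intro!: continuous_intros cont simp: abs_le_square_iff[symmetric] abs_of_nonneg[OF C]\<close>)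
    have "\<bar>\<integral>x. (h x - p x) * f x \<partial>leb01\<bar> \<le> \<zeta>"
      by (rule integral_density_bound[OF f _ h]) (intro continuous_intros cont)
    then have "\<bar>a - (\<integral>x. p x * f x \<partial>leb01)\<bar> \<le> \<zeta>" using ih by (simp add: left_diff_distrib a_def)
    moreover have "\<bar>(\<integral>x. p x * f x \<partial>leb01) - 0\<bar> \<le> C * (2 * e)"
      unfolding p0[symmetric] by (rule integral_density_diff_bound[OF cont p l1])
    ultimately have a': "\<bar>a\<bar> \<le> \<zeta> + C * (2 * e)" by linarith
    have 3: "a\<^sup>2 \<le> (C + 1) * (\<zeta> + C * (2 * e))"
      using mult_mono[OF a a'] C by (simp add: power2_eq_square abs_mult[symmetric])
    show ?thesis unfolding Var using 1 2 3 zero_le_power2[of a] by linarith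
  qed
  have dif: "\<bar>(\<integral>x. (h x - p x) * f x \<partial>leb01) - (\<integral>x. (h x - p x) * f0 x \<partial>leb01)\<bar> \<le> \<zeta> * (2 * e)"
    by (rule integral_density_diff_bound[OF _ h l1]) (intro continuous_intros cont)
  define D where "D = (\<integral>x. (h x - p x) * f x \<partial>leb01) - (\<integral>x. (h x - p x) * f0 x \<partial>leb01)"
  define rem where "rem = shift_log_mgf s h f + s * a - s\<^sup>2 / 2 * Var"
  have ms: "m * s = t * sqrt m" unfolding s using m0 by (simp add: field_simps)
  have mss: "m * s\<^sup>2 = t\<^sup>2" unfolding s using m0 by (simp add: power_divide)
  have an: "\<alpha> * real n = m" by (simp add: m)
  have asn: "\<alpha> * s = t * sqrt m / real n" using ms n by (simp add: m field_simps)
  define Sh where "Sh = (\<Sum>i<n. h (y i))"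
  define Sp where "Sp = (\<Sum>i<n. p (y i))"
  define Pp where "Pp = (\<integral>x. p x * f x \<partial>leb01)"
  define R where "R = emp_dev f0 m n (h - p) y"
  have R: "R = sqrt m * ((1 / real n) * (Sh - Sp) - (\<integral>x. (h x - p x) * f0 x \<partial>leb01))"
    unfolding R_def emp_dev_def Sh_def Sp_def by (simp add: sum_subtractf)
  have Dval: "(\<integral>x. (h x - p x) * f0 x \<partial>leb01) = a - Pp - D"
    unfolding D_def a_def Pp_def using ih by (simp add: left_diff_distrib)
  \<comment> \<open>An exact identity. The linear terms cancel up to h - p, which appears once in
    the empirical process (\<open>R\<close>) and once in the difference of means under f and f0
    (\<open>D\<close>). The latter has size sqrt m * \<zeta> * e, the quantity that the rate
    condition makes vanish.\<close>
  have main: "t * (sqrt m * (Pp - (1 / real n) * Sp)) + \<alpha> * (s * Sh + real n * shift_log_mgf s h f) - t\<^sup>2 * V / 2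
      = t * R - t * (sqrt m * D) + m * rem + t\<^sup>2 / 2 * (Var - V)"
  proof -
    have e1: "\<alpha> * (s * Sh + real n * shift_log_mgf s h f) = t * sqrt m * ((1 / real n) * Sh) + m * shift_log_mgf s h f"
      using asn an by (simp add: distrib_left mult.assoc[symmetric])
    have e2: "m * shift_log_mgf s h f = m * rem - (m * s) * a + (m * s\<^sup>2) / 2 * Var"
      unfolding rem_def by (simp add: algebra_simps)
    show ?thesis unfolding e1 e2 ms mss R Dval by (simp add: algebra_simps diff_divide_distrib)
  qed
  have "\<bar>t * R - t * (sqrt m * D) + m * rem + t\<^sup>2 / 2 * (Var - V)\<bar>
      \<le> \<bar>t * R\<bar> + \<bar>t * (sqrt m * D)\<bar> + \<bar>m * rem\<bar> + \<bar>t\<^sup>2 / 2 * (Var - V)\<bar>" by linarith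
  moreover have "\<bar>t * (sqrt m * D)\<bar> \<le> \<bar>t\<bar> * (sqrt m * (\<zeta> * (2 * e)))"
    unfolding abs_mult using dif m0 by (intro mult_left_mono) (auto simp: D_def)
  moreover have "\<bar>m * rem\<bar> \<le> 2 * m * (\<bar>s\<bar> * (2 * (C + 1))) ^ 3"
    using mult_left_mono[OF kap, of m] m0 by (simp add: rem_def abs_mult)
  moreover have "\<bar>t\<^sup>2 / 2 * (Var - V)\<bar> \<le> t\<^sup>2 / 2 * ((\<zeta> * (2 * C + 1) + C\<^sup>2 * (2 * e)) + (C + 1) * (\<zeta> + C * (2 * e)))"
    unfolding abs_mult using VV by (intro mult_mono) auto
  ultimately have "\<bar>t * R - t * (sqrt m * D) + m * rem + t\<^sup>2 / 2 * (Var - V)\<bar>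
    \<le> \<bar>t\<bar> * \<bar>R\<bar> + (\<bar>t\<bar> * (sqrt m * (\<zeta> * (2 * e))) + 2 * m * (\<bar>s\<bar> * (2 * (C + 1))) ^ 3
      + t\<^sup>2 / 2 * ((\<zeta> * (2 * C + 1) + C\<^sup>2 * (2 * e)) + (C + 1) * (\<zeta> + C * (2 * e))))"
    unfolding abs_mult[of t R] by linarith
  then show ?thesis unfolding main[symmetric] unfolding Pp_def Sp_def Sh_def V_def R_def .
qed

text \<open>After centring, each of the n factors has mean at most exp (4 l^2 z^2) by a quadratic
  Taylor bound, and m <= n gives n l^2 <= c^2. The bound is independent of c as long as c z <= 1/4,
  so a small sup norm allows a strong tilt.\<close>

lemma expected_exp_emp_dev_le:
  fixes f0 g :: C01
  assumes f0: "f0 \<in> densities" and g: "\<And>x. \<bar>g x\<bar> \<le> z" and n: "n \<ge> 1" and m: "0 \<le> m" "m \<le> real n"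
    and c: "0 \<le> c" "c * z \<le> 1 / 4"
  shows "(\<integral>\<^sup>+y. ennreal (exp (c * emp_dev f0 m n g y)) \<partial>data_law f0 n) \<le> ennreal (exp 1)"
proof -
  note cont = continuous_on_apply_bcontfun
  define a where "a = (\<integral>x. g x * f0 x \<partial>leb01)"
  define l where "l = c * sqrt m / real n"
  have z0: "0 \<le> z" using g[of undefined] by linarith
  have a: "\<bar>a\<bar> \<le> z" unfolding a_def by (rule integral_density_bound[OF f0 cont g])
  have v: "\<bar>g x - a\<bar> \<le> 2 * z" for x using g[of x] a by linarith
  have smn: "sqrt m \<le> real n"
  proof -
    have "sqrt m \<le> sqrt (real n)" using m by simp
    also have "\<dots> \<le> sqrt (real n * real n)" using n by (intro real_sqrt_le_mono) (simp add: mult_le_cancel_left1)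
    finally show ?thesis by simp
  qed
  have l: "0 \<le> l" "l \<le> c"
  proof -
    show "0 \<le> l" using c m by (simp add: l_def)
    have "c * (sqrt m / real n) \<le> c * 1" using c smn n by (intro mult_left_mono) auto
    then show "l \<le> c" by (simp add: l_def)
  qed
  have l2: "l\<^sup>2 * real n \<le> c\<^sup>2"
  proof -
    have "l\<^sup>2 * real n = c\<^sup>2 * (m / real n)" using m n by (simp add: l_def power_divide power_mult_distrib power2_eq_square)
    also have "\<dots> \<le> c\<^sup>2 * 1" using m n by (intro mult_left_mono) auto
    finally show ?thesis by simp
  qed
  have eq: "exp (c * emp_dev f0 m n g y) = (\<Prod>i<n. exp (l * (g (y i) - a)))" for y
  proof -
    have "c * emp_dev f0 m n g y = (\<Sum>i<n. l * (g (y i) - a))"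
    proof -
      have "(\<Sum>i<n. l * (g (y i) - a)) = l * ((\<Sum>i<n. g (y i)) - real n * a)"
        by (simp add: sum_distrib_left[symmetric] sum_subtractf)
      then show ?thesis
        unfolding emp_dev_def a_def[symmetric] l_def using n by (simp add: field_simps)
    qed
    then show ?thesis by (simp add: exp_sum)
  qed
  have "(\<integral>x. exp (l * (g x - a)) * f0 x \<partial>leb01) \<le> (\<integral>x. (1 + l * (g x - a) + l\<^sup>2 * (4 * z\<^sup>2)) * f0 x \<partial>leb01)"
  proof (rule integral_density_mono[OF f0])
    fix x
    have "\<bar>l * (g x - a)\<bar> \<le> c * (2 * z)" unfolding abs_mult using l v[of x] z0 by (intro mult_mono) auto
    then have "\<bar>l * (g x - a)\<bar> \<le> 1 / 2" using c by linarith
    then have "exp (l * (g x - a)) \<le> 1 + l * (g x - a) + l\<^sup>2 * (g x - a)\<^sup>2"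
      using exp_taylor_bounds(1) by (simp add: power_mult_distrib[symmetric])
    also have "(g x - a)\<^sup>2 \<le> 4 * z\<^sup>2" using power_mono[OF v[of x], of 2] by (simp add: power_mult_distrib)
    finally show "exp (l * (g x - a)) \<le> 1 + l * (g x - a) + l\<^sup>2 * (4 * z\<^sup>2)" by (simp add: mult_left_mono)
  qed (intro continuous_intros cont)+
  also have "\<dots> = 1 + l\<^sup>2 * (4 * z\<^sup>2)"
  proof -
    have "(\<integral>x. (1 + l * (g x - a) + l\<^sup>2 * (4 * z\<^sup>2)) * f0 x \<partial>leb01)
      = (\<integral>x. f0 x + l * (g x * f0 x) - (l * a) * f0 x + (l\<^sup>2 * (4 * z\<^sup>2)) * f0 x \<partial>leb01)"
      by (intro Bochner_Integration.integral_cong refl) (simp add: algebra_simps)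
    also have "\<dots> = 1 + l * a - (l * a) * 1 + (l\<^sup>2 * (4 * z\<^sup>2)) * 1"
      using densityD[OF f0] integrable_leb01_mult[OF cont, of g f0] by (simp add: a_def)
    finally show ?thesis by simp
  qed
  also have "\<dots> \<le> exp (l\<^sup>2 * (4 * z\<^sup>2))" by (rule exp_ge_add_one_self)
  finally have le: "(\<integral>x. exp (l * (g x - a)) * f0 x \<partial>leb01) \<le> exp (l\<^sup>2 * (4 * z\<^sup>2))" .
  have gm: "(\<lambda>x. l * (g x - a)) \<in> borel_measurable borel" by measurable
  have "(\<integral>\<^sup>+y. ennreal (exp (c * emp_dev f0 m n g y)) \<partial>data_law f0 n)
      = (\<integral>\<^sup>+x. ennreal (exp (l * (g x - a))) * ennreal (f0 x) \<partial>leb01) ^ n"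
    by (simp only: eq nn_integral_data_law_prod[OF f0 gm])
  also have "(\<integral>\<^sup>+x. ennreal (exp (l * (g x - a))) * ennreal (f0 x) \<partial>leb01) = ennreal (\<integral>x. exp (l * (g x - a)) * f0 x \<partial>leb01)"
    by (rule nn_integral_leb01_density[OF f0]) (auto intro!: continuous_intros cont)
  also have "\<dots> ^ n \<le> ennreal (exp (l\<^sup>2 * (4 * z\<^sup>2))) ^ n"
    by (rule power_mono) (use ennreal_leI[OF le] in auto)
  also have "\<dots> = ennreal (exp ((l\<^sup>2 * real n) * (4 * z\<^sup>2)))"
    by (simp add: ennreal_power exp_of_nat_mult[symmetric] mult_ac)
  also have "\<dots> \<le> ennreal (exp 1)"
  proof (intro ennreal_leI, subst exp_le_cancel_iff)
    have "(l\<^sup>2 * real n) * (4 * z\<^sup>2) \<le> c\<^sup>2 * (4 * z\<^sup>2)" by (intro mult_right_mono l2) simp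
    also have "\<dots> = 4 * (c * z)\<^sup>2" by (simp add: power_mult_distrib)
    also have "(c * z)\<^sup>2 \<le> (1/4)\<^sup>2" using c z0 by (intro power_mono) auto
    finally show "(l\<^sup>2 * real n) * (4 * z\<^sup>2) \<le> 1" by (simp add: power2_eq_square)
  qed
  finally show ?thesis .
qed

lemma measurable_emp_dev: "emp_dev f0 m n g \<in> borel_measurable (data_law f n)"
proof -
  have "(\<lambda>y. \<Sum>i<n. g (y i)) \<in> borel_measurable (data_law f n)"
    by (intro borel_measurable_sum measurable_compose[OF _ borel_measurable_apply_C01] measurable_data_component) simp
  then show ?thesis unfolding emp_dev_def by measurable
qed

text \<open>Chernoff's bound exp (1 - c \<delta>) with a tilt c of order 1 / \<zeta>, which tends to
  infinity. Applying it to g and to -g gives both signs.\<close>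

lemma whp_emp_dev_le:
  fixes g :: "nat \<Rightarrow> C01"
  assumes f0: "f0 \<in> densities" and m: "\<And>n. n \<ge> 1 \<Longrightarrow> 0 \<le> m n \<and> m n \<le> real n"
    and g: "\<And>n x. n \<ge> 1 \<Longrightarrow> \<bar>g n x\<bar> \<le> \<zeta> n" and \<zeta>: "\<zeta> \<longlonglongrightarrow> 0" and \<delta>: "0 < \<delta>"
  shows "whp (data_law f0) (\<lambda>n y. \<bar>emp_dev f0 (m n) n (g n) y\<bar> \<le> \<delta>)"
proof -
  \<comment> \<open>The summand 1/(n+1) keeps the denominator positive where \<zeta> vanishes and
    still tends to 0.\<close>
  define c where "c n = 1 / (4 * (\<bar>\<zeta> n\<bar> + 1 / real (Suc n)))" for n
  have dpos: "0 < \<bar>\<zeta> n\<bar> + 1 / real (Suc n)" for n by (simp add: add_nonneg_pos)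
  have c: "0 < c n" for n unfolding c_def using dpos[of n] by simp
  have cz: "c n * \<zeta> n \<le> 1 / 4" for n
    unfolding c_def using dpos[of n] by (simp add: divide_le_eq) (simp add: add_increasing2)
  have l0: "(\<lambda>n. 1 / real (Suc n)) \<longlonglongrightarrow> 0" by (rule LIMSEQ_Suc[OF lim_1_over_n])
  have "(\<lambda>n. 4 * (\<bar>\<zeta> n\<bar> + 1 / real (Suc n))) \<longlonglongrightarrow> 4 * (\<bar>0\<bar> + 0)" by (intro tendsto_intros \<zeta> l0)
  then have "filterlim (\<lambda>n. 4 * (\<bar>\<zeta> n\<bar> + 1 / real (Suc n))) (at_right 0) sequentially"
    using dpos by (intro tendsto_imp_filterlim_at_right always_eventually allI) (simp, simp only: zero_less_mult_iff, simp)
  then have ctop: "filterlim c at_top sequentially"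
    unfolding c_def using filterlim_compose[OF filterlim_inverse_at_top_right] by (simp add: inverse_eq_divide)
  have one: "whp (data_law f0) (\<lambda>n y. emp_dev f0 (m n) n (g' n) y \<le> \<delta>)"
    if g': "\<And>n x. n \<ge> 1 \<Longrightarrow> \<bar>g' n x\<bar> \<le> \<zeta> n" for g' :: "nat \<Rightarrow> C01"
  proof -
    have "whp (data_law f0) (\<lambda>n y. ennreal (exp (c n * emp_dev f0 (m n) n (g' n) y - c n * \<delta>)) \<le> ennreal 1)"
    proof (rule whp_Markov)
      show "(\<lambda>y. ennreal (exp (c n * emp_dev f0 (m n) n (g' n) y - c n * \<delta>))) \<in> borel_measurable (data_law f0 n)" for n
        using measurable_emp_dev[of f0 "m n" n "g' n" f0] by measurable
      have "filterlim (\<lambda>n. \<delta> * c n) at_top sequentially"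
        by (rule filterlim_tendsto_pos_mult_at_top[OF tendsto_const \<delta> ctop])
      then have "filterlim (\<lambda>n. - (\<delta> * c n)) at_bot sequentially" by (simp add: filterlim_uminus_at_bot)
      then have "(\<lambda>n. exp (- (\<delta> * c n))) \<longlonglongrightarrow> 0" by (rule filterlim_compose[OF exp_at_bot])
      from tendsto_ennrealI[OF tendsto_mult_right_zero[OF this, of "exp 1"]]
      show "(\<lambda>n. ennreal (exp 1 * exp (- (\<delta> * c n)))) \<longlonglongrightarrow> 0" by simp
      show "\<forall>\<^sub>F n in sequentially. (\<integral>\<^sup>+y. ennreal (exp (c n * emp_dev f0 (m n) n (g' n) y - c n * \<delta>)) \<partial>data_law f0 n)
          \<le> ennreal (exp 1 * exp (- (\<delta> * c n)))"
        using eventually_ge_at_top[of 1]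
      proof (rule eventually_mono)
        fix n :: nat assume n: "1 \<le> n"
        have [measurable]: "emp_dev f0 (m n) n (g' n) \<in> borel_measurable (data_law f0 n)" by (rule measurable_emp_dev)
        have "(\<integral>\<^sup>+y. ennreal (exp (c n * emp_dev f0 (m n) n (g' n) y - c n * \<delta>)) \<partial>data_law f0 n)
          = (\<integral>\<^sup>+y. ennreal (exp (c n * emp_dev f0 (m n) n (g' n) y)) * ennreal (exp (- (\<delta> * c n))) \<partial>data_law f0 n)"
          by (intro nn_integral_cong) (simp add: ennreal_mult[symmetric] exp_add[symmetric] mult.commute)
        also have "\<dots> = (\<integral>\<^sup>+y. ennreal (exp (c n * emp_dev f0 (m n) n (g' n) y)) \<partial>data_law f0 n) * ennreal (exp (- (\<delta> * c n)))"
          by (rule nn_integral_multc) measurable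
        also have "\<dots> \<le> ennreal (exp 1) * ennreal (exp (- (\<delta> * c n)))"
          using expected_exp_emp_dev_le[OF f0 g'[OF n] n _ _ _ cz] m[OF n] c[of n]
          by (intro mult_right_mono) auto
        finally show "(\<integral>\<^sup>+y. ennreal (exp (c n * emp_dev f0 (m n) n (g' n) y - c n * \<delta>)) \<partial>data_law f0 n)
          \<le> ennreal (exp 1 * exp (- (\<delta> * c n)))" by (simp add: ennreal_mult)
      qed
    qed simp
    then show ?thesis
    proof (rule whp_mono, intro always_eventually allI ballI impI)
      fix n y assume "ennreal (exp (c n * emp_dev f0 (m n) n (g' n) y - c n * \<delta>)) \<le> ennreal 1"
      then have "c n * emp_dev f0 (m n) n (g' n) y \<le> c n * \<delta>" by simp
      then show "emp_dev f0 (m n) n (g' n) y \<le> \<delta>" using c[of n] by simp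
    qed
  qed
  have neg: "emp_dev f0 (m n) n (- g n) y = - emp_dev f0 (m n) n (g n) y" for n y
    by (simp add: emp_dev_def sum_negf algebra_simps)
  have "whp (data_law f0) (\<lambda>n y. emp_dev f0 (m n) n (g n) y \<le> \<delta> \<and> emp_dev f0 (m n) n (- g n) y \<le> \<delta>)"
    by (intro whp_conj one) (use g in auto)
  then show ?thesis
    by (rule whp_mono) (auto simp: neg abs_le_iff)
qed

section \<open>Laplace transform of the posterior\<close>

definition l1_err :: "C01 \<Rightarrow> C01 \<Rightarrow> real"
  where "l1_err f0 w = (\<integral>x. \<bar>exp_density w x - f0 x\<bar> \<partial>leb01)"

definition lin_stat :: "C01 \<Rightarrow> real \<Rightarrow> nat \<Rightarrow> (nat \<Rightarrow> unit_interval) \<Rightarrow> C01 \<Rightarrow> real"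
  where "lin_stat p m n y w = sqrt m * ((\<integral>x. p x * exp_density w x \<partial>leb01) - (1 / real n) * (\<Sum>i<n. p (y i)))"

lemma measurable_exp_density_leb01:
  "(\<lambda>(w, x). apply_bcontfun (exp_density w) x) \<in> borel_measurable (borel \<Otimes>\<^sub>M leb01)"
proof -
  have "(\<lambda>z. apply_bcontfun (exp_density (fst z)) (snd z)) \<in> borel_measurable (borel \<Otimes>\<^sub>M leb01)"
  proof (rule measurable_eval_compose)
    show "(\<lambda>z. exp_density (fst z)) \<in> borel_measurable (borel \<Otimes>\<^sub>M leb01)"
      by (rule measurable_compose[OF measurable_fst measurable_exp_density])
    show "snd \<in> measurable (borel \<Otimes>\<^sub>M leb01) borel"
      by (subst measurable_cong_sets[OF refl sets_leb01[symmetric]]) (rule measurable_snd)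
  qed
  then show ?thesis by (simp add: case_prod_beta')
qed

lemma apply_C01_measurable_leb01 [measurable]: "apply_bcontfun (f::C01) \<in> borel_measurable leb01"
  unfolding measurable_cong_sets[OF sets_leb01 refl] by (rule borel_measurable_apply_C01)

lemma measurable_l1_err [measurable]: "l1_err f0 \<in> borel_measurable borel"
proof -
  interpret prob_space leb01 by (rule prob_space_leb01)
  note [measurable] = measurable_exp_density_leb01
  show ?thesis unfolding l1_err_def by measurable
qed

lemma measurable_lin_stat [measurable]: "lin_stat p m n y \<in> borel_measurable borel"
proof -
  interpret prob_space leb01 by (rule prob_space_leb01)
  note [measurable] = measurable_exp_density_leb01
  show ?thesis unfolding lin_stat_def by measurable
qed

text \<open>The shift multiplies the density by exp (s h - \<kappa>), where \<kappa> is the change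
  of log normaliser. That exponent is at most 2 |s| H, hence at most 1/2, so the density changes by
  a relative amount of at most 4 |s| H.\<close>

lemma l1_err_shift:
  fixes h :: C01
  assumes h: "\<And>x. \<bar>h x\<bar> \<le> H" and s: "\<bar>s\<bar> * H \<le> 1 / 4"
  shows "l1_err f0 (w + s *\<^sub>R h) \<le> l1_err f0 w + 4 * (\<bar>s\<bar> * H)"
proof -
  note cont = continuous_on_apply_bcontfun
  define q where "q = \<bar>s\<bar> * H"
  define f where "f = exp_density w"
  have f: "f \<in> densities" by (simp add: f_def exp_density_in_densities)
  define \<kappa> where "\<kappa> = shift_log_mgf (- s) h f"
  have sh: "\<bar>s * h x\<bar> \<le> q" for x unfolding q_def abs_mult by (intro mult_left_mono h) simp
  have sh': "- q \<le> s * h x" "s * h x \<le> q" for x using sh[of x] by linarith+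
  have "(\<integral>x. exp (- q) * f x \<partial>leb01) \<le> (\<integral>x. exp (- (- s * h x)) * f x \<partial>leb01)"
    by (rule integral_density_mono[OF f]) (use sh' in \<open>auto intro!: continuous_intros cont\<close>)
  moreover have "(\<integral>x. exp (- (- s * h x)) * f x \<partial>leb01) \<le> (\<integral>x. exp q * f x \<partial>leb01)"
    by (rule integral_density_mono[OF f]) (use sh' in \<open>auto intro!: continuous_intros cont\<close>)
  ultimately have b: "exp (- q) \<le> (\<integral>x. exp (- (- s * h x)) * f x \<partial>leb01)" "(\<integral>x. exp (- (- s * h x)) * f x \<partial>leb01) \<le> exp q"
    using densityD(2)[OF f] by simp_all
  have bp: "0 < (\<integral>x. exp (- (- s * h x)) * f x \<partial>leb01)" by (rule less_le_trans[OF exp_gt_zero b(1)])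
  have \<kappa>: "- q \<le> \<kappa>" "\<kappa> \<le> q"
    using ln_mono[OF b(1) exp_gt_zero] ln_mono[OF b(2) bp] by (simp_all add: \<kappa>_def shift_log_mgf_def)
  have fs: "exp_density (w + s *\<^sub>R h) x = f x * exp (s * h x - \<kappa>)" for x
  proof -
    have "ln (exp_density (w + s *\<^sub>R h) x) = ln (f x) + (s * h x - \<kappa>)"
      using ln_exp_density_shift[of w "- s" h x] by (simp add: f_def \<kappa>_def)
    then have "exp (ln (exp_density (w + s *\<^sub>R h) x)) = exp (ln (f x)) * exp (s * h x - \<kappa>)" by (simp add: exp_add)
    then show ?thesis using exp_density_pos[of _ x] by (simp add: f_def)
  qed
  have d: "\<bar>exp_density (w + s *\<^sub>R h) x - f x\<bar> \<le> 4 * q * f x" for x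
  proof -
    define v where "v = s * h x - \<kappa>"
    have v: "\<bar>v\<bar> \<le> 2 * q" using sh'[of x] \<kappa> unfolding v_def by linarith
    have v2: "\<bar>v\<bar> \<le> 1 / 2" using v s by (simp add: q_def)
    have "v\<^sup>2 \<le> \<bar>v\<bar>" using v2 mult_left_mono[of "\<bar>v\<bar>" 1 "\<bar>v\<bar>"] by (simp add: power2_eq_square)
    then have "\<bar>exp v - 1\<bar> \<le> 2 * \<bar>v\<bar>" using exp_taylor_bounds(1)[OF v2] exp_ge_add_one_self[of v] by linarith
    then have "\<bar>exp v - 1\<bar> \<le> 4 * q" using v by linarith
    then have "\<bar>exp v - 1\<bar> * f x \<le> 4 * q * f x" using densityD(1)[OF f] by (rule mult_right_mono)
    moreover have "exp_density (w + s *\<^sub>R h) x - f x = (exp v - 1) * f x" unfolding fs v_def by (simp add: algebra_simps)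
    ultimately show ?thesis using densityD(1)[OF f, of x] by (simp add: abs_mult)
  qed
  have "l1_err f0 (w + s *\<^sub>R h) \<le> (\<integral>x. \<bar>f x - f0 x\<bar> + 4 * q * f x \<partial>leb01)"
    unfolding l1_err_def
  proof (intro integral_mono integrable_leb01 continuous_intros cont)
    fix x
    show "\<bar>exp_density (w + s *\<^sub>R h) x - f0 x\<bar> \<le> \<bar>f x - f0 x\<bar> + 4 * q * f x"
      using d[of x] by linarith
  qed
  also have "\<dots> = l1_err f0 w + 4 * q"
    using densityD[OF f] by (simp add: l1_err_def f_def integrable_leb01 continuous_intros cont)
  finally show ?thesis by (simp add: q_def)
qed

text \<open>Chernoff's bound for the Gaussian variable L. The additional tilt \<open>b\<close> is
  left free because it will grow like n \<alpha> e^2, so that the tail beats the mean inverse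
  evidence.\<close>

lemma representer_tail:
  fixes W :: "'w \<Rightarrow> C01"
  assumes W: "centered_gaussian_element M W" and L: "rkhs_representer M W h L" and b: "0 \<le> b"
  shows "(\<integral>\<^sup>+\<omega>. ennreal (exp \<bar>s * L \<omega>\<bar>) * indicator {\<omega>. \<delta> < \<bar>s * L \<omega>\<bar>} \<omega> \<partial>M)
    \<le> ennreal (2 * exp ((b + 1)\<^sup>2 * (s\<^sup>2 * (\<integral>\<omega>. (L \<omega>)\<^sup>2 \<partial>M)) / 2 - b * \<delta>))"
proof -
  have [measurable]: "L \<in> borel_measurable M" using L by (auto simp: rkhs_representer_def)
  define S where "S = (\<integral>\<omega>. (L \<omega>)\<^sup>2 \<partial>M)"
  define v where "v = (b + 1) * s"
  have I: "(\<integral>\<^sup>+\<omega>. ennreal (exp (u * L \<omega>)) \<partial>M) = ennreal (exp (u\<^sup>2 * S / 2))" for u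
    using nn_integral_exp_representer[OF W L bounded_linear_zero, of u] by (simp add: S_def)
  have "(\<integral>\<^sup>+\<omega>. ennreal (exp \<bar>s * L \<omega>\<bar>) * indicator {\<omega>. \<delta> < \<bar>s * L \<omega>\<bar>} \<omega> \<partial>M)
    \<le> (\<integral>\<^sup>+\<omega>. ennreal (exp (- b * \<delta>)) * (ennreal (exp (v * L \<omega>)) + ennreal (exp (- v * L \<omega>))) \<partial>M)"
  proof (rule nn_integral_mono)
    fix \<omega>
    show "ennreal (exp \<bar>s * L \<omega>\<bar>) * indicator {\<omega>. \<delta> < \<bar>s * L \<omega>\<bar>} \<omega>
      \<le> ennreal (exp (- b * \<delta>)) * (ennreal (exp (v * L \<omega>)) + ennreal (exp (- v * L \<omega>)))"
    proof (cases "\<delta> < \<bar>s * L \<omega>\<bar>")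
      case True
      define x where "x = s * L \<omega>"
      have "b * \<delta> \<le> b * \<bar>x\<bar>" using True b by (intro mult_left_mono) (auto simp: x_def)
      then have "exp \<bar>x\<bar> \<le> exp (- b * \<delta>) * exp ((b + 1) * \<bar>x\<bar>)"
        unfolding exp_add[symmetric] by (simp add: algebra_simps)
      also have "exp ((b + 1) * \<bar>x\<bar>) \<le> exp ((b + 1) * x) + exp (- ((b + 1) * x))"
        by (cases "x \<ge> 0") simp_all
      finally have "exp \<bar>x\<bar> \<le> exp (- b * \<delta>) * (exp (v * L \<omega>) + exp (- v * L \<omega>))"
        by (simp add: x_def v_def mult.assoc mult_left_mono)
      from ennreal_leI[OF this] show ?thesis using True by (simp add: x_def ennreal_mult)
    qed simp
  qed
  also have "\<dots> = ennreal (exp (- b * \<delta>)) * (ennreal (exp (v\<^sup>2 * S / 2)) + ennreal (exp ((- v)\<^sup>2 * S / 2)))"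
    unfolding I[symmetric] by (subst nn_integral_cmult) (auto simp: nn_integral_add)
  also have "\<dots> = ennreal (exp (- b * \<delta>) * (2 * exp (v\<^sup>2 * S / 2)))"
    by (simp add: ennreal_mult[symmetric] ennreal_plus[symmetric] del: ennreal_plus)
  also have "exp (- b * \<delta>) * (2 * exp (v\<^sup>2 * S / 2)) = 2 * exp ((b + 1)\<^sup>2 * (s\<^sup>2 * S) / 2 - b * \<delta>)"
  proof -
    have "v\<^sup>2 * S / 2 = (b + 1)\<^sup>2 * (s\<^sup>2 * S) / 2" by (simp add: v_def power_mult_distrib)
    moreover have "exp (- b * \<delta>) * exp (v\<^sup>2 * S / 2) = exp (v\<^sup>2 * S / 2 - b * \<delta>)"
      unfolding exp_add[symmetric] by simp
    ultimately show ?thesis by simp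
  qed
  finally show ?thesis by (simp add: S_def)
qed

lemma prob_space_posterior_elem:
  assumes M: "prob_space M" and W [measurable]: "W \<in> borel_measurable M"
    and fin: "evidence M W \<alpha> f0 n y \<noteq> \<infinity>"
  shows "prob_space (posterior_elem M W \<alpha> f0 n y)"
proof (rule prob_spaceI)
  have "emeasure (posterior_elem M W \<alpha> f0 n y) (space (posterior_elem M W \<alpha> f0 n y))
      = (\<integral>\<^sup>+\<omega>. 1 \<partial>posterior_elem M W \<alpha> f0 n y)" by simp
  also have "\<dots> = evidence M W \<alpha> f0 n y * (1 / evidence M W \<alpha> f0 n y)"
    by (subst nn_integral_posterior_elem[OF W]) (simp_all add: evidence_def)
  also have "\<dots> = 1"
    using fin evidence_nonzero[OF M W, of \<alpha> f0 n y] by (simp add: ennreal_times_divide ennreal_divide_self less_top)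
  finally show "emeasure (posterior_elem M W \<alpha> f0 n y) (space (posterior_elem M W \<alpha> f0 n y)) = 1" .
qed

lemma space_posterior_elem [simp]: "space (posterior_elem M W \<alpha> f0 n y) = space M"
  by (simp add: posterior_elem_def)

lemma sets_posterior_elem [simp, measurable_cong]: "sets (posterior_elem M W \<alpha> f0 n y) = sets M"
  by (simp add: posterior_elem_def)

text \<open>The mass hypothesis concerns the ball of radius \<open>e\<close> while the Laplace transform is restricted to
  radius \<open>2 e\<close>: the shift maps the smaller ball into the larger one, whence the lower bound.\<close>

lemma laplace_sandwich:
  fixes W :: "'w \<Rightarrow> C01" and h p f0 :: C01
  assumes W: "centered_gaussian_element M W" and L: "rkhs_representer M W h L"
    and fin: "evidence M W \<alpha> f0 n y \<noteq> \<infinity>"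
    and exponent: "\<And>w. l1_err f0 w \<le> 2 * e \<Longrightarrow> \<bar>t * lin_stat p m n y w
      + \<alpha> * (s * (\<Sum>i<n. h (y i)) + real n * shift_log_mgf s h (exp_density w)) - v\<bar> \<le> 2 * \<delta>"
    and shift: "\<And>w. l1_err f0 w \<le> e \<Longrightarrow> l1_err f0 (w + s *\<^sub>R h) \<le> 2 * e"
    and S: "s\<^sup>2 * (\<integral>\<omega>. (L \<omega>)\<^sup>2 \<partial>M) \<le> 2 * \<delta>" and \<delta>: "0 \<le> \<delta>"
    and tail: "(\<integral>\<^sup>+\<omega>. ennreal (exp \<bar>s * L \<omega>\<bar>) * indicator {\<omega>. \<delta> < \<bar>s * L \<omega>\<bar>} \<omega> \<partial>posterior_elem M W \<alpha> f0 n y) \<le> ennreal \<delta>"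
    and mass: "ennreal (1 - \<delta>) \<le> emeasure (posterior_elem M W \<alpha> f0 n y) {\<omega> \<in> space M. l1_err f0 (W \<omega>) \<le> e}"
  shows "(\<integral>\<^sup>+\<omega>. ennreal (exp (t * lin_stat p m n y (W \<omega>))) * indicator {\<omega>. l1_err f0 (W \<omega>) \<le> 2 * e} \<omega> \<partial>posterior_elem M W \<alpha> f0 n y)
      \<le> ennreal (exp (v + 2 * \<delta>) * (exp \<delta> + \<delta>))" (is "?Lap \<le> _")
    and "ennreal (exp (v - 4 * \<delta>) * (1 - 2 * \<delta>))
      \<le> (\<integral>\<^sup>+\<omega>. ennreal (exp (t * lin_stat p m n y (W \<omega>))) * indicator {\<omega>. l1_err f0 (W \<omega>) \<le> 2 * e} \<omega> \<partial>posterior_elem M W \<alpha> f0 n y)"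
proof -
  have M: "prob_space M" and Wm [measurable]: "W \<in> borel_measurable M"
    using W unfolding centered_gaussian_element_def by auto
  interpret prob_space M by (rule M)
  have Lm [measurable]: "L \<in> borel_measurable M" using L by (auto simp: rkhs_representer_def)
  define P where "P = posterior_elem M W \<alpha> f0 n y"
  interpret P: prob_space P unfolding P_def by (rule prob_space_posterior_elem[OF M Wm fin])
  have [measurable_cong]: "sets P = sets M" by (simp add: P_def)
  define D where "D = 1 / evidence M W \<alpha> f0 n y"
  define G where "G = lik_ratio \<alpha> f0 n y"
  have [measurable]: "G \<in> borel_measurable borel" unfolding G_def by measurable
  define U where "U = {w. l1_err f0 w \<le> 2 * e}"
  have Um [measurable]: "U \<in> sets borel" unfolding U_def by measurable
  have nnP: "(\<integral>\<^sup>+\<omega>. k \<omega> \<partial>P) = (\<integral>\<^sup>+\<omega>. k \<omega> * ennreal (G (W \<omega>)) \<partial>M) * D" if "k \<in> borel_measurable M" for k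
    unfolding P_def D_def G_def by (rule nn_integral_posterior_elem[OF Wm that])
  define S' where "S' = s\<^sup>2 * (\<integral>\<omega>. (L \<omega>)\<^sup>2 \<partial>M)"
  have S'0: "0 \<le> S'" by (simp add: S'_def)
  have addsh: "(\<lambda>w::C01. w + s *\<^sub>R h) \<in> borel_measurable borel"
    by (intro borel_measurable_continuous_onI continuous_intros)
  have subsh: "(\<lambda>w::C01. w - s *\<^sub>R h) \<in> borel_measurable borel"
    by (intro borel_measurable_continuous_onI continuous_intros)
  have Ush [measurable]: "(\<lambda>w. indicator U (w + s *\<^sub>R h) :: ennreal) \<in> borel_measurable borel"
    by (rule measurable_compose[OF addsh]) measurable
  have Gsh [measurable]: "(\<lambda>w. G (w - s *\<^sub>R h)) \<in> borel_measurable borel"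
    by (rule measurable_compose[OF subsh]) measurable
  define J where "J = (\<integral>\<^sup>+\<omega>. indicator U (W \<omega>) * ennreal (G (W \<omega> - s *\<^sub>R h)) \<partial>M)"
  \<comment> \<open>Cameron-Martin with -s h takes the shift out of the likelihood; in exchange the
    localising set is shifted and the weight appears.\<close>
  have cm: "J = (\<integral>\<^sup>+\<omega>. indicator U (W \<omega> + s *\<^sub>R h) * ennreal (exp (- (s * L \<omega>) - S' / 2)) * ennreal (G (W \<omega>)) \<partial>M)"
  proof -
    have "(\<lambda>w. indicator U (w + s *\<^sub>R h) * ennreal (G w)) \<in> borel_measurable borel" by measurable
    from cameron_martin[OF W rkhs_representer_scale[OF L Wm, of "- s"] this]
    show ?thesis by (simp add: J_def S'_def power_mult_distrib mult_ac)
  qed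
  define J' where "J' = (\<integral>\<^sup>+\<omega>. indicator U (W \<omega> + s *\<^sub>R h) * ennreal (exp (- (s * L \<omega>) - S' / 2)) \<partial>P)"
  have WUsh [measurable]: "(\<lambda>\<omega>. indicator U (W \<omega> + s *\<^sub>R h) :: ennreal) \<in> borel_measurable M"
    by (rule measurable_compose[OF Wm Ush])
  have J'D: "J * D = J'" unfolding J'_def cm by (subst nnP) measurable
  define K where "K = (\<integral>\<^sup>+\<omega>. ennreal (exp \<bar>s * L \<omega>\<bar>) * indicator {\<omega>. \<delta> < \<bar>s * L \<omega>\<bar>} \<omega> \<partial>P)"
  have K: "K \<le> ennreal \<delta>" using tail by (simp add: K_def P_def)
  have [measurable]: "(\<lambda>\<omega>. indicator {\<omega>. \<delta> < \<bar>s * L \<omega>\<bar>} \<omega> :: ennreal) \<in> borel_measurable M"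
  proof -
    have "(\<lambda>\<omega>. indicator {\<omega>. \<delta> < \<bar>s * L \<omega>\<bar>} \<omega> :: ennreal) = (\<lambda>\<omega>. if \<delta> < \<bar>s * L \<omega>\<bar> then 1 else 0)"
      by (auto simp: indicator_def)
    then show ?thesis by simp
  qed
  have WU [measurable]: "(\<lambda>\<omega>. indicator {\<omega>. l1_err f0 (W \<omega>) \<le> 2 * e} \<omega> :: ennreal) \<in> borel_measurable M"
  proof -
    have "(\<lambda>\<omega>. indicator {\<omega>. l1_err f0 (W \<omega>) \<le> 2 * e} \<omega> :: ennreal) = (\<lambda>\<omega>. if l1_err f0 (W \<omega>) \<le> 2 * e then 1 else 0)"
      by (auto simp: indicator_def)
    then show ?thesis by simp
  qed
  have lap: "?Lap = (\<integral>\<^sup>+\<omega>. ennreal (exp (t * lin_stat p m n y (W \<omega>)) * G (W \<omega>)) * indicator U (W \<omega>) \<partial>M) * D"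
  proof -
    have "?Lap = (\<integral>\<^sup>+\<omega>. ennreal (exp (t * lin_stat p m n y (W \<omega>))) * indicator {\<omega>. l1_err f0 (W \<omega>) \<le> 2 * e} \<omega> * ennreal (G (W \<omega>)) \<partial>M) * D"
      unfolding P_def[symmetric] by (rule nnP) measurable
    also have "(\<lambda>\<omega>. ennreal (exp (t * lin_stat p m n y (W \<omega>))) * indicator {\<omega>. l1_err f0 (W \<omega>) \<le> 2 * e} \<omega> * ennreal (G (W \<omega>)))
      = (\<lambda>\<omega>. ennreal (exp (t * lin_stat p m n y (W \<omega>)) * G (W \<omega>)) * indicator U (W \<omega>))"
      by (auto simp: fun_eq_iff U_def indicator_def ennreal_mult G_def lik_ratio_pos less_imp_le)
    finally show ?thesis .
  qed
  define E where "E w = t * lin_stat p m n y w + \<alpha> * (s * (\<Sum>i<n. h (y i)) + real n * shift_log_mgf s h (exp_density w))" for w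
  \<comment> \<open>By \<open>lik_ratio_shift\<close> the tilted likelihood is the shifted
    likelihood times exp (E w), and E is within 2 \<delta> of v on \<open>U\<close>.\<close>
  have tilt: "exp (t * lin_stat p m n y w) * G w = exp (E w) * G (w - s *\<^sub>R h)" for w
    unfolding G_def lik_ratio_shift[of \<alpha> f0 n y w s h] E_def by (simp add: exp_add)
  have Eb: "v - 2 * \<delta> \<le> E w" "E w \<le> v + 2 * \<delta>" if "w \<in> U" for w
    using exponent[of w] that unfolding U_def E_def by (auto simp: abs_le_iff)
  have G0: "0 \<le> G w" for w by (simp add: G_def lik_ratio_pos less_imp_le)
  have up1: "?Lap \<le> ennreal (exp (v + 2 * \<delta>)) * J'"
  proof -
    have "?Lap \<le> (\<integral>\<^sup>+\<omega>. ennreal (exp (v + 2 * \<delta>)) * (indicator U (W \<omega>) * ennreal (G (W \<omega> - s *\<^sub>R h))) \<partial>M) * D"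
      unfolding lap
    proof (intro mult_right_mono nn_integral_mono)
      fix \<omega>
      show "ennreal (exp (t * lin_stat p m n y (W \<omega>)) * G (W \<omega>)) * indicator U (W \<omega>)
          \<le> ennreal (exp (v + 2 * \<delta>)) * (indicator U (W \<omega>) * ennreal (G (W \<omega> - s *\<^sub>R h)))"
        using Eb(2)[of "W \<omega>"] G0 unfolding tilt
        by (auto simp: indicator_def ennreal_mult[symmetric] intro!: ennreal_leI mult_right_mono)
    qed simp
    also have "\<dots> = ennreal (exp (v + 2 * \<delta>)) * (J * D)"
      unfolding J_def by (subst nn_integral_cmult) (auto simp: mult.assoc intro!: measurable_compose[OF Wm Gsh])
    finally show ?thesis unfolding J'D .
  qed
  have lo1: "ennreal (exp (v - 2 * \<delta>)) * J' \<le> ?Lap"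
  proof -
    have "ennreal (exp (v - 2 * \<delta>)) * (J * D) = (\<integral>\<^sup>+\<omega>. ennreal (exp (v - 2 * \<delta>)) * (indicator U (W \<omega>) * ennreal (G (W \<omega> - s *\<^sub>R h))) \<partial>M) * D"
      unfolding J_def by (subst nn_integral_cmult) (auto simp: mult.assoc intro!: measurable_compose[OF Wm Gsh])
    also have "\<dots> \<le> ?Lap"
      unfolding lap
    proof (intro mult_right_mono nn_integral_mono)
      fix \<omega>
      show "ennreal (exp (v - 2 * \<delta>)) * (indicator U (W \<omega>) * ennreal (G (W \<omega> - s *\<^sub>R h)))
          \<le> ennreal (exp (t * lin_stat p m n y (W \<omega>)) * G (W \<omega>)) * indicator U (W \<omega>)"
        using Eb(1)[of "W \<omega>"] G0 unfolding tilt
        by (auto simp: indicator_def ennreal_mult[symmetric] intro!: ennreal_leI mult_right_mono)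
    qed simp
    finally show ?thesis unfolding J'D .
  qed
  \<comment> \<open>Split at |s L| = \<delta>: below it the weight is at most exp \<delta>, above it
    the posterior tail bound takes over.\<close>
  have "J' \<le> (\<integral>\<^sup>+\<omega>. ennreal (exp \<delta>) + ennreal (exp \<bar>s * L \<omega>\<bar>) * indicator {\<omega>. \<delta> < \<bar>s * L \<omega>\<bar>} \<omega> \<partial>P)"
    unfolding J'_def
  proof (rule nn_integral_mono)
    fix \<omega>
    have "exp (- (s * L \<omega>) - S' / 2) \<le> exp \<bar>s * L \<omega>\<bar>" using S'0 by simp
    then show "indicator U (W \<omega> + s *\<^sub>R h) * ennreal (exp (- (s * L \<omega>) - S' / 2))
        \<le> ennreal (exp \<delta>) + ennreal (exp \<bar>s * L \<omega>\<bar>) * indicator {\<omega>. \<delta> < \<bar>s * L \<omega>\<bar>} \<omega>"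
      by (auto simp: indicator_def intro!: ennreal_leI add_increasing intro: order_trans)
  qed
  also have "\<dots> = ennreal (exp \<delta>) + K"
    unfolding K_def by (subst nn_integral_add) (auto simp: P.emeasure_space_1)
  also have "\<dots> \<le> ennreal (exp \<delta>) + ennreal \<delta>" by (intro add_left_mono K)
  finally have J'up: "J' \<le> ennreal (exp \<delta> + \<delta>)" using \<delta> by simp
  show "?Lap \<le> ennreal (exp (v + 2 * \<delta>) * (exp \<delta> + \<delta>))"
    using order_trans[OF up1 mult_left_mono[OF J'up]] \<delta> by (simp add: ennreal_mult)
  have "ennreal (1 - \<delta>) \<le> emeasure P {\<omega> \<in> space M. l1_err f0 (W \<omega>) \<le> e}" using mass by (simp add: P_def)
  also have "\<dots> = (\<integral>\<^sup>+\<omega>. indicator {\<omega> \<in> space M. l1_err f0 (W \<omega>) \<le> e} \<omega> \<partial>P)"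
    by (rule nn_integral_indicator[symmetric]) measurable
  also have "\<dots> \<le> (\<integral>\<^sup>+\<omega>. ennreal (exp (2 * \<delta>)) * (indicator U (W \<omega> + s *\<^sub>R h) * ennreal (exp (- (s * L \<omega>) - S' / 2)))
      + ennreal (exp \<bar>s * L \<omega>\<bar>) * indicator {\<omega>. \<delta> < \<bar>s * L \<omega>\<bar>} \<omega> \<partial>P)"
  proof (rule nn_integral_mono)
    fix \<omega>
    show "indicator {\<omega> \<in> space M. l1_err f0 (W \<omega>) \<le> e} \<omega> \<le> ennreal (exp (2 * \<delta>)) * (indicator U (W \<omega> + s *\<^sub>R h) * ennreal (exp (- (s * L \<omega>) - S' / 2)))
      + ennreal (exp \<bar>s * L \<omega>\<bar>) * indicator {\<omega>. \<delta> < \<bar>s * L \<omega>\<bar>} \<omega>"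
    proof (cases "\<delta> < \<bar>s * L \<omega>\<bar>")
      case True
      have "1 \<le> ennreal (exp \<bar>s * L \<omega>\<bar>)" by (simp add: ennreal_1[symmetric] del: ennreal_1)
      then have "1 \<le> X + ennreal (exp \<bar>s * L \<omega>\<bar>)" for X by (rule add_increasing[OF zero_le])
      moreover have "indicator {\<omega> \<in> space M. l1_err f0 (W \<omega>) \<le> e} \<omega> \<le> (1 :: ennreal)" by (auto simp: indicator_def)
      ultimately show ?thesis using True by (auto intro: order_trans[of _ 1])
    next
      case False
      \<comment> \<open>Off the tail the weight is at least exp (- 2 \<delta>): one \<delta> from s
        L and one from half the variance.\<close>
      have "0 \<le> 2 * \<delta> + (- (s * L \<omega>) - S' / 2)" using False S unfolding S'_def by linarith
      then have "1 \<le> exp (2 * \<delta>) * exp (- (s * L \<omega>) - S' / 2)" unfolding exp_add[symmetric] by simp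
      then have "1 \<le> ennreal (exp (2 * \<delta>)) * ennreal (exp (- (s * L \<omega>) - S' / 2))"
        by (simp add: ennreal_mult[symmetric] ennreal_1[symmetric] del: ennreal_1)
      then show ?thesis using shift[of "W \<omega>"] False by (auto simp: indicator_def U_def)
    qed
  qed
  also have "\<dots> = ennreal (exp (2 * \<delta>)) * J' + K"
    unfolding K_def J'_def by (subst nn_integral_add) (auto simp: nn_integral_cmult)
  also have "\<dots> \<le> ennreal (exp (2 * \<delta>)) * J' + ennreal \<delta>" by (intro add_left_mono K)
  finally have le: "ennreal (1 - \<delta>) \<le> ennreal (exp (2 * \<delta>)) * J' + ennreal \<delta>" .
  have "ennreal (1 - 2 * \<delta>) \<le> ennreal (exp (2 * \<delta>)) * J'"
  proof -
    have "ennreal (1 - 2 * \<delta>) = ennreal (1 - \<delta>) - ennreal \<delta>" using \<delta> by (simp add: ennreal_minus)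
    also have "\<dots> \<le> (ennreal (exp (2 * \<delta>)) * J' + ennreal \<delta>) - ennreal \<delta>" by (rule ennreal_minus_mono[OF le]) simp
    finally show ?thesis by simp
  qed
  then have "ennreal (exp (v - 4 * \<delta>)) * ennreal (1 - 2 * \<delta>) \<le> ennreal (exp (v - 4 * \<delta>)) * (ennreal (exp (2 * \<delta>)) * J')"
    by (rule mult_left_mono) simp
  also have "\<dots> = ennreal (exp (v - 2 * \<delta>)) * J'"
    by (simp add: mult.assoc[symmetric] ennreal_mult[symmetric] exp_add[symmetric])
  also note lo1
  finally show "ennreal (exp (v - 4 * \<delta>) * (1 - 2 * \<delta>)) \<le> ?Lap" by (simp add: ennreal_mult')
qed

lemma measurable_evidence [measurable]:
  assumes M: "prob_space M" and W [measurable]: "W \<in> borel_measurable M"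
  shows "evidence M W \<alpha> f0 n \<in> borel_measurable (data_law f n)"
proof -
  interpret M: prob_space M by (rule M)
  note [measurable] = measurable_lik_ratio_pair[OF W]
  show ?thesis unfolding evidence_def by measurable
qed

text \<open>Numerator and inverse evidence are treated separately by Markov's inequality, with exp
  (36 a) as the exchange factor. The number 36 lies between the 34 = 32 + 2 in the mean inverse
  evidence and the decay 37 of \<open>k\<close>, so both rescaled means tend to 0.\<close>

lemma posterior_integral_small_whp:
  fixes W :: "'w \<Rightarrow> C01" and k :: "nat \<Rightarrow> 'w \<Rightarrow> ennreal"
  assumes M: "prob_space M" and W [measurable]: "W \<in> borel_measurable M"
    and f0: "f0 \<in> densities" and c: "0 < c" "\<And>x. c \<le> apply_bcontfun f0 x"
    and \<alpha>: "\<And>n. n \<ge> 1 \<Longrightarrow> 0 < \<alpha> n \<and> \<alpha> n \<le> 1"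
    and e: "\<forall>\<^sub>F n in sequentially. 0 < e n \<and> e n \<le> 1 / 8"
    and a: "\<And>n. a n = real n * \<alpha> n * (e n)\<^sup>2" and atop: "filterlim a at_top sequentially"
    and mass: "\<forall>\<^sub>F n in sequentially. ennreal (exp (- (2 * a n + 1))) \<le>
      emeasure M {\<omega> \<in> space M. norm (W \<omega> - log_density f0) \<le> 2 * e n}"
    and k [measurable]: "\<And>n. k n \<in> borel_measurable M"
    and kb: "\<forall>\<^sub>F n in sequentially. (\<integral>\<^sup>+\<omega>. k n \<omega> \<partial>M) \<le> ennreal (2 * exp (- (37 * a n)))"
    and \<eta>: "0 < \<eta>"
  shows "whp (data_law f0) (\<lambda>n y. (\<integral>\<^sup>+\<omega>. k n \<omega> \<partial>posterior_elem M W (\<alpha> n) f0 n y) \<le> ennreal \<eta>)"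
proof -
  interpret M: prob_space M by (rule M)
  note [measurable] = measurable_lik_ratio_pair[OF W] measurable_evidence[OF M W]
  define N where "N n y = (\<integral>\<^sup>+\<omega>. k n \<omega> * ennreal (lik_ratio (\<alpha> n) f0 n y (W \<omega>)) \<partial>M)" for n y
  define D where "D n y = 1 / evidence M W (\<alpha> n) f0 n y" for n y
  have Nm [measurable]: "N n \<in> borel_measurable (data_law f0 n)" for n unfolding N_def by measurable
  have Dm [measurable]: "D n \<in> borel_measurable (data_law f0 n)" for n unfolding D_def by measurable
  have lim: "(\<lambda>n. ennreal (C * exp (- (d * a n)))) \<longlonglongrightarrow> 0" if "d > 0" for C d
  proof -
    have "filterlim (\<lambda>n. d * a n) at_top sequentially"
      by (rule filterlim_tendsto_pos_mult_at_top[OF tendsto_const that atop])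
    then have "filterlim (\<lambda>n. - (d * a n)) at_bot sequentially" by (simp add: filterlim_uminus_at_bot)
    then have "(\<lambda>n. exp (- (d * a n))) \<longlonglongrightarrow> 0" by (rule filterlim_compose[OF exp_at_bot])
    from tendsto_ennrealI[OF tendsto_mult_right_zero[OF this, of C]] show ?thesis by simp
  qed
  have w1: "whp (data_law f0) (\<lambda>n y. N n y * ennreal (exp (36 * a n)) \<le> ennreal \<eta>)"
  proof (rule whp_Markov[OF _ _ lim[of 1 2] \<eta>])
    show "(\<lambda>y. N n y * ennreal (exp (36 * a n))) \<in> borel_measurable (data_law f0 n)" for n by measurable
    show "\<forall>\<^sub>F n in sequentially. (\<integral>\<^sup>+y. N n y * ennreal (exp (36 * a n)) \<partial>data_law f0 n) \<le> ennreal (2 * exp (- (1 * a n)))"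
      using kb eventually_ge_at_top[of 1]
    proof eventually_elim
      case (elim n)
      have "(\<integral>\<^sup>+y. N n y * ennreal (exp (36 * a n)) \<partial>data_law f0 n) = (\<integral>\<^sup>+y. N n y \<partial>data_law f0 n) * ennreal (exp (36 * a n))"
        by (rule nn_integral_multc) measurable
      also have "\<dots> \<le> ennreal (2 * exp (- (37 * a n))) * ennreal (exp (36 * a n))"
        unfolding N_def using \<alpha>[OF elim(2)]
        by (intro mult_right_mono order_trans[OF expected_weighted_lik_ratio_le[OF M W f0 c _ _ k] elim(1)]) auto
      also have "\<dots> = ennreal (2 * exp (- (1 * a n)))"
        by (simp add: ennreal_mult[symmetric] exp_add[symmetric])
      finally show ?case .
    qed
  qed simp
  have w2: "whp (data_law f0) (\<lambda>n y. D n y * ennreal (exp (- (36 * a n))) \<le> ennreal 1)"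
  proof (rule whp_Markov[OF _ _ lim[of 2 "exp 1"]])
    show "(\<lambda>y. D n y * ennreal (exp (- (36 * a n)))) \<in> borel_measurable (data_law f0 n)" for n by measurable
    show "\<forall>\<^sub>F n in sequentially. (\<integral>\<^sup>+y. D n y * ennreal (exp (- (36 * a n))) \<partial>data_law f0 n) \<le> ennreal (exp 1 * exp (- (2 * a n)))"
      using e mass eventually_ge_at_top[of 1]
    proof eventually_elim
      case (elim n)
      have "(\<integral>\<^sup>+y. D n y * ennreal (exp (- (36 * a n))) \<partial>data_law f0 n) = (\<integral>\<^sup>+y. D n y \<partial>data_law f0 n) * ennreal (exp (- (36 * a n)))"
        by (rule nn_integral_multc) measurable
      also have "\<dots> \<le> ennreal (exp (32 * a n + (2 * a n + 1))) * ennreal (exp (- (36 * a n)))"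
        unfolding D_def a using elim \<alpha>[of n]
        by (intro mult_right_mono expected_inverse_evidence_le[OF M W f0 c]) (auto simp: a)
      also have "\<dots> = ennreal (exp 1 * exp (- (2 * a n)))"
        by (simp add: ennreal_mult[symmetric] exp_add[symmetric])
      finally show ?case .
    qed
  qed simp_all
  show ?thesis
  proof (rule whp_mono[OF whp_conj[OF w1 w2]], intro always_eventually allI ballI impI)
    fix n y
    assume le: "N n y * ennreal (exp (36 * a n)) \<le> ennreal \<eta> \<and> D n y * ennreal (exp (- (36 * a n))) \<le> ennreal 1"
    have "(\<integral>\<^sup>+\<omega>. k n \<omega> \<partial>posterior_elem M W (\<alpha> n) f0 n y) = N n y * D n y"
      unfolding N_def D_def by (rule nn_integral_posterior_elem[OF W k])
    also have "\<dots> = (N n y * D n y) * (ennreal (exp (36 * a n)) * ennreal (exp (- (36 * a n))))"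
      by (simp add: ennreal_mult[symmetric] exp_add[symmetric])
    also have "\<dots> = (N n y * ennreal (exp (36 * a n))) * (D n y * ennreal (exp (- (36 * a n))))"
      by (simp add: mult_ac)
    also have "\<dots> \<le> ennreal \<eta> * ennreal 1" using le by (intro mult_mono) auto
    finally show "(\<integral>\<^sup>+\<omega>. k n \<omega> \<partial>posterior_elem M W (\<alpha> n) f0 n y) \<le> ennreal \<eta>" by simp
  qed
qed

text \<open>Contrapositively, any positive posterior mass certifies finite evidence; this is how
  \<open>post\<close> is recognised as a probability measure for given data.\<close>

lemma emeasure_posterior_elem_infinite_evidence:
  assumes [measurable]: "W \<in> borel_measurable M" "B \<in> sets M"
    and "evidence M W \<alpha> f0 n y = \<infinity>"
  shows "emeasure (posterior_elem M W \<alpha> f0 n y) B = 0"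
  using assms(3) unfolding posterior_elem_def by (subst emeasure_density) auto

text \<open>The rate \<open>e\<close> is an enlargement of the rate of the theorem, so that $n \alpha_n e_n^2 \to \infty$
  holds also when \<open>W\<close> is degenerate.\<close>

locale bvm_setting =
  fixes M :: "'w measure" and W :: "'w \<Rightarrow> C01" and f0 p :: C01 and c :: real
    and \<alpha> e z :: "nat \<Rightarrow> real" and h :: "nat \<Rightarrow> C01"
  assumes W: "centered_gaussian_element M W"
    and f0: "f0 \<in> densities" and c: "0 < c" "\<And>x. c \<le> apply_bcontfun f0 x"
    and \<alpha>: "\<And>n. n \<ge> 1 \<Longrightarrow> 0 < \<alpha> n \<and> \<alpha> n \<le> 1"
    and m_top: "filterlim (\<lambda>n. real n * \<alpha> n) at_top sequentially"
    and e0: "e \<longlonglongrightarrow> 0" and e_pos: "\<And>n. n \<ge> 1 \<Longrightarrow> 0 < e n"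
    and root_top: "filterlim (\<lambda>n. sqrt (real n * \<alpha> n) * e n) at_top sequentially"
    and prior_mass: "\<And>n. n \<ge> 1 \<Longrightarrow> ennreal (exp (- (2 * (real n * \<alpha> n * (e n)\<^sup>2) + 1))) \<le>
      emeasure M {\<omega> \<in> space M. norm (W \<omega> - log_density f0) \<le> 2 * e n}"
    and p0: "(\<integral>x. p x * f0 x \<partial>leb01) = 0"
    and rep: "\<And>n. n \<ge> 1 \<Longrightarrow> \<exists>L. rkhs_representer M W (h n) L \<and> (\<integral>\<omega>. (L \<omega>)\<^sup>2 \<partial>M) \<le> real n * \<alpha> n * (z n)\<^sup>2"
    and approx: "\<And>n x. n \<ge> 1 \<Longrightarrow> \<bar>h n x - p x\<bar> \<le> z n"
    and z0: "z \<longlonglongrightarrow> 0"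
    and rate: "(\<lambda>n. sqrt (real n * \<alpha> n) * e n * z n) \<longlonglongrightarrow> 0"
begin

definition m :: "nat \<Rightarrow> real" where "m n = real n * \<alpha> n"

definition V :: real where "V = (\<integral>x. (p x)\<^sup>2 * f0 x \<partial>leb01)"

abbreviation post :: "nat \<Rightarrow> (nat \<Rightarrow> unit_interval) \<Rightarrow> 'w measure"
  where "post n y \<equiv> posterior_elem M W (\<alpha> n) f0 n y"

definition near :: "real \<Rightarrow> 'w set" where "near d = {\<omega> \<in> space M. l1_err f0 (W \<omega>) \<le> d}"

definition stat :: "nat \<Rightarrow> (nat \<Rightarrow> unit_interval) \<Rightarrow> 'w \<Rightarrow> real"
  where "stat n y \<omega> = lin_stat p (m n) n y (W \<omega>)"

definition laplace :: "nat \<Rightarrow> (nat \<Rightarrow> unit_interval) \<Rightarrow> real \<Rightarrow> ennreal"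
  where "laplace n y t = (\<integral>\<^sup>+\<omega>. ennreal (exp (t * stat n y \<omega>)) * indicator (near (2 * e n)) \<omega> \<partial>post n y)"

lemma prob_M: "prob_space M" and W_meas [measurable]: "W \<in> borel_measurable M"
  using W unfolding centered_gaussian_element_def by auto

lemma near_sets [measurable]: "near d \<in> sets M"
  unfolding near_def by measurable

lemma stat_meas [measurable]: "stat n y \<in> borel_measurable M"
  unfolding stat_def by measurable

lemma m_pos: "n \<ge> 1 \<Longrightarrow> 0 < m n" using \<alpha>[of n] by (simp add: m_def)

lemma sqrt_m_top: "filterlim (\<lambda>n. sqrt (m n)) at_top sequentially"
  unfolding m_def by (rule filterlim_compose[OF sqrt_at_top m_top])

lemma inv_sqrt_m: "(\<lambda>n. K / sqrt (m n)) \<longlonglongrightarrow> 0"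
  by (rule tendsto_divide_0[OF tendsto_const filterlim_at_top_imp_at_infinity[OF sqrt_m_top]])

text \<open>The deterministic sandwich applies eventually on the intersection of three events: small
  posterior tail of the representer, small empirical process at h - p, and posterior mass near
  \<open>f0\<close>. All other requirements concern deterministic sequences.\<close>

lemma laplace_whp:
  assumes mass: "\<And>\<delta>. 0 < \<delta> \<Longrightarrow> whp (data_law f0) (\<lambda>n y. ennreal (1 - \<delta>) \<le> emeasure (post n y) (near (e n)))"
    and \<delta>: "0 < \<delta>" "\<delta> < 1"
  shows "whp (data_law f0) (\<lambda>n y.
    ennreal (exp (t\<^sup>2 * V / 2 - 4 * \<delta>) * (1 - 2 * \<delta>)) \<le> laplace n y t \<and>
    laplace n y t \<le> ennreal (exp (t\<^sup>2 * V / 2 + 2 * \<delta>) * (exp \<delta> + \<delta>)))"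
proof -
  obtain C where C: "\<And>x. \<bar>p x\<bar> \<le> C" using norm_bounded[of p] by (metis real_norm_def)
  define L where "L n = (SOME L. rkhs_representer M W (h n) L \<and> (\<integral>\<omega>. (L \<omega>)\<^sup>2 \<partial>M) \<le> real n * \<alpha> n * (z n)\<^sup>2)" for n
  have L: "rkhs_representer M W (h n) (L n)" "(\<integral>\<omega>. (L n \<omega>)\<^sup>2 \<partial>M) \<le> m n * (z n)\<^sup>2" if "n \<ge> 1" for n
    using someI_ex[OF rep[OF that]] unfolding L_def[symmetric] m_def by auto
  define s where "s n = t / sqrt (m n)" for n
  have s2: "(s n)\<^sup>2 * m n = t\<^sup>2" if "n \<ge> 1" for n using m_pos[OF that] by (simp add: s_def power_divide)
  define a where "a n = real n * \<alpha> n * (e n)\<^sup>2" for n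
  have a_eq: "a n = (sqrt (m n) * e n)\<^sup>2" if "n \<ge> 1" for n
    using m_pos[OF that] by (simp add: a_def m_def power_mult_distrib)
  have atop: "filterlim a at_top sequentially"
  proof (rule filterlim_cong[THEN iffD1, OF refl refl])
    show "\<forall>\<^sub>F n in sequentially. (sqrt (m n) * e n)\<^sup>2 = a n"
      using eventually_ge_at_top[of 1] by eventually_elim (simp add: a_eq)
    show "filterlim (\<lambda>n. (sqrt (m n) * e n)\<^sup>2) at_top sequentially"
      using filterlim_pow_at_top[OF _ root_top, of 2] by (simp add: m_def)
  qed
  define k where "k n \<omega> = ennreal (exp \<bar>s n * L n \<omega>\<bar>) * indicator {\<omega>. \<delta> < \<bar>s n * L n \<omega>\<bar>} \<omega>" for n \<omega>
  have s0: "s \<longlonglongrightarrow> 0" unfolding s_def by (rule inv_sqrt_m)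
  have ev_s: "\<forall>\<^sub>F n in sequentially. \<bar>s n\<bar> * (2 * (C + 1)) < 1 / 2"
  proof -
    have "(\<lambda>n. \<bar>s n\<bar> * (2 * (C + 1))) \<longlonglongrightarrow> \<bar>0\<bar> * (2 * (C + 1))" by (intro tendsto_intros s0)
    then show ?thesis by (intro order_tendstoD(2)) auto
  qed
  \<comment> \<open>Rescaled, this says that the shift changes the L1 distance by at most e n, so
    radius e n is mapped into 2 e n.\<close>
  have ev_e: "\<forall>\<^sub>F n in sequentially. 4 * (\<bar>t\<bar> * (C + 1)) \<le> sqrt (m n) * e n"
    using root_top unfolding filterlim_at_top m_def by blast
  have ev_z: "\<forall>\<^sub>F n in sequentially. z n < 1" using order_tendstoD(2)[OF z0, of 1] by simp
  have ev_tz: "\<forall>\<^sub>F n in sequentially. t\<^sup>2 * (z n)\<^sup>2 < 2 * \<delta>"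
  proof -
    have "(\<lambda>n. t\<^sup>2 * (z n)\<^sup>2) \<longlonglongrightarrow> t\<^sup>2 * 0\<^sup>2" by (intro tendsto_intros z0)
    then show ?thesis using \<delta> by (intro order_tendstoD(2)) auto
  qed
  define rem where "rem n = \<bar>t\<bar> * (sqrt (m n) * (z n * (2 * e n))) + 2 * m n * (\<bar>s n\<bar> * (2 * (C + 1))) ^ 3
      + t\<^sup>2 / 2 * ((z n * (2 * C + 1) + C\<^sup>2 * (2 * e n)) + (C + 1) * (z n + C * (2 * e n)))" for n
  have ev_rem: "\<forall>\<^sub>F n in sequentially. rem n < \<delta>"
  proof -
    \<comment> \<open>The remainder in vanishing form: its first term is the rate condition, and the
      cubic term is of order 1 / sqrt m because m s^3 is.\<close>
    have "(\<lambda>n. 2 * \<bar>t\<bar> * (sqrt (real n * \<alpha> n) * e n * z n) + (2 * (\<bar>t\<bar> * (2 * (C + 1))) ^ 3) / sqrt (m n)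
      + t\<^sup>2 / 2 * ((z n * (2 * C + 1) + C\<^sup>2 * (2 * e n)) + (C + 1) * (z n + C * (2 * e n))))
      \<longlonglongrightarrow> 2 * \<bar>t\<bar> * 0 + 0 + t\<^sup>2 / 2 * ((0 * (2 * C + 1) + C\<^sup>2 * (2 * 0)) + (C + 1) * (0 + C * (2 * 0)))"
      by (intro tendsto_intros rate z0 e0 inv_sqrt_m)
    then have "\<forall>\<^sub>F n in sequentially. 2 * \<bar>t\<bar> * (sqrt (real n * \<alpha> n) * e n * z n) + (2 * (\<bar>t\<bar> * (2 * (C + 1))) ^ 3) / sqrt (m n)
      + t\<^sup>2 / 2 * ((z n * (2 * C + 1) + C\<^sup>2 * (2 * e n)) + (C + 1) * (z n + C * (2 * e n))) < \<delta>"
      using \<delta> by (intro order_tendstoD(2)) auto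
    then show ?thesis using eventually_ge_at_top[of 1]
    proof eventually_elim
      case (elim n)
      have mp: "0 < m n" using m_pos elim(2) .
      have "2 * m n * (\<bar>s n\<bar> * (2 * (C + 1))) ^ 3 = (2 * (\<bar>t\<bar> * (2 * (C + 1))) ^ 3) * (m n / sqrt (m n) ^ 3)"
        using mp by (simp add: s_def power_mult_distrib power_divide abs_mult)
      also have "m n / sqrt (m n) ^ 3 = 1 / sqrt (m n)"
        using mp by (simp add: power3_eq_cube)
      finally show ?case using elim(1) by (simp add: rem_def m_def mult_ac)
    qed
  qed
  have aln: "(\<lambda>n. (38 / \<delta> + 1)\<^sup>2 * t\<^sup>2 / 2 * (sqrt (real n * \<alpha> n) * e n * z n)\<^sup>2) \<longlonglongrightarrow> (38 / \<delta> + 1)\<^sup>2 * t\<^sup>2 / 2 * 0\<^sup>2"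
    by (intro tendsto_intros rate)
  have ev_az: "\<forall>\<^sub>F n in sequentially. (38 / \<delta> + 1)\<^sup>2 * t\<^sup>2 / 2 * (sqrt (real n * \<alpha> n) * e n * z n)\<^sup>2 < 1"
    by (rule order_tendstoD(2)[OF aln]) simp
  have ev_a: "\<forall>\<^sub>F n in sequentially. 1 \<le> a n" using atop unfolding filterlim_at_top by blast
  have kb: "\<forall>\<^sub>F n in sequentially. (\<integral>\<^sup>+\<omega>. k n \<omega> \<partial>M) \<le> ennreal (2 * exp (- (37 * a n)))"
    using ev_az ev_a eventually_ge_at_top[of 1]
  proof eventually_elim
    case (elim n)
    \<comment> \<open>The linear term b \<delta> then equals 38 a. The quadratic term is at most a
      since a z^2 tends to 0, and the required 37 a remains.\<close>
    define b where "b = 38 * a n / \<delta>"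
    have b0: "0 \<le> b" using elim \<delta> by (simp add: b_def)
    have bb: "b + 1 \<le> (38 / \<delta> + 1) * a n" using elim(2) by (simp add: b_def algebra_simps)
    have "(b + 1)\<^sup>2 * ((s n)\<^sup>2 * (\<integral>\<omega>. (L n \<omega>)\<^sup>2 \<partial>M)) / 2 \<le> ((38 / \<delta> + 1) * a n)\<^sup>2 * ((s n)\<^sup>2 * (m n * (z n)\<^sup>2)) / 2"
      using power_mono[OF bb, of 2] b0 mult_left_mono[OF L(2)[OF elim(3)], of "(s n)\<^sup>2"]
      by - (rule divide_right_mono[OF mult_mono], auto)
    also have "(s n)\<^sup>2 * (m n * (z n)\<^sup>2) = t\<^sup>2 * (z n)\<^sup>2" using s2[OF elim(3)] by (simp add: mult.assoc[symmetric])
    also have "((38 / \<delta> + 1) * a n)\<^sup>2 * (t\<^sup>2 * (z n)\<^sup>2) / 2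
        = a n * ((38 / \<delta> + 1)\<^sup>2 * t\<^sup>2 / 2 * (sqrt (real n * \<alpha> n) * e n * z n)\<^sup>2)"
    proof -
      have q: "(sqrt (real n * \<alpha> n) * e n * z n)\<^sup>2 = a n * (z n)\<^sup>2"
        unfolding a_eq[OF elim(3)] m_def by (simp add: power_mult_distrib)
      show ?thesis unfolding q by (simp add: power2_eq_square)
    qed
    also have "\<dots> \<le> a n * 1" using elim by (intro mult_left_mono) auto
    finally have "(b + 1)\<^sup>2 * ((s n)\<^sup>2 * (\<integral>\<omega>. (L n \<omega>)\<^sup>2 \<partial>M)) / 2 - b * \<delta> \<le> - (37 * a n)"
      using \<delta> by (simp add: b_def)
    then have "ennreal (2 * exp ((b + 1)\<^sup>2 * ((s n)\<^sup>2 * (\<integral>\<omega>. (L n \<omega>)\<^sup>2 \<partial>M)) / 2 - b * \<delta>)) \<le> ennreal (2 * exp (- (37 * a n)))"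
      by (intro ennreal_leI) simp
    then show ?case
      unfolding k_def by (rule order_trans[OF representer_tail[OF W L(1)[OF elim(3)] b0]])
  qed
  \<comment> \<open>At n = 0 nothing is known of the chosen \<open>L\<close>; zero takes its place
    to keep every index measurable.\<close>
  have km: "(if n \<ge> 1 then k n else (\<lambda>_. 0)) \<in> borel_measurable M" for n
  proof (cases "n \<ge> 1")
    case True
    then have [measurable]: "L n \<in> borel_measurable M" using L(1) by (auto simp: rkhs_representer_def)
    have "k n = (\<lambda>\<omega>. if \<delta> < \<bar>s n * L n \<omega>\<bar> then ennreal (exp \<bar>s n * L n \<omega>\<bar>) else 0)"
      by (auto simp: k_def indicator_def)
    also have "\<dots> \<in> borel_measurable M" by measurable
    finally show ?thesis using True by simp
  qed simp
  have tail: "whp (data_law f0) (\<lambda>n y. (\<integral>\<^sup>+\<omega>. (if n \<ge> 1 then k n else (\<lambda>_. 0)) \<omega> \<partial>post n y) \<le> ennreal \<delta>)"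
  proof (rule posterior_integral_small_whp[OF prob_M W_meas f0 c \<alpha> _ a_def atop _ km _ \<delta>(1)])
    show "\<forall>\<^sub>F n in sequentially. 0 < e n \<and> e n \<le> 1 / 8"
    proof -
      have "\<forall>\<^sub>F n in sequentially. e n < 1 / 8" by (rule order_tendstoD(2)[OF e0]) simp
      then show ?thesis using eventually_ge_at_top[of 1] by eventually_elim (simp add: e_pos)
    qed
    show "\<forall>\<^sub>F n in sequentially. ennreal (exp (- (2 * a n + 1))) \<le> emeasure M {\<omega> \<in> space M. norm (W \<omega> - log_density f0) \<le> 2 * e n}"
      using eventually_ge_at_top[of 1] unfolding a_def by eventually_elim (rule prior_mass)
    show "\<forall>\<^sub>F n in sequentially. (\<integral>\<^sup>+\<omega>. (if n \<ge> 1 then k n else (\<lambda>_. 0)) \<omega> \<partial>M) \<le> ennreal (2 * exp (- (37 * a n)))"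
      using kb eventually_ge_at_top[of 1] by eventually_elim simp
  qed
  have dev: "whp (data_law f0) (\<lambda>n y. \<bar>emp_dev f0 (m n) n (h n - p) y\<bar> \<le> \<delta> / (\<bar>t\<bar> + 1))"
  proof (rule whp_emp_dev_le[OF f0 _ _ z0])
    show "0 \<le> m n \<and> m n \<le> real n" if "n \<ge> 1" for n
      using \<alpha>[OF that] mult_left_mono[of "\<alpha> n" 1 "real n"] by (simp add: m_def)
    show "\<bar>apply_bcontfun (h n - p) x\<bar> \<le> z n" if "n \<ge> 1" for n x using approx[OF that, of x] by simp
  qed (use \<delta> in auto)
  show ?thesis
  proof (rule whp_mono[OF whp_conj[OF whp_conj[OF tail dev] mass[OF \<delta>(1)]]])
    show "\<forall>\<^sub>F n in sequentially. \<forall>y\<in>space (data_law f0 n).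
      ((\<integral>\<^sup>+\<omega>. (if n \<ge> 1 then k n else (\<lambda>_. 0)) \<omega> \<partial>post n y) \<le> ennreal \<delta> \<and>
        \<bar>emp_dev f0 (m n) n (h n - p) y\<bar> \<le> \<delta> / (\<bar>t\<bar> + 1)) \<and> ennreal (1 - \<delta>) \<le> emeasure (post n y) (near (e n)) \<longrightarrow>
      ennreal (exp (t\<^sup>2 * V / 2 - 4 * \<delta>) * (1 - 2 * \<delta>)) \<le> laplace n y t \<and>
      laplace n y t \<le> ennreal (exp (t\<^sup>2 * V / 2 + 2 * \<delta>) * (exp \<delta> + \<delta>))"
      using ev_s ev_e ev_z ev_tz ev_rem eventually_ge_at_top[of 1]
    proof (eventually_elim, intro ballI impI)
      fix n y
      assume sB: "\<bar>s n\<bar> * (2 * (C + 1)) < 1 / 2" and en: "4 * (\<bar>t\<bar> * (C + 1)) \<le> sqrt (m n) * e n"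
        and zn: "z n < 1" and tz: "t\<^sup>2 * (z n)\<^sup>2 < 2 * \<delta>" and remn: "rem n < \<delta>" and n: "1 \<le> n"
        and H: "((\<integral>\<^sup>+\<omega>. (if n \<ge> 1 then k n else (\<lambda>_. 0)) \<omega> \<partial>post n y) \<le> ennreal \<delta> \<and>
        \<bar>emp_dev f0 (m n) n (h n - p) y\<bar> \<le> \<delta> / (\<bar>t\<bar> + 1)) \<and> ennreal (1 - \<delta>) \<le> emeasure (post n y) (near (e n))"
      have fin: "evidence M W (\<alpha> n) f0 n y \<noteq> \<infinity>"
      proof
        assume "evidence M W (\<alpha> n) f0 n y = \<infinity>"
        from emeasure_posterior_elem_infinite_evidence[OF W_meas near_sets this] H \<delta> show False by auto
      qed
      have tR: "\<bar>t\<bar> * \<bar>emp_dev f0 (m n) n (h n - p) y\<bar> \<le> \<delta>"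
      proof -
        have "\<bar>t\<bar> * \<bar>emp_dev f0 (m n) n (h n - p) y\<bar> \<le> \<bar>t\<bar> * (\<delta> / (\<bar>t\<bar> + 1))" using H by (intro mult_left_mono) auto
        also have "\<dots> \<le> \<delta>" using \<delta> by (simp add: field_simps)
        finally show ?thesis .
      qed
      have hC: "\<bar>h n x\<bar> \<le> C + 1" for x using approx[OF n, of x] C[of x] zn by linarith
      have sh: "4 * (\<bar>s n\<bar> * (C + 1)) \<le> e n"
        using en m_pos[OF n] by (simp add: s_def field_simps)
      have lapeq: "laplace n y t = (\<integral>\<^sup>+\<omega>. ennreal (exp (t * lin_stat p (m n) n y (W \<omega>))) * indicator {\<omega>. l1_err f0 (W \<omega>) \<le> 2 * e n} \<omega> \<partial>post n y)"
        unfolding laplace_def stat_def near_def by (intro nn_integral_cong) (auto simp: indicator_def)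
      have exponent: "\<bar>t * lin_stat p (m n) n y w + \<alpha> n * (s n * (\<Sum>i<n. h n (y i)) + real n * shift_log_mgf (s n) (h n) (exp_density w)) - t\<^sup>2 * V / 2\<bar> \<le> 2 * \<delta>"
        if w: "l1_err f0 w \<le> 2 * e n" for w
      proof -
        have "\<bar>t * lin_stat p (m n) n y w + \<alpha> n * (s n * (\<Sum>i<n. h n (y i)) + real n * shift_log_mgf (s n) (h n) (exp_density w)) - t\<^sup>2 * V / 2\<bar>
          \<le> \<bar>t\<bar> * \<bar>emp_dev f0 (m n) n (h n - p) y\<bar> + rem n"
          unfolding lin_stat_def V_def rem_def
          by (rule lan_exponent_bound[OF exp_density_in_densities f0 _ p0 C approx[OF n]])
            (use w zn n \<alpha>[OF n] sB in \<open>auto simp: l1_err_def m_def s_def\<close>)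
        then show ?thesis using tR remn by linarith
      qed
      have shift: "l1_err f0 (w + s n *\<^sub>R h n) \<le> 2 * e n" if "l1_err f0 w \<le> e n" for w
        using l1_err_shift[OF hC, of "s n" f0 w] sB sh that by simp
      have S: "(s n)\<^sup>2 * (\<integral>\<omega>. (L n \<omega>)\<^sup>2 \<partial>M) \<le> 2 * \<delta>"
      proof -
        have "(s n)\<^sup>2 * (\<integral>\<omega>. (L n \<omega>)\<^sup>2 \<partial>M) \<le> (s n)\<^sup>2 * (m n * (z n)\<^sup>2)" using L(2)[OF n] by (intro mult_left_mono) auto
        also have "\<dots> = t\<^sup>2 * (z n)\<^sup>2" using s2[OF n] by (simp add: mult.assoc[symmetric])
        finally show ?thesis using tz by linarith
      qed
      have tl: "(\<integral>\<^sup>+\<omega>. ennreal (exp \<bar>s n * L n \<omega>\<bar>) * indicator {\<omega>. \<delta> < \<bar>s n * L n \<omega>\<bar>} \<omega> \<partial>post n y) \<le> ennreal \<delta>"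
        using H n by (simp add: k_def)
      have ms: "ennreal (1 - \<delta>) \<le> emeasure (post n y) {\<omega> \<in> space M. l1_err f0 (W \<omega>) \<le> e n}"
        using H by (simp add: near_def)
      show "ennreal (exp (t\<^sup>2 * V / 2 - 4 * \<delta>) * (1 - 2 * \<delta>)) \<le> laplace n y t \<and>
        laplace n y t \<le> ennreal (exp (t\<^sup>2 * V / 2 + 2 * \<delta>) * (exp \<delta> + \<delta>))"
        unfolding lapeq
        using laplace_sandwich[OF W L(1)[OF n] fin exponent shift S less_imp_le[OF \<delta>(1)] tl ms] by blast
    qed
  qed
qed

end

section \<open>The posterior conditioned on the L1 ball\<close>

context bvm_setting
begin

text \<open>The Laplace transform is controlled only on the ball, whereas the distance criterion
  asks for probability measures; hence the normalisation by the mass of the ball.\<close>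

definition cond_law :: "nat \<Rightarrow> (nat \<Rightarrow> unit_interval) \<Rightarrow> real measure"
  where "cond_law n y = distr (density (post n y)
    (\<lambda>\<omega>. indicator (near (2 * e n)) \<omega> / emeasure (post n y) (near (2 * e n)))) borel (stat n y)"

lemma stat_meas_post [measurable]: "stat n y \<in> borel_measurable (post n y)"
  by measurable

lemma cond_law_mgf:
  assumes "emeasure (post n y) (near (2 * e n)) \<noteq> 0"
  shows "(\<integral>\<^sup>+x. ennreal (exp (t * x)) \<partial>cond_law n y) = laplace n y t / emeasure (post n y) (near (2 * e n))"
proof -
  have "(\<integral>\<^sup>+x. ennreal (exp (t * x)) \<partial>cond_law n y)
    = (\<integral>\<^sup>+\<omega>. indicator (near (2 * e n)) \<omega> / emeasure (post n y) (near (2 * e n)) * ennreal (exp (t * stat n y \<omega>)) \<partial>post n y)"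
    unfolding cond_law_def by (simp add: nn_integral_distr nn_integral_density)
  also have "\<dots> = (\<integral>\<^sup>+\<omega>. ennreal (exp (t * stat n y \<omega>)) * indicator (near (2 * e n)) \<omega> / emeasure (post n y) (near (2 * e n)) \<partial>post n y)"
    by (intro nn_integral_cong) (simp add: divide_ennreal_def mult_ac)
  also have "\<dots> = laplace n y t / emeasure (post n y) (near (2 * e n))"
    unfolding laplace_def by (rule nn_integral_divide) measurable
  finally show ?thesis .
qed

lemma real_distribution_cond_law:
  assumes fin: "evidence M W (\<alpha> n) f0 n y \<noteq> \<infinity>" and nz: "emeasure (post n y) (near (2 * e n)) \<noteq> 0"
  shows "real_distribution (cond_law n y)"
proof -
  interpret P: prob_space "post n y" by (rule prob_space_posterior_elem[OF prob_M W_meas fin])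
  have "(\<integral>\<^sup>+\<omega>. indicator (near (2 * e n)) \<omega> / emeasure (post n y) (near (2 * e n)) \<partial>post n y)
      = emeasure (post n y) (near (2 * e n)) / emeasure (post n y) (near (2 * e n))"
    by (subst nn_integral_divide) auto
  also have "\<dots> = 1" using nz by (intro ennreal_divide_self) (auto simp: P.emeasure_eq_measure)
  finally have "prob_space (density (post n y) (\<lambda>\<omega>. indicator (near (2 * e n)) \<omega> / emeasure (post n y) (near (2 * e n))))"
    by (intro prob_spaceI) (simp add: emeasure_density cong: nn_integral_cong_simp)
  then show ?thesis
    unfolding cond_law_def by (rule prob_space.real_distribution_distr) simp
qed

lemma V_nonneg: "0 \<le> V"
  unfolding V_def by (intro integral_nonneg_AE AE_I2 mult_nonneg_nonneg densityD(1)[OF f0]) auto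

text \<open>A fixed accuracy requires only finitely many arguments t and one tolerance, so the
  convergence of each transform in probability suffices. Conditioning divides by a mass between 1 -
  d and 1 and affects only the upper bound.\<close>

lemma cond_law_d_BL_whp:
  assumes mass: "\<And>\<delta>. 0 < \<delta> \<Longrightarrow> whp (data_law f0) (\<lambda>n y. ennreal (1 - \<delta>) \<le> emeasure (post n y) (near (e n)))"
    and \<delta>: "0 < \<delta>"
  shows "whp (data_law f0) (\<lambda>n y. d_BL (cond_law n y) (gaussian 0 V) \<le> ennreal \<delta>)"
proof -
  obtain T \<eta> where T: "finite T" "0 < \<eta>"
    and close: "\<And>Q. real_distribution Q \<Longrightarrow> (\<forall>t\<in>T. mgf_close V \<eta> t Q) \<Longrightarrow> d_BL Q (gaussian 0 V) \<le> ennreal \<delta>"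
    using mgf_close_imp_d_BL_le[OF V_nonneg \<delta>] by blast
  have each: "whp (data_law f0) (\<lambda>n y. evidence M W (\<alpha> n) f0 n y \<noteq> \<infinity> \<and> emeasure (post n y) (near (2 * e n)) \<noteq> 0 \<and> mgf_close V \<eta> t (cond_law n y))" for t
  proof -
    define E where "E = t\<^sup>2 * V / 2"
    have "((\<lambda>d. exp (E - 4 * d) * (1 - 2 * d)) \<longlongrightarrow> exp (E - 4 * 0) * (1 - 2 * 0)) (at_right 0)"
      by (intro tendsto_intros)
    then have "\<forall>\<^sub>F d in at_right 0. exp E - \<eta> < exp (E - 4 * d) * (1 - 2 * d)"
      using T by (intro order_tendstoD(1)) auto
    moreover have "((\<lambda>d. exp (E + 2 * d) * (exp d + d) / (1 - d)) \<longlongrightarrow> exp (E + 2 * 0) * (exp 0 + 0) / (1 - 0)) (at_right 0)"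
      by (intro tendsto_intros) auto
    then have "\<forall>\<^sub>F d in at_right 0. exp (E + 2 * d) * (exp d + d) / (1 - d) < exp E + \<eta>"
      using T by (intro order_tendstoD(2)) auto
    moreover have "\<forall>\<^sub>F d in at_right 0. (0::real) < d \<and> d < 1"
      by (subst eventually_at_right[of 0 1]) (auto intro!: exI[of _ "1::real"])
    ultimately have "\<forall>\<^sub>F d in at_right 0. exp E - \<eta> < exp (E - 4 * d) * (1 - 2 * d) \<and>
        exp (E + 2 * d) * (exp d + d) / (1 - d) < exp E + \<eta> \<and> 0 < d \<and> d < 1"
      by eventually_elim simp
    \<comment> \<open>Both sandwich bounds tend to exp E as d decreases to 0, so one d serves the
      tolerance on both sides.\<close>
    then obtain d where d: "exp E - \<eta> < exp (E - 4 * d) * (1 - 2 * d)"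
      "exp (E + 2 * d) * (exp d + d) / (1 - d) < exp E + \<eta>" "0 < d" "d < 1"
      using eventually_happens'[OF trivial_limit_at_right_real] by blast
    show ?thesis
    proof (rule whp_mono[OF whp_conj[OF laplace_whp[OF mass d(3,4), of t] mass[OF d(3)]]])
      show "\<forall>\<^sub>F n in sequentially. \<forall>y\<in>space (data_law f0 n).
        (ennreal (exp (t\<^sup>2 * V / 2 - 4 * d) * (1 - 2 * d)) \<le> laplace n y t \<and> laplace n y t \<le> ennreal (exp (t\<^sup>2 * V / 2 + 2 * d) * (exp d + d))) \<and>
        ennreal (1 - d) \<le> emeasure (post n y) (near (e n)) \<longrightarrow>
        evidence M W (\<alpha> n) f0 n y \<noteq> \<infinity> \<and> emeasure (post n y) (near (2 * e n)) \<noteq> 0 \<and> mgf_close V \<eta> t (cond_law n y)"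
        using eventually_ge_at_top[of 1]
      proof (eventually_elim, intro ballI impI)
        fix n y assume n: "1 \<le> n"
          and H: "(ennreal (exp (t\<^sup>2 * V / 2 - 4 * d) * (1 - 2 * d)) \<le> laplace n y t \<and> laplace n y t \<le> ennreal (exp (t\<^sup>2 * V / 2 + 2 * d) * (exp d + d))) \<and>
            ennreal (1 - d) \<le> emeasure (post n y) (near (e n))"
        have fin: "evidence M W (\<alpha> n) f0 n y \<noteq> \<infinity>"
        proof
          assume "evidence M W (\<alpha> n) f0 n y = \<infinity>"
          from emeasure_posterior_elem_infinite_evidence[OF W_meas near_sets this] H d show False by auto
        qed
        interpret P: prob_space "post n y" by (rule prob_space_posterior_elem[OF prob_M W_meas fin])
        define q where "q = measure (post n y) (near (2 * e n))"
        have eq: "emeasure (post n y) (near (2 * e n)) = ennreal q" by (simp add: q_def P.emeasure_eq_measure)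
        have "near (e n) \<subseteq> near (2 * e n)" using e_pos[OF n] by (auto simp: near_def)
        then have "emeasure (post n y) (near (e n)) \<le> ennreal q" unfolding eq[symmetric] by (intro emeasure_mono) auto
        with H have "ennreal (1 - d) \<le> ennreal q" by (meson order_trans)
        then have q: "1 - d \<le> q" "0 < q" "q \<le> 1"
          using d P.prob_le_1 by (auto simp: q_def)
        have nz: "emeasure (post n y) (near (2 * e n)) \<noteq> 0" using q by (simp add: eq)
        have lo: "ennreal (exp E - \<eta>) \<le> laplace n y t / ennreal q"
        proof -
          have "ennreal (exp E - \<eta>) \<le> laplace n y t"
            using H d(1) unfolding E_def[symmetric] by (meson ennreal_leI less_imp_le order_trans)
          also have "\<dots> = laplace n y t / 1" by (simp add: divide_ennreal_def)
          also have "\<dots> \<le> laplace n y t / ennreal q"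
            unfolding divide_ennreal_def using q
            by (intro mult_left_mono) (auto simp: inverse_ennreal ennreal_1[symmetric] field_simps simp del: ennreal_1)
          finally show ?thesis .
        qed
        have hi: "laplace n y t / ennreal q \<le> ennreal (exp E + \<eta>)"
        proof -
          have "laplace n y t / ennreal q \<le> ennreal (exp (E + 2 * d) * (exp d + d)) / ennreal q"
            unfolding divide_ennreal_def using H by (intro mult_right_mono) (auto simp: E_def)
          also have "\<dots> = ennreal (exp (E + 2 * d) * (exp d + d) / q)"
            using q d by (intro divide_ennreal) auto
          also have "\<dots> \<le> ennreal (exp (E + 2 * d) * (exp d + d) / (1 - d))"
            using q d by (intro ennreal_leI divide_left_mono) auto
          also have "\<dots> \<le> ennreal (exp E + \<eta>)" using d by (intro ennreal_leI) auto
          finally show ?thesis .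
        qed
        show "evidence M W (\<alpha> n) f0 n y \<noteq> \<infinity> \<and> emeasure (post n y) (near (2 * e n)) \<noteq> 0 \<and> mgf_close V \<eta> t (cond_law n y)"
          unfolding mgf_close_def cond_law_mgf[OF nz] using fin nz lo hi by (simp add: E_def eq)
      qed
    qed
  qed
  \<comment> \<open>The set \<open>T\<close> may be empty; adding 0 keeps the statements on evidence
    and mass available.\<close>
  have "whp (data_law f0) (\<lambda>n y. \<forall>t\<in>insert 0 T. evidence M W (\<alpha> n) f0 n y \<noteq> \<infinity> \<and> emeasure (post n y) (near (2 * e n)) \<noteq> 0 \<and> mgf_close V \<eta> t (cond_law n y))"
    by (rule whp_ball_finite) (use T each in auto)
  then show ?thesis
    by (rule whp_mono) (auto intro!: always_eventually close real_distribution_cond_law)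
qed

text \<open>Replacing X by the linear statistic costs \<delta> on \<open>B\<close> by the Lipschitz
  property and 2 \<delta> off \<open>B\<close> by boundedness. Passing to the conditioned law costs
  twice the mass outside the ball, again at most 2 \<delta>.\<close>

lemma test_integral_diff:
  assumes fin: "evidence M W (\<alpha> n) f0 n y \<noteq> \<infinity>" and n: "n \<ge> 1"
    and B [measurable]: "B \<in> sets M" and Bn: "B \<subseteq> near (2 * e n)"
    and mass: "1 - \<delta> \<le> measure (post n y) B" and \<delta>: "0 < \<delta>" "\<delta> < 1"
    and X [measurable]: "X \<in> borel_measurable M" and XB: "\<And>\<omega>. \<omega> \<in> B \<Longrightarrow> \<bar>X \<omega> - stat n y \<omega>\<bar> \<le> \<delta>"
    and g: "\<And>x. \<bar>g x\<bar> \<le> 1" "1-lipschitz_on UNIV (g :: real \<Rightarrow> real)"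
  shows "\<bar>(\<integral>\<omega>. g (X \<omega>) \<partial>post n y) - (\<integral>x. g x \<partial>cond_law n y)\<bar> \<le> 5 * \<delta>"
proof -
  interpret P: prob_space "post n y" by (rule prob_space_posterior_elem[OF prob_M W_meas fin])
  note [measurable] = lipschitz_borel[OF g(2)]
  define q where "q = measure (post n y) (near (2 * e n))"
  have eq: "emeasure (post n y) (near (2 * e n)) = ennreal q" by (simp add: q_def P.emeasure_eq_measure)
  have "measure (post n y) B \<le> q" unfolding q_def by (rule P.finite_measure_mono[OF Bn]) simp
  then have q: "1 - \<delta> \<le> q" "0 < q" "q \<le> 1" using mass \<delta> by (auto simp: q_def)
  have pM: "measure (post n y) (space M) = 1" using P.prob_space by simp
  have ig: "integrable (post n y) (\<lambda>\<omega>. g (Z \<omega>))" if "Z \<in> borel_measurable M" for Z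
    by (rule P.integrable_const_bound[of _ 1]) (use g that in auto)
  have iB: "integrable (post n y) (\<lambda>\<omega>. indicator S \<omega> :: real)" if "S \<in> sets M" for S
    using that by (intro P.integrable_const_bound[of _ 1]) (auto simp: indicator_def)
  have mB: "(\<integral>\<omega>. indicator S \<omega> \<partial>post n y) = measure (post n y) S" if "S \<in> sets M" for S
    using that sets.sets_into_space[OF that] by (simp add: Int_absorb2)
  have cl: "(\<integral>x. g x \<partial>cond_law n y) = (\<integral>\<omega>. (indicator (near (2 * e n)) \<omega> / q) * g (stat n y \<omega>) \<partial>post n y)"
  proof -
    have dens: "(\<lambda>\<omega>. indicator (near (2 * e n)) \<omega> / emeasure (post n y) (near (2 * e n)))
      = (\<lambda>\<omega>. ennreal (indicator (near (2 * e n)) \<omega> / q))"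
      using q by (auto simp: eq indicator_def divide_ennreal[of 1 q, simplified] fun_eq_iff)
    have "(\<integral>x. g x \<partial>cond_law n y) = (\<integral>\<omega>. g (stat n y \<omega>) \<partial>density (post n y) (\<lambda>\<omega>. ennreal (indicator (near (2 * e n)) \<omega> / q)))"
      unfolding cond_law_def dens by (rule integral_distr) measurable
    also have "\<dots> = (\<integral>\<omega>. (indicator (near (2 * e n)) \<omega> / q) *\<^sub>R g (stat n y \<omega>) \<partial>post n y)"
      by (rule integral_density) (use q in auto)
    finally show ?thesis by simp
  qed
  have i2: "integrable (post n y) (\<lambda>\<omega>. (indicator (near (2 * e n)) \<omega> / q) * g (stat n y \<omega>))"
    by (rule P.integrable_const_bound[of _ "1 / q"])
      (use g q in \<open>auto simp: indicator_def divide_right_mono\<close>)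
  have 1: "\<bar>(\<integral>\<omega>. g (X \<omega>) \<partial>post n y) - (\<integral>\<omega>. g (stat n y \<omega>) \<partial>post n y)\<bar> \<le> 3 * \<delta>"
  proof -
    have "\<bar>(\<integral>\<omega>. g (X \<omega>) \<partial>post n y) - (\<integral>\<omega>. g (stat n y \<omega>) \<partial>post n y)\<bar> = \<bar>\<integral>\<omega>. g (X \<omega>) - g (stat n y \<omega>) \<partial>post n y\<bar>"
      using ig by simp
    also have "\<dots> \<le> (\<integral>\<omega>. \<bar>g (X \<omega>) - g (stat n y \<omega>)\<bar> \<partial>post n y)" by (rule integral_abs_bound)
    also have "\<dots> \<le> (\<integral>\<omega>. \<delta> + 2 * (1 - indicator B \<omega>) \<partial>post n y)"
    proof (rule integral_mono)
      fix \<omega>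
      show "\<bar>g (X \<omega>) - g (stat n y \<omega>)\<bar> \<le> \<delta> + 2 * (1 - indicator B \<omega>)"
      proof (cases "\<omega> \<in> B")
        case True
        have "\<bar>g (X \<omega>) - g (stat n y \<omega>)\<bar> \<le> \<bar>X \<omega> - stat n y \<omega>\<bar>"
          using lipschitz_onD[OF g(2), of "X \<omega>" "stat n y \<omega>"] by (simp add: dist_real_def)
        then show ?thesis using XB[OF True] True by simp
      next
        case False
        then show ?thesis using g(1)[of "X \<omega>"] g(1)[of "stat n y \<omega>"] \<delta> by simp
      qed
    qed (use ig iB in auto)
    also have "\<dots> = \<delta> + 2 * (1 - measure (post n y) B)"
      using iB[OF B] mB[OF B] by (simp add: pM)
    also have "\<dots> \<le> 3 * \<delta>" using mass by (simp add: algebra_simps)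
    finally show ?thesis .
  qed
  have 2: "\<bar>(\<integral>\<omega>. g (stat n y \<omega>) \<partial>post n y) - (\<integral>x. g x \<partial>cond_law n y)\<bar> \<le> 2 * \<delta>"
  proof -
    have "\<bar>(\<integral>\<omega>. g (stat n y \<omega>) \<partial>post n y) - (\<integral>x. g x \<partial>cond_law n y)\<bar>
      = \<bar>\<integral>\<omega>. g (stat n y \<omega>) - (indicator (near (2 * e n)) \<omega> / q) * g (stat n y \<omega>) \<partial>post n y\<bar>"
      unfolding cl using ig[OF stat_meas] i2 by simp
    also have "\<dots> \<le> (\<integral>\<omega>. \<bar>g (stat n y \<omega>) - (indicator (near (2 * e n)) \<omega> / q) * g (stat n y \<omega>)\<bar> \<partial>post n y)"
      by (rule integral_abs_bound)
    \<comment> \<open>The integrand is at most 1 off the ball and 1/q - 1 on it, written as one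
      expression; it integrates to 2 (1 - q).\<close>
    also have "\<dots> \<le> (\<integral>\<omega>. 1 + (1 / q - 2) * indicator (near (2 * e n)) \<omega> \<partial>post n y)"
    proof (rule integral_mono)
      fix \<omega>
      have "\<bar>g (stat n y \<omega>) - g (stat n y \<omega>) / q\<bar> \<le> 1 / q - 1"
      proof -
        have "g (stat n y \<omega>) - g (stat n y \<omega>) / q = - (g (stat n y \<omega>) * (1 / q - 1))" by (simp add: algebra_simps)
        then have "\<bar>g (stat n y \<omega>) - g (stat n y \<omega>) / q\<bar> = \<bar>g (stat n y \<omega>)\<bar> * \<bar>1 / q - 1\<bar>" by (simp add: abs_mult)
        also have "\<dots> \<le> 1 * \<bar>1 / q - 1\<bar>" by (intro mult_right_mono g) simp
        also have "\<dots> = 1 / q - 1" using q by simp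
        finally show ?thesis .
      qed
      then show "\<bar>g (stat n y \<omega>) - (indicator (near (2 * e n)) \<omega> / q) * g (stat n y \<omega>)\<bar> \<le> 1 + (1 / q - 2) * indicator (near (2 * e n)) \<omega>"
        using g(1) by (auto simp: indicator_def)
    qed (use ig i2 iB in auto)
    also have "\<dots> = 1 + (1 / q - 2) * q"
      using iB[OF near_sets] mB[OF near_sets] by (simp add: pM q_def)
    also have "\<dots> = 2 * (1 - q)" using q by (simp add: left_diff_distrib)
    also have "\<dots> \<le> 2 * \<delta>" using q by simp
    finally show ?thesis .
  qed
  show ?thesis using abs_triangle_ineq[of "(\<integral>\<omega>. g (X \<omega>) \<partial>post n y) - (\<integral>\<omega>. g (stat n y \<omega>) \<partial>post n y)"
      "(\<integral>\<omega>. g (stat n y \<omega>) \<partial>post n y) - (\<integral>x. g x \<partial>cond_law n y)"] 1 2 by simp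
qed

end

section \<open>The theorem\<close>

theorem theorem2p10:
  fixes M :: "'w measure" and W :: "'w \<Rightarrow> C01"
    and f0 \<psi>t :: C01
    and \<alpha> \<epsilon> \<zeta> :: "nat \<Rightarrow> real"
    and \<psi> :: "C01 \<Rightarrow> real" and r :: "C01 \<Rightarrow> C01 \<Rightarrow> real"
    and A :: "nat \<Rightarrow> C01 set"
    and \<psi>s :: "nat \<Rightarrow> C01"
  defines "prior \<equiv> density_prior M W"
  defines "\<psi>hat \<equiv> \<lambda>n y. \<psi> f0 + (1 / real n) * (\<Sum>i<n. \<psi>t (y i))"
  assumes f0_density: "f0 \<in> densities"
    and f0_bounded_away: "\<exists>c>0. \<forall>x. c \<le> f0 x"
    and \<alpha>_range: "\<And>n. n \<ge> 1 \<Longrightarrow> 0 < \<alpha> n \<and> \<alpha> n \<le> 1"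
    and n\<alpha>_infinity: "filterlim (\<lambda>n. real n * \<alpha> n) at_top sequentially"
    and W_gaussian: "centered_gaussian_element M W"
    and \<epsilon>_tendsto: "\<epsilon> \<longlonglongrightarrow> 0"
    and concentration: "\<And>n. n \<ge> 1 \<Longrightarrow>
      concentration_fun M W (log_density f0) (\<epsilon> n) \<le> ereal (real n * \<alpha> n * (\<epsilon> n)\<^sup>2)"
    and \<psi>_measurable: "\<psi> \<in> borel_measurable density_space"
    and expansion: "\<And>f. f \<in> densities \<Longrightarrow>
      \<psi> f - \<psi> f0 = (\<integral>x. \<psi>t x * f x \<partial>leb01) + r f f0"
    and \<psi>t_centered: "(\<integral>x. \<psi>t x * f0 x \<partial>leb01) = 0"
    and A_measurable: "\<And>n. n \<ge> 1 \<Longrightarrow> A n \<in> sets density_space"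
    and A_subset: "\<And>n. n \<ge> 1 \<Longrightarrow>
      A n \<subseteq> {f \<in> densities. (\<integral>x. \<bar>f x - f0 x\<bar> \<partial>leb01) \<le> \<epsilon> n}"
    and remainder: "small_o_P (data_law f0) (\<lambda>n y. SUP f\<in>A n. ennreal \<bar>r f f0\<bar>)
      (\<lambda>n. 1 / sqrt (real n * \<alpha> n))"
    and A_posterior: "small_o_P (data_law f0)
      (\<lambda>n y. ennreal \<bar>measure (frac_posterior (\<alpha> n) prior n y) (A n) - 1\<bar>) (\<lambda>_. 1)"
    and \<psi>s_rkhs: "\<And>n. n \<ge> 1 \<Longrightarrow> \<psi>s n \<in> rkhs M W"
    and \<zeta>_tendsto: "\<zeta> \<longlonglongrightarrow> 0"
    and \<psi>s_approx: "\<And>n. n \<ge> 1 \<Longrightarrow> norm (\<psi>s n - \<psi>t) \<le> \<zeta> n"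
    and \<psi>s_norm: "\<And>n. n \<ge> 1 \<Longrightarrow> rkhs_norm M W (\<psi>s n) \<le> sqrt (real n * \<alpha> n) * \<zeta> n"
    and rate: "(\<lambda>n. sqrt (real n * \<alpha> n) * \<epsilon> n * \<zeta> n) \<longlonglongrightarrow> 0"
  shows "weakly_converges_in_prob (data_law f0)
    (\<lambda>n y. distr (frac_posterior (\<alpha> n) prior n y) borel
       (\<lambda>f. sqrt (real n * \<alpha> n) * (\<psi> f - \<psi>hat n y)))
    (gaussian 0 (\<integral>x. (\<psi>t x)\<^sup>2 * f0 x \<partial>leb01))"
proof -
  obtain c where c: "0 < c" "\<And>x. c \<le> apply_bcontfun f0 x" using f0_bounded_away by blast
  have M: "prob_space M" and Wm [measurable]: "W \<in> borel_measurable M"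
    using W_gaussian unfolding centered_gaussian_element_def by auto
  define mm where "mm n = real n * \<alpha> n" for n
  have mp: "0 < mm n" if "n \<ge> 1" for n using \<alpha>_range[OF that] that by (simp add: mm_def)
  have \<zeta>_nonneg: "0 \<le> \<zeta> n" if "n \<ge> 1" for n using order_trans[OF norm_ge_zero \<psi>s_approx[OF that]] .
  \<comment> \<open>The enlarged rate has to meet three demands. As d tends to 0, sqrt m * e >= 1 /
    sqrt d tends to infinity. As 1 / sqrt m <= d, the new term in e is at most sqrt d. As \<zeta> <=
    d, its product with sqrt m * \<zeta> is at most sqrt d as well.\<close>
  define d where "d n = \<zeta> n + 1 / sqrt (mm n)" for n
  define e where "e n = max \<bar>\<epsilon> n\<bar> (1 / sqrt (d n) / sqrt (mm n))" for n
  have dp: "0 < d n" if "n \<ge> 1" for n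
    using mp[OF that] \<zeta>_nonneg[OF that] by (simp add: d_def add_nonneg_pos)
  have sm_top: "filterlim (\<lambda>n. sqrt (mm n)) at_top sequentially"
    unfolding mm_def by (rule filterlim_compose[OF sqrt_at_top n\<alpha>_infinity])
  have "(\<lambda>n. 1 / sqrt (mm n)) \<longlonglongrightarrow> 0"
    by (rule tendsto_divide_0[OF tendsto_const filterlim_at_top_imp_at_infinity[OF sm_top]])
  from tendsto_add[OF \<zeta>_tendsto this] have d0: "d \<longlonglongrightarrow> 0" by (simp add: d_def[abs_def])
  have sd0: "(\<lambda>n. sqrt (d n)) \<longlonglongrightarrow> 0" using tendsto_real_sqrt[OF d0] by simp
  have K1: "1 / sqrt (d n) / sqrt (mm n) \<le> sqrt (d n)" and K2: "1 / sqrt (d n) * \<zeta> n \<le> sqrt (d n)" if n: "n \<ge> 1" for n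
  proof -
    have dd: "d n / sqrt (d n) = sqrt (d n)" using dp[OF n] by (simp add: real_div_sqrt)
    have "1 / sqrt (mm n) / sqrt (d n) \<le> d n / sqrt (d n)"
      using dp[OF n] \<zeta>_nonneg[OF n] by (intro divide_right_mono) (auto simp: d_def)
    then show "1 / sqrt (d n) / sqrt (mm n) \<le> sqrt (d n)" unfolding dd by (simp add: mult.commute)
    have "\<zeta> n / sqrt (d n) \<le> d n / sqrt (d n)"
      using dp[OF n] mp[OF n] by (intro divide_right_mono) (auto simp: d_def)
    then show "1 / sqrt (d n) * \<zeta> n \<le> sqrt (d n)" unfolding dd by simp
  qed
  have e_pos: "0 < e n" if "n \<ge> 1" for n
    using dp[OF that] mp[OF that] by (simp add: e_def less_max_iff_disj)
  have me: "sqrt (mm n) * e n = max (sqrt (mm n) * \<bar>\<epsilon> n\<bar>) (1 / sqrt (d n))" if n: "n \<ge> 1" for n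
    using mp[OF n] by (simp add: e_def max_mult_distrib_left)
  have setting: "bvm_setting M W f0 \<psi>t c \<alpha> e \<zeta> \<psi>s"
  proof
    show "e \<longlonglongrightarrow> 0"
    proof (rule tendsto_sandwich[OF _ _ tendsto_const])
      show "\<forall>\<^sub>F n in sequentially. 0 \<le> e n" by (simp add: e_def le_max_iff_disj)
      show "\<forall>\<^sub>F n in sequentially. e n \<le> \<bar>\<epsilon> n\<bar> + sqrt (d n)"
        using eventually_ge_at_top[of 1]
      proof eventually_elim
        case (elim n)
        then show ?case using K1[OF elim] dp[OF elim] by (auto simp: e_def)
      qed
      show "(\<lambda>n. \<bar>\<epsilon> n\<bar> + sqrt (d n)) \<longlonglongrightarrow> 0"
        using tendsto_add[OF tendsto_rabs[OF \<epsilon>_tendsto] sd0] by simp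
    qed
    have "filterlim (\<lambda>n. sqrt (d n)) (at_right 0) sequentially"
      by (rule tendsto_imp_filterlim_at_right[OF sd0])
        (use eventually_ge_at_top[of 1] in \<open>eventually_elim, simp add: dp\<close>)
    then have Ktop: "filterlim (\<lambda>n. 1 / sqrt (d n)) at_top sequentially"
      using filterlim_compose[OF filterlim_inverse_at_top_right] by (simp add: inverse_eq_divide)
    show "filterlim (\<lambda>n. sqrt (real n * \<alpha> n) * e n) at_top sequentially"
      by (rule filterlim_at_top_mono[OF Ktop])
        (use eventually_ge_at_top[of 1] in \<open>eventually_elim, simp add: me flip: mm_def\<close>)
    show "(\<lambda>n. sqrt (real n * \<alpha> n) * e n * \<zeta> n) \<longlonglongrightarrow> 0"
    proof (rule tendsto_sandwich[OF _ _ tendsto_const])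
      show "\<forall>\<^sub>F n in sequentially. 0 \<le> sqrt (real n * \<alpha> n) * e n * \<zeta> n"
        using eventually_ge_at_top[of 1]
        by eventually_elim (use mp \<zeta>_nonneg e_pos in \<open>auto simp: mm_def[symmetric] less_imp_le intro!: mult_nonneg_nonneg\<close>)
      show "\<forall>\<^sub>F n in sequentially. sqrt (real n * \<alpha> n) * e n * \<zeta> n \<le> \<bar>sqrt (real n * \<alpha> n) * \<epsilon> n * \<zeta> n\<bar> + sqrt (d n)"
        using eventually_ge_at_top[of 1]
      proof eventually_elim
        case (elim n)
        have "sqrt (mm n) * e n * \<zeta> n = max (sqrt (mm n) * \<bar>\<epsilon> n\<bar> * \<zeta> n) (1 / sqrt (d n) * \<zeta> n)"
          unfolding me[OF elim] using \<zeta>_nonneg[OF elim] by (simp add: max_mult_distrib_right)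
        moreover have "sqrt (mm n) * \<bar>\<epsilon> n\<bar> * \<zeta> n = \<bar>sqrt (mm n) * \<epsilon> n * \<zeta> n\<bar>"
          using \<zeta>_nonneg[OF elim] mp[OF elim] by (simp add: abs_mult)
        ultimately show ?case
          using K2[OF elim] dp[OF elim] by (simp add: mm_def[symmetric])
      qed
      show "(\<lambda>n. \<bar>sqrt (real n * \<alpha> n) * \<epsilon> n * \<zeta> n\<bar> + sqrt (d n)) \<longlonglongrightarrow> 0"
        using tendsto_add[OF tendsto_rabs[OF rate] sd0] by simp
    qed
    fix n :: nat assume n: "1 \<le> n"
    show "0 < e n" by (rule e_pos[OF n])
    \<comment> \<open>Enlarging the rate is harmless: the claimed bound decreases and the ball
      grows.\<close>
    show "ennreal (exp (- (2 * (real n * \<alpha> n * (e n)\<^sup>2) + 1))) \<le> emeasure M {\<omega> \<in> space M. norm (W \<omega> - log_density f0) \<le> 2 * e n}"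
    proof -
      have "(\<epsilon> n)\<^sup>2 \<le> (e n)\<^sup>2" using power_mono[of "\<bar>\<epsilon> n\<bar>" "e n" 2] by (simp add: e_def)
      then have "mm n * (\<epsilon> n)\<^sup>2 \<le> mm n * (e n)\<^sup>2" using mp[OF n] by (intro mult_left_mono) auto
      then have "exp (- (2 * (mm n * (e n)\<^sup>2) + 1)) \<le> exp (- 2 * (mm n * (\<epsilon> n)\<^sup>2) - 1)" by simp
      then have "ennreal (exp (- (2 * (mm n * (e n)\<^sup>2) + 1))) \<le> ennreal (exp (- 2 * (mm n * (\<epsilon> n)\<^sup>2) - 1))"
        by (rule ennreal_leI)
      also have "\<dots> \<le> emeasure M {\<omega> \<in> space M. norm (W \<omega> - log_density f0) \<le> 2 * \<epsilon> n}"
        using prior_mass_lower_bound[OF W_gaussian concentration[OF n]] by (simp add: mm_def)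
      also have "\<dots> \<le> emeasure M {\<omega> \<in> space M. norm (W \<omega> - log_density f0) \<le> 2 * e n}"
      proof (rule emeasure_mono)
        have "\<epsilon> n \<le> e n" by (auto simp: e_def le_max_iff_disj)
        then show "{\<omega> \<in> space M. norm (W \<omega> - log_density f0) \<le> 2 * \<epsilon> n} \<subseteq> {\<omega> \<in> space M. norm (W \<omega> - log_density f0) \<le> 2 * e n}"
          by auto
        have "(\<lambda>\<omega>. norm (W \<omega> - log_density f0)) \<in> borel_measurable M"
          by (rule measurable_compose[OF Wm]) (intro borel_measurable_continuous_onI continuous_intros)
        then show "{\<omega> \<in> space M. norm (W \<omega> - log_density f0) \<le> 2 * e n} \<in> sets M" by measurable
      qed
      finally show ?thesis by (simp add: mm_def)
    qed
    show "\<exists>L. rkhs_representer M W (\<psi>s n) L \<and> (\<integral>\<omega>. (L \<omega>)\<^sup>2 \<partial>M) \<le> real n * \<alpha> n * (\<zeta> n)\<^sup>2"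
    proof -
      obtain L where L: "rkhs_representer M W (\<psi>s n) L" using \<psi>s_rkhs[OF n] by (auto simp: rkhs_def)
      have "sqrt (\<integral>\<omega>. (L \<omega>)\<^sup>2 \<partial>M) \<le> sqrt (mm n) * \<zeta> n"
        using \<psi>s_norm[OF n] unfolding rkhs_norm_eq[OF Wm L] mm_def .
      from power_mono[OF this, of 2] have "(\<integral>\<omega>. (L \<omega>)\<^sup>2 \<partial>M) \<le> mm n * (\<zeta> n)\<^sup>2"
        using mp[OF n] by (simp add: power_mult_distrib)
      then show ?thesis using L by (auto simp: mm_def)
    qed
    show "\<bar>\<psi>s n x - \<psi>t x\<bar> \<le> \<zeta> n" for x
      using order_trans[OF norm_bounded[of "\<psi>s n - \<psi>t" x] \<psi>s_approx[OF n]] by simp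
    show "0 < \<alpha> n \<and> \<alpha> n \<le> 1" by (rule \<alpha>_range[OF n])
  qed (use W_gaussian f0_density c n\<alpha>_infinity \<psi>t_centered \<zeta>_tendsto in auto)
  interpret bvm_setting M W f0 \<psi>t c \<alpha> e \<zeta> \<psi>s by (rule setting)
  have fm [measurable]: "(\<lambda>\<omega>. exp_density (W \<omega>)) \<in> measurable M density_space"
    by (rule measurable_compose[OF Wm measurable_exp_density_space])
  have fmp: "(\<lambda>\<omega>. exp_density (W \<omega>)) \<in> measurable (post n y) density_space" for n y
    using fm by (simp add: measurable_cong_sets[OF sets_posterior_elem refl])
  have fp: "frac_posterior (\<alpha> n) prior n y = distr (post n y) density_space (\<lambda>\<omega>. exp_density (W \<omega>))" for n y
    unfolding prior_def by (rule frac_posterior_eq_distr[OF M Wm])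
  \<comment> \<open>The pullback of \<open>A n\<close> to the sample space, where the posterior is
    analysed.\<close>
  define B where "B n = {\<omega> \<in> space M. exp_density (W \<omega>) \<in> A n}" for n
  have Bs [measurable]: "B n \<in> sets M" if "n \<ge> 1" for n
    using measurable_sets[OF fm A_measurable[OF that]] by (simp add: B_def vimage_def Int_def conj_commute)
  have Bnear: "B n \<subseteq> near (e n)" if n: "n \<ge> 1" for n
  proof
    fix \<omega> assume "\<omega> \<in> B n"
    then have "\<omega> \<in> space M" "l1_err f0 (W \<omega>) \<le> \<epsilon> n" using A_subset[OF n] by (auto simp: B_def l1_err_def)
    moreover have "\<epsilon> n \<le> e n" by (auto simp: e_def le_max_iff_disj)
    ultimately show "\<omega> \<in> near (e n)" by (simp add: near_def)
  qed
  have mA: "measure (frac_posterior (\<alpha> n) prior n y) (A n) = measure (post n y) (B n)" if "n \<ge> 1" for n y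
    unfolding fp measure_distr[OF fmp A_measurable[OF that]]
    by (simp add: B_def vimage_def Int_def conj_commute)
  have massB: "whp (data_law f0) (\<lambda>n y. 1 - \<delta> \<le> measure (post n y) (B n))" if "0 < \<delta>" for \<delta>
  proof (rule whp_mono)
    show "whp (data_law f0) (\<lambda>n y. ennreal \<bar>measure (frac_posterior (\<alpha> n) prior n y) (A n) - 1\<bar> \<le> ennreal (\<delta> * 1))"
      using A_posterior that unfolding small_o_P_iff_whp by blast
    show "\<forall>\<^sub>F n in sequentially. \<forall>y\<in>space (data_law f0 n).
        ennreal \<bar>measure (frac_posterior (\<alpha> n) prior n y) (A n) - 1\<bar> \<le> ennreal (\<delta> * 1) \<longrightarrow> 1 - \<delta> \<le> measure (post n y) (B n)"
      using eventually_ge_at_top[of 1]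
    proof (eventually_elim, intro ballI impI)
      fix n y assume "1 \<le> n" "ennreal \<bar>measure (frac_posterior (\<alpha> n) prior n y) (A n) - 1\<bar> \<le> ennreal (\<delta> * 1)"
      then have "\<bar>measure (post n y) (B n) - 1\<bar> \<le> \<delta>" using that by (simp add: mA)
      then show "1 - \<delta> \<le> measure (post n y) (B n)" by linarith
    qed
  qed
  have mass: "whp (data_law f0) (\<lambda>n y. ennreal (1 - \<delta>) \<le> emeasure (post n y) (near (e n)))" if "0 < \<delta>" for \<delta>
  proof (rule whp_mono[OF massB[OF that]])
    show "\<forall>\<^sub>F n in sequentially. \<forall>y\<in>space (data_law f0 n).
        1 - \<delta> \<le> measure (post n y) (B n) \<longrightarrow> ennreal (1 - \<delta>) \<le> emeasure (post n y) (near (e n))"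
      using eventually_ge_at_top[of 1]
    proof (eventually_elim, intro ballI impI)
      fix n y assume n: "1 \<le> n" and "1 - \<delta> \<le> measure (post n y) (B n)"
      then have "ennreal (1 - \<delta>) \<le> ennreal (measure (post n y) (B n))" by (intro ennreal_leI)
      \<comment> \<open>Only an inequality: finiteness of the evidence is not yet known, and
        \<open>measure\<close> sends infinity to 0.\<close>
      also have "\<dots> \<le> emeasure (post n y) (B n)" unfolding measure_def by (simp add: ennreal_enn2real_if)
      also have "\<dots> \<le> emeasure (post n y) (near (e n))" by (rule emeasure_mono[OF Bnear[OF n]]) simp
      finally show "ennreal (1 - \<delta>) \<le> emeasure (post n y) (near (e n))" .
    qed
  qed
  show ?thesis
    unfolding weakly_converges_in_prob_def small_o_P_iff_whp
  proof (intro allI impI)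
    fix \<delta>0 :: real assume \<delta>0: "0 < \<delta>0"
    \<comment> \<open>The distance budget is 5 \<delta> for the comparison with the conditioned law
      plus half of \<delta>0 for the Gaussian limit; the cap 1/2 keeps the conditioning mass
      positive.\<close>
    define \<delta> where "\<delta> = min (\<delta>0 / 10) (1 / 2)"
    have \<delta>: "0 < \<delta>" "\<delta> < 1" "5 * \<delta> + \<delta>0 / 2 \<le> \<delta>0" using \<delta>0 by (auto simp: \<delta>_def)
    have rem: "whp (data_law f0) (\<lambda>n y. (SUP f\<in>A n. ennreal \<bar>r f f0\<bar>) \<le> ennreal (\<delta> * (1 / sqrt (real n * \<alpha> n))))"
      using remainder \<delta>(1) unfolding small_o_P_iff_whp by blast
    have half: "0 < \<delta>0 / 2" using \<delta>0 by simp
    show "whp (data_law f0) (\<lambda>n y. d_BL (distr (frac_posterior (\<alpha> n) prior n y) borel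
        (\<lambda>f. sqrt (real n * \<alpha> n) * (\<psi> f - \<psi>hat n y))) (gaussian 0 (\<integral>x. (\<psi>t x)\<^sup>2 * f0 x \<partial>leb01)) \<le> ennreal (\<delta>0 * 1))"
    proof (rule whp_mono[OF whp_conj[OF whp_conj[OF cond_law_d_BL_whp[OF mass half] massB[OF \<delta>(1)]] rem]])
      show "\<forall>\<^sub>F n in sequentially. \<forall>y\<in>space (data_law f0 n).
        (d_BL (cond_law n y) (gaussian 0 V) \<le> ennreal (\<delta>0 / 2) \<and> 1 - \<delta> \<le> measure (post n y) (B n)) \<and>
        (SUP f\<in>A n. ennreal \<bar>r f f0\<bar>) \<le> ennreal (\<delta> * (1 / sqrt (real n * \<alpha> n))) \<longrightarrow>
        d_BL (distr (frac_posterior (\<alpha> n) prior n y) borel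
        (\<lambda>f. sqrt (real n * \<alpha> n) * (\<psi> f - \<psi>hat n y))) (gaussian 0 (\<integral>x. (\<psi>t x)\<^sup>2 * f0 x \<partial>leb01)) \<le> ennreal (\<delta>0 * 1)"
        using eventually_ge_at_top[of 1]
      proof (eventually_elim, intro ballI impI)
        fix n y assume n: "1 \<le> n"
          and H: "(d_BL (cond_law n y) (gaussian 0 V) \<le> ennreal (\<delta>0 / 2) \<and> 1 - \<delta> \<le> measure (post n y) (B n)) \<and>
            (SUP f\<in>A n. ennreal \<bar>r f f0\<bar>) \<le> ennreal (\<delta> * (1 / sqrt (real n * \<alpha> n)))"
        define T where "T f = sqrt (real n * \<alpha> n) * (\<psi> f - \<psi>hat n y)" for f
        have Tm [measurable]: "T \<in> borel_measurable density_space" unfolding T_def using \<psi>_measurable by measurable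
        have TWm: "(\<lambda>\<omega>. T (exp_density (W \<omega>))) \<in> borel_measurable M" by measurable
        have fin: "evidence M W (\<alpha> n) f0 n y \<noteq> \<infinity>"
        proof
          assume "evidence M W (\<alpha> n) f0 n y = \<infinity>"
          from emeasure_posterior_elem_infinite_evidence[OF W_meas Bs[OF n] this] H \<delta> show False by (simp add: measure_def)
        qed
        have TX: "\<bar>T (exp_density (W \<omega>)) - stat n y \<omega>\<bar> \<le> \<delta>" if "\<omega> \<in> B n" for \<omega>
        proof -
          define f where "f = exp_density (W \<omega>)"
          have fA: "f \<in> A n" using that by (simp add: B_def f_def)
          have fd: "f \<in> densities" by (simp add: f_def exp_density_in_densities)
          have sp: "0 < sqrt (real n * \<alpha> n)" using mp[OF n] by (simp add: mm_def)
          have "ennreal \<bar>r f f0\<bar> \<le> (SUP f\<in>A n. ennreal \<bar>r f f0\<bar>)" by (rule SUP_upper[OF fA])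
          also have "\<dots> \<le> ennreal (\<delta> * (1 / sqrt (real n * \<alpha> n)))" by (rule conjunct2[OF H])
          finally have "\<bar>r f f0\<bar> \<le> \<delta> / sqrt (real n * \<alpha> n)" using \<delta> sp by simp
          then have rb: "sqrt (real n * \<alpha> n) * \<bar>r f f0\<bar> \<le> \<delta>" using sp by (simp add: field_simps)
          \<comment> \<open>The centring \<open>\<psi>hat\<close> removes \<open>\<psi> f0\<close>
            and subtracts the sample mean of \<open>\<psi>t\<close>, as the linear statistic does;
            only the scaled remainder survives, and it is bounded uniformly on
            \<open>A n\<close>.\<close>
          have "T f - stat n y \<omega> = sqrt (real n * \<alpha> n) * r f f0"
            using expansion[OF fd]
            unfolding T_def stat_def lin_stat_def m_def \<psi>hat_def f_def[symmetric] by (simp add: algebra_simps)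
          then show ?thesis using rb sp by (simp add: abs_mult f_def)
        qed
        show "d_BL (distr (frac_posterior (\<alpha> n) prior n y) borel
          (\<lambda>f. sqrt (real n * \<alpha> n) * (\<psi> f - \<psi>hat n y))) (gaussian 0 (\<integral>x. (\<psi>t x)\<^sup>2 * f0 x \<partial>leb01)) \<le> ennreal (\<delta>0 * 1)"
          unfolding V_def[symmetric] T_def[symmetric]
        proof (rule d_BL_leI)
          fix g :: "real \<Rightarrow> real" assume g: "\<And>x. \<bar>g x\<bar> \<le> 1" "1-lipschitz_on UNIV g"
          note [measurable] = lipschitz_borel[OF g(2)]
          have "distr (frac_posterior (\<alpha> n) prior n y) borel T = distr (post n y) borel (\<lambda>\<omega>. T (exp_density (W \<omega>)))"
            unfolding fp using distr_distr[OF Tm fmp] by (simp add: comp_def)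
          then have I: "(\<integral>x. g x \<partial>distr (frac_posterior (\<alpha> n) prior n y) borel T) = (\<integral>\<omega>. g (T (exp_density (W \<omega>))) \<partial>post n y)"
            using TWm by (simp add: integral_distr)
          have near2: "B n \<subseteq> near (2 * e n)" using Bnear[OF n] e_pos[OF n] by (auto simp: near_def)
          have 1: "\<bar>(\<integral>\<omega>. g (T (exp_density (W \<omega>))) \<partial>post n y) - (\<integral>x. g x \<partial>cond_law n y)\<bar> \<le> 5 * \<delta>"
            by (rule test_integral_diff[OF fin n Bs[OF n] near2 _ \<delta>(1,2) TWm TX g]) (use H in auto)
          have 2: "\<bar>(\<integral>x. g x \<partial>cond_law n y) - (\<integral>x. g x \<partial>gaussian 0 V)\<bar> \<le> \<delta>0 / 2"
            by (rule d_BL_leD[OF _ _ g]) (use H \<delta>0 in auto)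
          show "\<bar>(\<integral>x. g x \<partial>distr (frac_posterior (\<alpha> n) prior n y) borel T) - (\<integral>x. g x \<partial>gaussian 0 V)\<bar> \<le> \<delta>0 * 1"
            unfolding I using 1 2 \<delta>(3) by linarith
        qed
      qed
    qed
  qed
qed

end
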